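(* Let $\mathcal C$ be a constraint that is admissible for $[0,1]$. There is a constant $d^{\mathcal C}$, independent of $n$, such that as $n\to\infty$ $$\frac{\operatorname{vol}_{n-k}(\mathcal M_n^{\mathcal C}([0,1]))}{\operatorname{vol}_n(\mathcal M_n([0,1]))}=\frac{\big((m_{i_k+1}^+-m_{i_k+1}^-)(\mu^{\mathcal C})\big)^{n-i_k}\,n^{k/2}\,(2\pi)^{k/2}/\sqrt{d^{\mathcal C}}}{4^{-i_k(i_k-3)/2}\,4^{-i_kn}\,(\sqrt{\pi/4})^{i_k}}\,(1+o(1)).$$ Consequently, this ratio is $\mathcal O(e^{-cn})$ for some $c>0$ if $\mu^0\notin\mathcal P^{\mathcal C}([0,1])$, and it is $\mathcal O(n^{k/2})$ if $\mu^0\in\mathcal P^{\mathcal C}([0,1])$.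
   Context: For a Borel set $E\subset\mathbb R$, $\mathcal P(E)$ is the set of Borel probability measures on $E$ possessing moments of all orders, $m_j(\mu):=\int x^j\,d\mu(x)$, and $\mathcal M_n(E):=\{(m_1(\mu),\dots,m_n(\mu)):\mu\in\mathcal P(E)\}$. A constraint $\mathcal C=\{m_{i_1}=c_{i_1},\dots,m_{i_k}=c_{i_k}\}$ consists of finitely many integers $1\le i_1<\dots<i_k$ and real values $c_{i_1},\dots,c_{i_k}$; $k=0$ (no constraint) is allowed, with $i_k:=0$. Put $\mathcal P^{\mathcal C}(E):=\{\mu\in\mathcal P(E): m_{i_j}(\mu)=c_{i_j},\ 1\le j\le k\}$ and $\mathcal M^{\mathcal C}_n(E):=\{(m_1(\mu),\dots,m_n(\mu)):\mu\in\mathcal P^{\mathcal C}(E)\}$. $\mathcal C$ is admissible for $E$ if $\mathcal M^{\mathcal C}_{i_k}(E)\cap\operatorname{Int}\mathcal M_{i_k}(E)\neq\emptyset$ (automatic if $k=0$). $\operatorname{vol}_d$ is $d$-dimensional Lebesgue measure; $\operatorname{vol}_{n-k}(\mathcal M_n^{\mathcal C}([0,1]))$ means the $(n-k)$-dimensional Lebesgue measure of the projection of $\mathcal M_n^{\mathcal C}([0,1])$ to the unconstrained coordinates $(m_j,\ 1\le j\le n,\ j\neq i_1,\dots,i_k)$. $\mu^0(dx):=\frac{1}{\pi\sqrt{x(1-x)}}dx$ on $[0,1]$ is the arcsine distribution; $\mathcal K(\mu^0|\mu):=\int\log\frac{d\mu^0}{d\mu}\,d\mu^0$ if $\mu^0\ll\mu$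 and $\infty$ otherwise; $\mu^{\mathcal C}$ is the unique minimizer of $\mu\mapsto\mathcal K(\mu^0|\mu)$ over $\mathcal P^{\mathcal C}([0,1])$. Given $(m_1,\dots,m_l)\in\mathcal M_l([0,1])$, the set of $m_{l+1}$ with $(m_1,\dots,m_{l+1})\in\mathcal M_{l+1}([0,1])$ is an interval $[m_{l+1}^-,m_{l+1}^+]$ (for $l=0$ it is $[0,1]$). $(m_{i_k+1}^+-m_{i_k+1}^-)(\mu^{\mathcal C})$ is the length of this interval for $l=i_k$ and $(m_1,\dots,m_{i_k})=(m_1(\mu^{\mathcal C}),\dots,m_{i_k}(\mu^{\mathcal C}))$. *)

theory Defs
  imports "HOL-Probability.Probability" "HOL-Library.Landau_Symbols"
begin

definition moment :: "nat \<Rightarrow> real measure \<Rightarrow> real" where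
  "moment j \<mu> = (\<integral>x. x ^ j \<partial>\<mu>)"

text \<open>Points of $R^n$ are represented by extensional functions on the coordinate set \<open>{1..n}\<close>;
  the entry at \<open>j\<close> is the $j$-th moment.\<close>

definition moment_vector :: "nat \<Rightarrow> real measure \<Rightarrow> nat \<Rightarrow> real" where
  "moment_vector n \<mu> = (\<lambda>j\<in>{1..n}. moment j \<mu>)"

definition moment_measures :: "real set \<Rightarrow> real measure set" where
  "moment_measures E =
    {\<mu>. prob_space \<mu> \<and> sets \<mu> = sets (restrict_space borel E) \<and>
        (\<forall>j. integrable \<mu> (\<lambda>x. x ^ j))}"

definition moment_space :: "nat \<Rightarrow> real set \<Rightarrow> (nat \<Rightarrow> real) set" where
  "moment_space n E = moment_vector n ` moment_measures E"

text \<open>A constraint is a finite partial map: \<open>C i = Some c\<close> encodes the requirement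
  that the \<open>i\<close>-th moment equals \<open>c\<close>.\<close>

definition moment_constraint :: "(nat \<rightharpoonup> real) \<Rightarrow> bool" where
  "moment_constraint C \<longleftrightarrow> finite (dom C) \<and> 0 \<notin> dom C"

definition num_constraints :: "(nat \<rightharpoonup> real) \<Rightarrow> nat" where
  "num_constraints C = card (dom C)"

definition last_index :: "(nat \<rightharpoonup> real) \<Rightarrow> nat" where
  "last_index C = (if dom C = {} then 0 else Max (dom C))"

definition constrained_measures :: "(nat \<rightharpoonup> real) \<Rightarrow> real set \<Rightarrow> real measure set" where
  "constrained_measures C E =
    {\<mu> \<in> moment_measures E. \<forall>i c. C i = Some c \<longrightarrow> moment i \<mu> = c}"

definition constrained_moment_space :: "(nat \<rightharpoonup> real) \<Rightarrow> nat \<Rightarrow> real set \<Rightarrow> (nat \<Rightarrow> real) set" where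
  "constrained_moment_space C n E = moment_vector n ` constrained_measures C E"

definition admissible :: "(nat \<rightharpoonup> real) \<Rightarrow> real set \<Rightarrow> bool" where
  "admissible C E \<longleftrightarrow>
    constrained_moment_space C (last_index C) E \<inter>
      (product_topology (\<lambda>_. euclideanreal) {1..last_index C}) interior_of
        (moment_space (last_index C) E) \<noteq> {}"

definition free_coordinates :: "(nat \<rightharpoonup> real) \<Rightarrow> nat \<Rightarrow> nat set" where
  "free_coordinates C n = {1..n} - dom C"

definition vol :: "nat set \<Rightarrow> (nat \<Rightarrow> real) set \<Rightarrow> real" where
  "vol J A = measure (\<Pi>\<^sub>M j\<in>J. lborel) A"

definition constrained_volume :: "(nat \<rightharpoonup> real) \<Rightarrow> nat \<Rightarrow> real" where
  "constrained_volume C n =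
    vol (free_coordinates C n)
      ((\<lambda>m. restrict m (free_coordinates C n)) ` constrained_moment_space C n {0..1})"

definition volume_ratio :: "(nat \<rightharpoonup> real) \<Rightarrow> nat \<Rightarrow> real" where
  "volume_ratio C n = constrained_volume C n / vol {1..n} (moment_space n {0..1})"

definition arcsine :: "real measure" where
  "arcsine =
    density (restrict_space lborel {0..1}) (\<lambda>x. ennreal (1 / (pi * sqrt (x * (1 - x)))))"

text \<open>In the library, \<open>entropy_density (exp 1) \<mu> \<nu>\<close> is $\log (d\nu/d\mu)$ and
  \<open>KL_divergence (exp 1) \<mu> \<nu>\<close> is its integral with respect to \<open>\<nu>\<close>; note the order of the
  arguments. The Bochner integral of a non-integrable function is 0, so that case is treated
  separately: for probability measures the negative part of the integrand is always integrable,
  hence the integral is then $+\infty$.\<close>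

definition rel_entropy :: "real measure \<Rightarrow> real measure \<Rightarrow> ereal" where
  "rel_entropy \<nu> \<mu> =
    (if absolutely_continuous \<mu> \<nu> \<and> integrable \<nu> (entropy_density (exp 1) \<mu> \<nu>)
     then ereal (KL_divergence (exp 1) \<mu> \<nu>) else \<infinity>)"

definition entropy_minimizer :: "(nat \<rightharpoonup> real) \<Rightarrow> real measure" where
  "entropy_minimizer C =
    (THE \<mu>. is_arg_min (rel_entropy arcsine) (\<lambda>\<mu>. \<mu> \<in> constrained_measures C {0..1}) \<mu>)"

text \<open>For \<open>m\<close> in \<open>moment_space l {0..1}\<close>, the admissible values of the moment of order
  \<open>l + 1\<close>, and the end points of the interval they form.\<close>

definition next_moments :: "nat \<Rightarrow> (nat \<Rightarrow> real) \<Rightarrow> real set" where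
  "next_moments l m = {x. m(Suc l := x) \<in> moment_space (Suc l) {0..1}}"

definition upper_moment :: "nat \<Rightarrow> (nat \<Rightarrow> real) \<Rightarrow> real" where
  "upper_moment l m = Sup (next_moments l m)"

definition lower_moment :: "nat \<Rightarrow> (nat \<Rightarrow> real) \<Rightarrow> real" where
  "lower_moment l m = Inf (next_moments l m)"

definition moment_range :: "nat \<Rightarrow> real measure \<Rightarrow> real" where
  "moment_range l \<mu> =
    upper_moment l (moment_vector l \<mu>) - lower_moment l (moment_vector l \<mu>)"

end

theory Submission
  imports Defs "HOL-Complex_Analysis.Complex_Analysis" "HOL-Real_Asymp.Real_Asymp"
begin

text \<open>Substituting \<open>x = (1 + cos \<theta>) / 2\<close> turns power moments on \<open>{0..1}\<close> into trigonometric moments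
  of a symmetric measure on the circle, and the Szego recursion with coefficients
  \<open>a\<^sub>0, \<dots>, a\<^sub>n\<^sub>-\<^sub>1\<close> in \<open>{-1..1}\<close> parametrises the moment space. The range of the next moment has length
  \<open>R\<^sub>n = 4\<^sup>-\<^sup>n \<Prod>(1 - a\<^sub>j\<^sup>2)\<close>, and the next coefficient is an affine function of the next moment. Hence
  Fubini gives the volume of the constrained moment space exactly, as a product of Beta integrals
  times the integral of \<open>R\<^sub>i\<^sup>n\<^sup>-\<^sup>i\<close> over the slice of the \<open>i\<close>-th moment space, to which the Laplace method
  applies.

  Each interior moment vector is realised by a Bernstein-Szego measure, whose density with respect
  to the arcsine law is \<open>1 / p\<close> with \<open>p\<close> a positive polynomial of degree at most \<open>n\<close>, and the mean
  value property of \<open>ln \<bar>f\<bar>\<close> for holomorphic \<open>f\<close> gives \<open>\<integral>ln p = - ln (4\<^sup>n R\<^sub>n)\<close>. At a maximum of \<open>R\<^sub>i\<close> on the slice, the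
  polynomial involves only the constrained powers; by \<open>ln y \<le> y - 1\<close> the corresponding measure is
  then the unique entropy minimiser, and \<open>ln R\<^sub>i\<close> decays at least quadratically away from the
  maximum, which provides the dominating Gaussian for the Laplace method.\<close>

section \<open>The arcsine distribution and the mean value property\<close>

text \<open>The overview leaves open where the powers of n and 4 come from. With n = N + i, the Beta
  integrals of order below N cancel in the quotient of volumes, and those of orders N, ..., N + i -
  1 stay in the denominator. Each has size 4^(-N) N^(-1/2), while the slice, with its i - k free
  coordinates, contributes R^N N^(-(i-k)/2), where R is the maximal value of R_i. Together this is
  R^N 4^(i N) N^(k/2).

  The obstacle throughout is the boundary of the moment spaces, where an error vanishes and the
  recursion divides by zero. There the next moment is unique, so boundary fibres are null sets. A
  maximising sequence cannot degenerate either, because the errors decrease in the order and the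
  last one stays bounded below. In the interior every quantity is a rational function of the
  moments.\<close>

lemma space_arcsine [simp]: "space arcsine = {0..1}"
  and sets_arcsine: "sets arcsine = sets (restrict_space borel {0..1})"
  unfolding arcsine_def by (simp_all add: space_restrict_space sets_restrict_space)

lemma half_one_plus_cos: "(1 + cos \<phi>) / 2 \<in> {0..1::real}"
  using cos_ge_minus_one[of \<phi>] cos_le_one[of \<phi>] by (simp del: cos_ge_minus_one cos_le_one)

text \<open>On \<open>{-pi..0}\<close> the map (1 + cos \<phi>) / 2 is increasing, as the
  substitution rule asks. Since x (1 - x) = (sin \<phi> / 2)^2, the Jacobian -sin \<phi> / 2 cancels
  the arcsine density up to 1/pi.\<close>

lemma arcsine_nn_integral:
  assumes [measurable]: "f \<in> borel_measurable borel"
  shows "(\<integral>\<^sup>+x. f x \<partial>arcsine) =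
    (\<integral>\<^sup>+\<phi>. ennreal (1 / pi) * f ((1 + cos \<phi>) / 2) * indicator {-pi..0} \<phi> \<partial>lborel)"
proof -
  let ?g = "\<lambda>\<phi>. (1 + cos \<phi>) / 2"
  let ?F = "\<lambda>x. ennreal (1 / (pi * sqrt (x * (1 - x)))) * f x"
  have "(\<integral>\<^sup>+x. f x \<partial>arcsine) = (\<integral>\<^sup>+x. ?F x * indicator {0..1} x \<partial>lborel)"
    unfolding arcsine_def
    by (subst nn_integral_density)
       (auto simp: nn_integral_restrict_space ac_simps intro!: nn_integral_cong measurable_restrict_space1)
  also have "\<dots> = (\<integral>\<^sup>+x. ?F x * indicator {?g (-pi)..?g 0} x \<partial>lborel)"
    by simp
  also have "\<dots> = (\<integral>\<^sup>+\<phi>. ?F (?g \<phi>) * ennreal (- sin \<phi> / 2) * indicator {-pi..0} \<phi> \<partial>lborel)"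
  proof (rule nn_integral_substitution_aux)
    show "0 \<le> - sin x / 2" if "x \<in> {-pi..0}" for x
      using that sin_ge_zero[of "-x"] by auto
  qed (auto intro!: derivative_eq_intros continuous_intros)
  also have "\<dots> = (\<integral>\<^sup>+\<phi>. ennreal (1 / pi) * f (?g \<phi>) * indicator {-pi..0} \<phi> \<partial>lborel)"
  proof (rule nn_integral_cong_AE)
    \<comment> \<open>At both end points the density is 1/0 = 0 and the cancellation fails; they
      form a null set.\<close>
    have "AE \<phi> in lborel. \<phi> \<noteq> -pi \<and> \<phi> \<noteq> (0::real)"
      using AE_lborel_singleton[of "-pi"] AE_lborel_singleton[of 0] by eventually_elim simp
    then show "AE \<phi> in lborel. ?F (?g \<phi>) * ennreal (- sin \<phi> / 2) * indicator {-pi..0} \<phi> =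
        ennreal (1 / pi) * f (?g \<phi>) * indicator {-pi..0} \<phi>"
    proof eventually_elim
      case (elim \<phi>)
      show ?case
      proof (cases "\<phi> \<in> {-pi..0}")
        case True
        then have s: "sin \<phi> < 0" using elim sin_gt_zero[of "-\<phi>"] by auto
        have "?g \<phi> * (1 - ?g \<phi>) = (sin \<phi> / 2)\<^sup>2"
          by (simp add: sin_squared_eq power_divide) (simp add: field_simps power2_eq_square)
        then have q: "sqrt (?g \<phi> * (1 - ?g \<phi>)) = - sin \<phi> / 2"
          using s by simp
        have "ennreal (1 / (pi * sqrt (?g \<phi> * (1 - ?g \<phi>)))) * ennreal (- sin \<phi> / 2) = ennreal (1/pi)"
          unfolding q using s mult_pos_neg[OF pi_gt_zero s]
          by (subst ennreal_mult'[symmetric]) (auto simp: field_simps)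
        note this[symmetric]
        then show ?thesis by (simp only: mult.commute mult.left_commute)
      qed simp
    qed
  qed
  finally show ?thesis .
qed

interpretation arcsine: prob_space arcsine
proof
  have "(\<integral>\<^sup>+x. 1 \<partial>arcsine) = 1"
    by (subst arcsine_nn_integral) (simp_all add: nn_integral_cmult ennreal_mult[symmetric])
  then show "emeasure arcsine (space arcsine) = 1" by simp
qed

lemma uniform_measure_half_circle:
  "uniform_measure lborel {-pi..0} = density lborel (\<lambda>\<phi>. ennreal (1 / pi * indicator {-pi..0} \<phi>))"
proof -
  have "inverse (ennreal pi) = ennreal (inverse pi)" by (rule inverse_ennreal) simp
  then show ?thesis
    unfolding uniform_measure_def
    by (intro density_cong) (auto simp: divide_ennreal_def indicator_def divide_inverse)
qed

text \<open>Written as an image measure, the law transfers Bochner integrals without any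
  integrability assumption.\<close>

lemma arcsine_eq_distr:
  "arcsine = distr (uniform_measure lborel {-pi..0}) (restrict_space borel {0..1}) (\<lambda>\<phi>. (1 + cos \<phi>) / 2)"
  (is "_ = distr ?U ?R ?g")
proof (rule measure_eqI)
  show "sets arcsine = sets (distr ?U ?R ?g)" by (simp add: sets_arcsine)
next
  have [measurable]: "?g \<in> measurable borel ?R"
    by (rule measurable_restrict_space2) (use half_one_plus_cos in auto)
  fix A assume A: "A \<in> sets arcsine"
  then have A': "A \<in> sets borel" "A \<in> sets ?R" by (auto simp: sets_arcsine sets_restrict_space)
  note [measurable] = A'
  have "emeasure arcsine A = (\<integral>\<^sup>+x. indicator A x \<partial>arcsine)" using A by simp
  also have "\<dots> = (\<integral>\<^sup>+\<phi>. ennreal (1 / pi) * indicator A (?g \<phi>) * indicator {-pi..0} \<phi> \<partial>lborel)"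
    by (rule arcsine_nn_integral) simp
  also have "\<dots> = (\<integral>\<^sup>+\<phi>. indicator A (?g \<phi>) \<partial>?U)"
    unfolding uniform_measure_half_circle
    by (subst nn_integral_density) (auto intro!: nn_integral_cong simp: indicator_def)
  also have "\<dots> = (\<integral>\<^sup>+x. indicator A x \<partial>distr ?U ?R ?g)"
    by (subst nn_integral_distr) (auto)
  finally show "emeasure arcsine A = emeasure (distr ?U ?R ?g) A" using A' by simp
qed

lemma arcsine_integral:
  fixes f :: "real \<Rightarrow> real"
  assumes "f \<in> borel_measurable borel"
  shows "(\<integral>x. f x \<partial>arcsine) = (1 / pi) * (LBINT \<phi>:{-pi..0}. f ((1 + cos \<phi>) / 2))"
proof -
  let ?U = "uniform_measure lborel {-pi..(0::real)}" and ?g = "\<lambda>\<phi>::real. (1 + cos \<phi>) / 2"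
  have [measurable]: "?g \<in> measurable borel (restrict_space borel {0..1})"
    by (rule measurable_restrict_space2) (use half_one_plus_cos in auto)
  note assms[measurable]
  have "(\<integral>x. f x \<partial>arcsine) = (\<integral>\<phi>. f (?g \<phi>) \<partial>?U)"
    unfolding arcsine_eq_distr by (subst integral_distr) (auto intro!: measurable_restrict_space1)
  also have "\<dots> = (\<integral>\<phi>. (1 / pi) * (indicator {-pi..0} \<phi> * f (?g \<phi>)) \<partial>lborel)"
    unfolding uniform_measure_half_circle by (simp add: integral_density mult.assoc)
  finally show ?thesis
    by (simp add: set_lebesgue_integral_def)
qed

text \<open>Cauchy's formula gives the mean over the full circle; the symmetry of \<open>f\<close>
  makes \<open>Re (f (cis t))\<close> even, so with periodicity both halves contribute
  equally.\<close>

lemma mean_value_half_circle: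
  fixes f :: "complex \<Rightarrow> complex"
  assumes cont: "continuous_on (cball 0 1) f" and hol: "f holomorphic_on ball 0 1"
    and sym: "\<And>z. norm z = 1 \<Longrightarrow> f (cnj z) = cnj (f z)"
  shows "(LBINT \<phi>:{-pi..0}. Re (f (cis \<phi>))) = pi * Re (f 0)"
proof -
  have "((\<lambda>u. f u / (u - 0)) has_contour_integral (2 * of_real pi * \<i> * f 0)) (circlepath 0 1)"
    using cont hol by (intro Cauchy_integral_circlepath) auto
  then have ci: "((\<lambda>u. f u / u) has_contour_integral (2 * of_real pi * \<i> * f 0)) (part_circlepath 0 1 0 (2*pi))"
    by (simp add: circlepath_def)
  have "((\<lambda>t. f (0 + 1 * cis t) / (0 + 1 * cis t) * 1 * \<i> * cis t) has_integral 2 * of_real pi * \<i> * f 0) {0..2*pi}"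
    using ci by (subst (asm) has_contour_integral_part_circlepath_iff) auto
  then have "((\<lambda>t. \<i> * f (cis t)) has_integral 2 * of_real pi * \<i> * f 0) {0..2*pi}"
    by (rule has_integral_eq[rotated]) (auto simp: field_simps)
  then have "((\<lambda>t. - \<i> * (\<i> * f (cis t))) has_integral (- \<i> * (2 * of_real pi * \<i> * f 0))) {0..2*pi}"
    by (rule has_integral_mult_right)
  then have "((\<lambda>t. f (cis t)) has_integral (2 * of_real pi * f 0)) {0..2*pi}"
    by (simp add: mult.assoc[symmetric]) (simp add: algebra_simps)?
  from has_integral_linear[OF this bounded_linear_Re]
  have full: "((\<lambda>t. Re (f (cis t))) has_integral (2 * pi * Re (f 0))) {0..2*pi}"
    by (simp add: o_def)
  define h where "h t = Re (f (cis t))" for t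
  have hc: "continuous_on A h" for A
  proof -
    have "continuous_on UNIV (\<lambda>t. f (cis t))"
      by (rule continuous_on_compose2[OF cont]) (auto intro!: continuous_intros)
    then show ?thesis unfolding h_def by (auto intro!: continuous_intros intro: continuous_on_subset)
  qed
  have hper: "h (t + 2 * pi) = h t" for t
    by (simp add: h_def cis_mult[symmetric] del: cis_mult)
  have heven: "h (- t) = h t" for t
  proof -
    have "cis (- t) = cnj (cis t)" by (simp add: cis_cnj)
    then show ?thesis using sym[of "cis t"] by (simp add: h_def)
  qed
  define I where "I = integral {-pi..0} h"
  have i1: "(h has_integral I) {-pi..0}" unfolding I_def
    by (intro integrable_integral integrable_continuous_real hc)
  have "((\<lambda>t. h (- t)) has_integral I) {- 0..- (- pi)}"
    using i1 by (subst has_integral_reflect_real)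
  then have i2: "(h has_integral I) {0..pi}" using heven by simp
  have "((\<lambda>t. h (t + (- 2*pi))) has_integral I) {-pi + 2*pi..0 + 2*pi}"
    using has_integral_affinity'[OF i1[unfolded cbox_interval[symmetric]], of 1 "-2*pi"] by simp
  moreover have "h (t + (- 2*pi)) = h t" for t using hper[of "t - 2*pi"] by simp
  ultimately have "(h has_integral I) {pi..2*pi}" by simp
  from has_integral_combine[OF _ _ i2 this] have "(h has_integral (I + I)) {0..2*pi}" by simp
  from has_integral_unique[OF this full[folded h_def]] have "I + I = 2 * pi * Re (f 0)" .
  moreover have "(LBINT \<phi>:{-pi..0}. h \<phi>) = I"
    unfolding I_def by (intro set_borel_integral_eq_integral borel_integrable_atLeastAtMost' hc)
  ultimately show ?thesis by (simp add: h_def)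
qed

section \<open>Chebyshev polynomials and trigonometric moments\<close>

text \<open>Chebyshev polynomials of the first kind shifted to the unit interval, T_n(2x -
  1).\<close>

fun cheb :: "nat \<Rightarrow> real poly" where
  "cheb 0 = 1"
| "cheb (Suc 0) = [:-1, 2:]"
| "cheb (Suc (Suc n)) = smult 2 ([:-1, 2:] * cheb (Suc n)) - cheb n"

lemma poly_cheb_cos: "poly (cheb n) ((1 + cos \<phi>) / 2) = cos (real n * \<phi>)"
proof (induction n rule: cheb.induct)
  case (3 n)
  have "cos (real (Suc (Suc n)) * \<phi>) = 2 * cos \<phi> * cos (real (Suc n) * \<phi>) - cos (real n * \<phi>)"
    using cos_add[of "real (Suc n) * \<phi>" \<phi>] cos_diff[of "real (Suc n) * \<phi>" \<phi>]
    by (simp add: algebra_simps)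
  then show ?case using 3 by (simp add: algebra_simps)
qed (simp_all add: add_divide_distrib)

lemma degree_cheb: "degree (cheb n) \<le> n"
proof (induction n rule: cheb.induct)
  case (3 n)
  have "degree ([:-1, 2:] * cheb (Suc n)) \<le> Suc (Suc n)"
    using degree_mult_le[of "[:-1, 2:]" "cheb (Suc n)"] 3 by simp
  then show ?case using 3 by (auto intro!: degree_diff_le intro: order_trans[OF degree_smult_le])
qed simp_all

text \<open>This leading coefficient is the source of the factor 4^n between the error of the
  recursion and the range of the next moment.\<close>

lemma coeff_cheb_Suc: "coeff (cheb (Suc n)) (Suc n) = 2 * 4 ^ n"
proof (induction n)
  case (Suc n)
  have "coeff (cheb (Suc n)) (Suc (Suc n)) = 0" "coeff (cheb n) (Suc (Suc n)) = 0"
    using degree_cheb[of "Suc n"] degree_cheb[of n] by (auto intro!: coeff_eq_0)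
  then show ?case using Suc by simp
qed simp

text \<open>The point of the upper half circle above 2x - 1. Outside \<open>{0..1}\<close> the value
  is unspecified but still of modulus 1, so the norm laws need no hypothesis on
  \<open>x\<close>.\<close>

definition circ :: "real \<Rightarrow> complex" where
  "circ x = cis (arccos (2 * x - 1))"

lemma norm_circ [simp]: "norm (circ x) = 1"
  by (simp add: circ_def)

lemma circ_cnj [simp]: "circ x * cnj (circ x) = 1" "cnj (circ x) * circ x = 1"
  by (simp_all add: circ_def cis_cnj cis_mult)

lemma circ_power_diff:
  "j \<le> n \<Longrightarrow> circ x ^ n * cnj (circ x) ^ j = circ x ^ (n - j)"
proof -
  assume "j \<le> n"
  then have "circ x ^ n * cnj (circ x) ^ j = circ x ^ (n - j) * (circ x ^ j * cnj (circ x) ^ j)"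
    by (simp add: power_add[symmetric] flip: mult.assoc)
  also have "circ x ^ j * cnj (circ x) ^ j = 1"
    by (simp add: power_mult_distrib[symmetric])
  finally show ?thesis by simp
qed

lemma continuous_on_circ [continuous_intros]: "continuous_on {0..1} circ"
  unfolding circ_def by (intro continuous_intros) auto

lemma poly_cheb: "x \<in> {0..1} \<Longrightarrow> poly (cheb n) x = Re (circ x ^ n)"
  using poly_cheb_cos[of n "arccos (2 * x - 1)"]
  by (simp add: circ_def cos_arccos cos_n_Re_cis_pow_n)

lemma circ_half_circle: "\<phi> \<in> {-pi..0} \<Longrightarrow> circ ((1 + cos \<phi>) / 2) = cnj (cis \<phi>)"
  using arccos_cos[of "-\<phi>"] by (simp add: circ_def cis_cnj field_simps)

section \<open>Probability measures on the unit interval and continuous integrands\<close>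

lemma moment_measuresD:
  assumes "\<mu> \<in> moment_measures {0..1}"
  shows "prob_space \<mu>" "sets \<mu> = sets (restrict_space borel {0..1})" "space \<mu> = {0..1}"
  using assms sets_eq_imp_space_eq[of \<mu> "restrict_space borel {0..1}"]
  by (auto simp: moment_measures_def space_restrict_space)

lemma moment_measures_measurable:
  assumes "\<mu> \<in> moment_measures {0..1}" "continuous_on {0..1} f"
  shows "f \<in> borel_measurable \<mu>"
  using borel_measurable_continuous_on_restrict[OF assms(2)] moment_measuresD(2)[OF assms(1)]
  by (simp cong: measurable_cong_sets)

lemma moment_measures_integrable:
  fixes f :: "real \<Rightarrow> real"
  assumes "\<mu> \<in> moment_measures {0..1}" "continuous_on {0..1} f"
  shows "integrable \<mu> f"
proof -
  interpret prob_space \<mu> by (rule moment_measuresD[OF assms(1)])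
  have "bounded (f ` {0..1})"
    by (intro compact_imp_bounded compact_continuous_image assms compact_Icc)
  then obtain B where "\<And>x. x \<in> {0..1} \<Longrightarrow> norm (f x) \<le> B"
    by (fastforce simp: bounded_iff)
  then show ?thesis
    by (intro integrable_const_bound[of _ B])
       (auto intro!: AE_I2 moment_measures_measurable assms simp: moment_measuresD[OF assms(1)])
qed

lemma moment_measuresI:
  assumes "prob_space \<mu>" "sets \<mu> = sets (restrict_space borel {0..1})"
  shows "\<mu> \<in> moment_measures {0..1}"
proof -
  interpret prob_space \<mu> by fact
  have sp: "space \<mu> = {0..1}"
    using sets_eq_imp_space_eq[OF assms(2)] by (simp add: space_restrict_space)
  have "integrable \<mu> (\<lambda>x. x ^ j)" for j
  proof (intro integrable_const_bound[of _ 1] AE_I2)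
    show "(\<lambda>x. x ^ j) \<in> borel_measurable \<mu>"
      by (subst measurable_cong_sets[OF assms(2) refl]) (intro measurable_restrict_space1, simp)
  qed (auto simp: sp power_le_one)
  with assms show ?thesis by (simp add: moment_measures_def)
qed

lemma arcsine_in_moment_measures: "arcsine \<in> moment_measures {0..1}"
  by (intro moment_measuresI arcsine.prob_space_axioms sets_arcsine)

text \<open>Evaluates integrals against the arcsine law at the centre of the disc. The symmetry of
  \<open>F\<close> also compensates that \<open>circ\<close> yields the conjugate of
  \<open>cis \<phi>\<close> for \<phi> in \<open>{-pi..0}\<close>.\<close>

lemma arcsine_mean_value:
  assumes cont: "continuous_on (cball 0 1) F" and hol: "F holomorphic_on ball 0 1"
    and sym: "\<And>z. norm z = 1 \<Longrightarrow> F (cnj z) = cnj (F z)"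
  shows "(\<integral>x. Re (F (circ x)) \<partial>arcsine) = Re (F 0)"
proof -
  \<comment> \<open>The cutoff makes the integrand Borel on the whole line, as
    \<open>arcsine_integral\<close> requires.\<close>
  let ?f = "\<lambda>x. indicator {0..1} x *\<^sub>R Re (F (circ x))"
  have c: "continuous_on {0..1} (\<lambda>x. Re (F (circ x)))"
    by (intro continuous_intros continuous_on_compose2[OF cont]) auto
  have m: "?f \<in> borel_measurable borel"
    using borel_measurable_continuous_on_restrict[OF c]
    by (subst (asm) borel_measurable_restrict_space_iff) auto
  have "(\<integral>x. Re (F (circ x)) \<partial>arcsine) = (\<integral>x. ?f x \<partial>arcsine)"
    by (intro Bochner_Integration.integral_cong) auto
  also have "\<dots> = (1 / pi) * (LBINT \<phi>:{-pi..0}. ?f ((1 + cos \<phi>) / 2))"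
    by (rule arcsine_integral[OF m])
  also have "(LBINT \<phi>:{-pi..0}. ?f ((1 + cos \<phi>) / 2)) = (LBINT \<phi>:{-pi..0}. Re (F (cis \<phi>)))"
  proof (rule set_lebesgue_integral_cong)
    show "\<forall>\<phi>. \<phi> \<in> {-pi..0} \<longrightarrow> ?f ((1 + cos \<phi>) / 2) = Re (F (cis \<phi>))"
      using half_one_plus_cos sym[of "cis _"]
      by (auto simp: circ_half_circle indicator_def)
  qed simp
  also have "\<dots> = pi * Re (F 0)"
    by (rule mean_value_half_circle[OF cont hol sym])
  finally show ?thesis by simp
qed

text \<open>The integral of \<open>p\<close> expressed through moments alone. The entry
  \<open>m 0\<close> is overridden by 1, because moment vectors start at coordinate 1.\<close>

definition moment_functional :: "(nat \<Rightarrow> real) \<Rightarrow> real poly \<Rightarrow> real" where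
  "moment_functional m p = (\<Sum>l\<le>degree p. coeff p l * (if l = 0 then 1 else m l))"

lemma moment_functional_altdef:
  "degree p \<le> n \<Longrightarrow> moment_functional m p = (\<Sum>l\<le>n. coeff p l * (if l = 0 then 1 else m l))"
  unfolding moment_functional_def by (intro sum.mono_neutral_left) (auto simp: coeff_eq_0)

lemma integral_poly:
  assumes "\<mu> \<in> moment_measures {0..1}" "degree p \<le> n" "\<And>j. 1 \<le> j \<Longrightarrow> j \<le> n \<Longrightarrow> m j = moment j \<mu>"
  shows "(\<integral>x. poly p x \<partial>\<mu>) = moment_functional m p"
proof -
  interpret prob_space \<mu> by (rule moment_measuresD[OF assms(1)])
  have "(\<integral>x. poly p x \<partial>\<mu>) = (\<Sum>l\<le>degree p. coeff p l * moment l \<mu>)"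
    using assms(1)
    by (simp add: poly_altdef moment_def Bochner_Integration.integral_sum moment_measures_def)
  also have "\<dots> = moment_functional m p"
    unfolding moment_functional_def using assms(2,3) prob_space
    by (intro sum.cong) (auto simp: moment_def)
  finally show ?thesis .
qed

definition trig_moment :: "(nat \<Rightarrow> real) \<Rightarrow> nat \<Rightarrow> real" where
  "trig_moment m j = moment_functional m (cheb j)"

lemma trig_moment_0 [simp]: "trig_moment m 0 = 1"
  by (simp add: trig_moment_def moment_functional_def)

lemma trig_moment_Suc:
  "trig_moment m (Suc n) = 2 * 4 ^ n * m (Suc n) +
     (\<Sum>l\<le>n. coeff (cheb (Suc n)) l * (if l = 0 then 1 else m l))"
  unfolding trig_moment_def
  by (subst moment_functional_altdef[OF degree_cheb]) (simp add: coeff_cheb_Suc)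

lemma trig_moment_cong:
  "(\<And>j. 1 \<le> j \<Longrightarrow> j \<le> n \<Longrightarrow> m j = m' j) \<Longrightarrow> trig_moment m n = trig_moment m' n"
  unfolding trig_moment_def
  by (simp add: moment_functional_altdef[OF degree_cheb]) (intro sum.cong, auto)

text \<open>The system is triangular with nonzero diagonal entries, so the moments are recovered one
  after the other.\<close>

lemma trig_moment_inj:
  assumes "\<And>j. j \<le> n \<Longrightarrow> trig_moment m j = trig_moment m' j" "1 \<le> j" "j \<le> n"
  shows "m j = m' j"
  using assms(2,3)
proof (induction j rule: less_induct)
  case (less j)
  then obtain k where k: "j = Suc k" by (cases j) auto
  have "(\<Sum>l\<le>k. coeff (cheb (Suc k)) l * (if l = 0 then 1 else m l)) =
        (\<Sum>l\<le>k. coeff (cheb (Suc k)) l * (if l = 0 then 1 else m' l))"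
    using less by (intro sum.cong) (auto simp: k)
  then show ?case using assms(1)[of j] less.prems by (simp add: k trig_moment_Suc)
qed

lemma trig_moment_measure:
  assumes "\<mu> \<in> moment_measures {0..1}" "\<And>j. 1 \<le> j \<Longrightarrow> j \<le> n \<Longrightarrow> m j = moment j \<mu>" "k \<le> n"
  shows "trig_moment m k = (\<integral>x. Re (circ x ^ k) \<partial>\<mu>)"
proof -
  have "trig_moment m k = (\<integral>x. poly (cheb k) x \<partial>\<mu>)"
    unfolding trig_moment_def using assms degree_cheb[of k] by (intro integral_poly[symmetric, of _ _ n]) auto
  also have "\<dots> = (\<integral>x. Re (circ x ^ k) \<partial>\<mu>)"
    by (intro Bochner_Integration.integral_cong)
       (auto simp: moment_measuresD[OF assms(1)] poly_cheb)
  finally show ?thesis .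
qed

section \<open>Real polynomials at complex arguments\<close>

abbreviation cpoly :: "real poly \<Rightarrow> complex \<Rightarrow> complex" where
  "cpoly p \<equiv> poly (map_poly complex_of_real p)"

lemma cpoly_simps [simp]:
  "cpoly (pCons a p) z = of_real a + z * cpoly p z"
  "cpoly (p - q) z = cpoly p z - cpoly q z"
  "cpoly (smult a p) z = of_real a * cpoly p z"
  "cpoly 1 z = 1"
proof -
  have "map_poly complex_of_real (p - q) = map_poly complex_of_real p - map_poly complex_of_real q"
    by (rule poly_eqI) (simp add: coeff_map_poly)
  then show "cpoly (p - q) z = cpoly p z - cpoly q z" by simp
  have "map_poly complex_of_real (smult a p) = smult (of_real a) (map_poly complex_of_real p)"
    by (rule poly_eqI) (simp add: coeff_map_poly)
  then show "cpoly (smult a p) z = of_real a * cpoly p z" by simp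
qed (simp_all add: map_poly_pCons)

lemma cpoly_altdef: "degree p \<le> n \<Longrightarrow> cpoly p z = (\<Sum>k\<le>n. of_real (coeff p k) * z ^ k)"
proof -
  assume "degree p \<le> n"
  then have "degree (map_poly complex_of_real p) \<le> n"
    by (intro degree_le) (auto simp: coeff_map_poly coeff_eq_0)
  then have "cpoly p z = (\<Sum>k\<le>n. coeff (map_poly complex_of_real p) k * z ^ k)"
    unfolding poly_altdef by (intro sum.mono_neutral_left) (auto simp: coeff_eq_0)
  then show ?thesis by (simp add: coeff_map_poly)
qed

lemma cpoly_cnj: "cpoly p (cnj z) = cnj (cpoly p z)"
  by (simp add: cpoly_altdef[OF order_refl])

lemma continuous_on_cpoly [continuous_intros]:
  "continuous_on A f \<Longrightarrow> continuous_on A (\<lambda>x. cpoly p (f x))"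
  by (rule continuous_on_poly)

lemma holomorphic_on_cpoly [holomorphic_intros]: "(\<lambda>z. cpoly p z) holomorphic_on A"
  by (intro holomorphic_intros)

section \<open>The Szego recursion\<close>

text \<open>If \<open>e = 0\<close>, then \<open>a = 0\<close> by the convention for division by zero, so the error stays \<open>0\<close> forever.\<close>

fun szego :: "(nat \<Rightarrow> real) \<Rightarrow> nat \<Rightarrow> real poly \<times> real poly \<times> real" where
  "szego t 0 = (1, 1, 1)"
| "szego t (Suc n) =
    (let (p, q, e) = szego t n; a = (\<Sum>k\<le>n. coeff p k * t (Suc k)) / e
     in (pCons 0 p - smult a q, q - smult a (pCons 0 p), e * (1 - a\<^sup>2)))"

text \<open>In the theory of orthogonal polynomials on the unit circle, \<open>Phi\<close> is the
  monic orthogonal polynomial, \<open>Psi\<close> its reversal, \<open>Err\<close> its squared norm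
  and \<open>verb\<close> the Verblunsky coefficient, real because the measures are symmetric under
  conjugation.\<close>

definition Phi where "Phi t n = fst (szego t n)"
definition Psi where "Psi t n = fst (snd (szego t n))"
definition Err where "Err t n = snd (snd (szego t n))"
definition verb where "verb t n = (\<Sum>k\<le>n. coeff (Phi t n) k * t (Suc k)) / Err t n"

lemma szego_0 [simp]: "Phi t 0 = 1" "Psi t 0 = 1" "Err t 0 = 1"
  by (simp_all add: Phi_def Psi_def Err_def)

lemma szego_Suc:
  "Phi t (Suc n) = pCons 0 (Phi t n) - smult (verb t n) (Psi t n)"
  "Psi t (Suc n) = Psi t n - smult (verb t n) (pCons 0 (Phi t n))"
  "Err t (Suc n) = Err t n * (1 - (verb t n)\<^sup>2)"
  by (simp_all add: Phi_def Psi_def Err_def verb_def Let_def case_prod_beta)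

lemma degree_szego: "degree (Phi t n) \<le> n" "degree (Psi t n) \<le> n"
proof (induction n)
  case (Suc n)
  { case 1 show ?case unfolding szego_Suc using Suc
      by (intro degree_diff_le order_trans[OF degree_smult_le] order_trans[OF degree_pCons_le]) auto }
  { case 2 show ?case unfolding szego_Suc using Suc
      by (intro degree_diff_le order_trans[OF degree_smult_le] order_trans[OF degree_pCons_le]) auto }
qed simp_all

lemma coeff_Phi_monic [simp]: "coeff (Phi t n) n = 1"
proof (induction n)
  case (Suc n)
  have "coeff (Psi t n) (Suc n) = 0" using degree_szego(2)[of t n] by (intro coeff_eq_0) simp
  then show ?case using Suc by (simp add: szego_Suc)
qed simp

lemma coeff_Psi_0 [simp]: "coeff (Psi t n) 0 = 1"
  by (induction n) (simp_all add: szego_Suc)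

lemma cpoly_Psi_0 [simp]: "cpoly (Psi t n) 0 = 1"
  by (simp add: poly_0_coeff_0 coeff_map_poly)

lemma szego_cong:
  assumes "\<And>j. j \<le> n \<Longrightarrow> t j = t' j"
  shows "szego t n = szego t' n"
  using assms
proof (induction n)
  case (Suc n)
  have "(\<Sum>k\<le>n. coeff p k * t (Suc k)) = (\<Sum>k\<le>n. coeff p k * t' (Suc k))" for p :: "real poly"
    using Suc.prems by (intro sum.cong) auto
  then show ?case using Suc by simp
qed simp

lemma Err_cong: "(\<And>j. j \<le> n \<Longrightarrow> t j = t' j) \<Longrightarrow> Err t n = Err t' n"
  using szego_cong[of n t t'] by (simp add: Err_def)

lemma Phi_Psi_cong:
  "(\<And>j. j \<le> n \<Longrightarrow> t j = t' j) \<Longrightarrow> Phi t n = Phi t' n \<and> Psi t n = Psi t' n"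
  using szego_cong[of n t t'] by (simp add: Phi_def Psi_def)

text \<open>On the circle \<open>cnj z\<close> is 1/z, so this identifies \<open>Psi\<close> as the
  reversed polynomial of \<open>Phi\<close>.\<close>

lemma cpoly_Psi_circle:
  assumes "norm z = 1"
  shows "cpoly (Psi t n) z = z ^ n * cnj (cpoly (Phi t n) z)"
proof (induction n)
  case (Suc n)
  have z: "z * cnj z = 1" using assms by (simp add: complex_norm_square[symmetric])
  have "z ^ n * cnj (cpoly (Psi t n) z) = (z ^ n * cnj z ^ n) * cpoly (Phi t n) z"
    by (simp add: Suc)
  also have "z ^ n * cnj z ^ n = 1" using z by (simp add: power_mult_distrib[symmetric])
  finally have "z ^ n * cnj (cpoly (Psi t n) z) = cpoly (Phi t n) z" by simp
  note rev = this
  have "z ^ Suc n * cnj (cpoly (Phi t (Suc n)) z) =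
      (z * cnj z) * (z ^ n * cnj (cpoly (Phi t n) z)) -
      of_real (verb t n) * z * (z ^ n * cnj (cpoly (Psi t n) z))"
    by (simp add: szego_Suc algebra_simps)
  also have "\<dots> = cpoly (Psi t (Suc n)) z"
    unfolding rev z by (simp add: szego_Suc Suc)
  finally show ?case by simp
qed simp

lemma Err_pos_imp_verb: "\<forall>j\<le>n. Err t j > 0 \<Longrightarrow> j < n \<Longrightarrow> \<bar>verb t j\<bar> < 1"
proof -
  assume *: "\<forall>j\<le>n. Err t j > 0" "j < n"
  then have "Err t j > 0" "Err t j * (1 - (verb t j)\<^sup>2) > 0"
    using szego_Suc(3)[of t j] by (metis less_imp_le, metis Suc_leI)
  then have "(verb t j)\<^sup>2 < 1" by (simp add: zero_less_mult_iff)
  then show ?thesis by (simp add: abs_square_less_1)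
qed

text \<open>The two claims need each other in the induction: with u = z Phi and v = Psi, the bound
  on |u| by |v| and |a| < 1 keep v - a u away from zero, and the bound is passed on by |v - a u|^2 -
  |u - a v|^2 = (1 - a^2) (|v|^2 - |u|^2).\<close>

lemma Psi_nonzero_disc:
  assumes "\<And>j. j < n \<Longrightarrow> \<bar>verb t j\<bar> < 1" "norm z \<le> 1"
  shows "cpoly (Psi t n) z \<noteq> 0 \<and> norm (cpoly (Phi t n) z) \<le> norm (cpoly (Psi t n) z)"
  using assms(1)
proof (induction n)
  case (Suc n)
  define a where "a = verb t n"
  define u where "u = z * cpoly (Phi t n) z"
  define v where "v = cpoly (Psi t n) z"
  have a: "\<bar>a\<bar> < 1" using Suc.prems by (simp add: a_def)
  have v: "v \<noteq> 0" and "norm (cpoly (Phi t n) z) \<le> norm v"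
    using Suc by (auto simp: v_def)
  then have uv: "norm u \<le> norm v"
    unfolding u_def norm_mult using assms(2) mult_mono[of "norm z" 1] by fastforce
  have "v - of_real a * u \<noteq> 0"
  proof
    assume "v - of_real a * u = 0"
    then have "norm v = \<bar>a\<bar> * norm u" by (simp add: norm_mult)
    also have "\<dots> \<le> \<bar>a\<bar> * norm v" using uv by (simp add: mult_left_mono)
    also have "\<dots> < norm v" using a v by simp
    finally show False by simp
  qed
  moreover have "(norm (u - of_real a * v))\<^sup>2 \<le> (norm (v - of_real a * u))\<^sup>2"
  proof -
    have "(norm (v - of_real a * u))\<^sup>2 - (norm (u - of_real a * v))\<^sup>2
        = (1 - a\<^sup>2) * ((norm v)\<^sup>2 - (norm u)\<^sup>2)"
      unfolding cmod_power2 by (simp add: power2_eq_square algebra_simps)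
    also have "\<dots> \<ge> 0"
      using a uv by (intro mult_nonneg_nonneg) (auto simp: abs_square_le_1 intro: power_mono)
    finally show ?thesis by simp
  qed
  then have "norm (u - of_real a * v) \<le> norm (v - of_real a * u)"
    by (rule power2_le_imp_le) simp
  ultimately show ?case by (simp add: szego_Suc u_def v_def a_def mult.left_commute)
qed simp

text \<open>Inner product of \<open>p\<close> and z^l for the symmetric lift of \<mu> to the circle:
  as \<open>p\<close> has real coefficients, the real part is the average over a point and its
  conjugate.\<close>

definition trig_inner :: "real measure \<Rightarrow> real poly \<Rightarrow> nat \<Rightarrow> real" where
  "trig_inner \<mu> p l = (\<integral>x. Re (cpoly p (circ x) * cnj (circ x) ^ l) \<partial>\<mu>)"

lemma trig_inner_integrable:
  "\<mu> \<in> moment_measures {0..1} \<Longrightarrow> integrable \<mu> (\<lambda>x. Re (cpoly p (circ x) * cnj (circ x) ^ l))"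
  by (intro moment_measures_integrable continuous_intros) auto

lemma trig_inner_lin:
  assumes "\<mu> \<in> moment_measures {0..1}"
  shows "trig_inner \<mu> (p - smult a q) l = trig_inner \<mu> p l - a * trig_inner \<mu> q l"
proof -
  have "trig_inner \<mu> (p - smult a q) l =
    (\<integral>x. Re (cpoly p (circ x) * cnj (circ x) ^ l) - a * Re (cpoly q (circ x) * cnj (circ x) ^ l) \<partial>\<mu>)"
    unfolding trig_inner_def by (intro Bochner_Integration.integral_cong) (auto simp: algebra_simps)
  then show ?thesis using trig_inner_integrable[OF assms] by (simp add: trig_inner_def)
qed

lemma trig_inner_shift: "trig_inner \<mu> (pCons 0 p) (Suc l) = trig_inner \<mu> p l"
proof -
  have "cpoly (pCons 0 p) (circ x) * cnj (circ x) ^ Suc l = cpoly p (circ x) * cnj (circ x) ^ l" for x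
  proof -
    have "cpoly (pCons 0 p) (circ x) * cnj (circ x) ^ Suc l =
        (circ x * cnj (circ x)) * (cpoly p (circ x) * cnj (circ x) ^ l)"
      by simp
    then show ?thesis by (simp only: circ_cnj mult_1_left)
  qed
  then show ?thesis unfolding trig_inner_def by (simp only:)
qed

text \<open>Reversal reflects the exponent: orthogonality of \<open>Phi\<close> to the powers 0,
  ..., n - 1 becomes orthogonality of \<open>Psi\<close> to the powers 1, ..., n.\<close>

lemma trig_inner_Psi:
  assumes "l \<le> n"
  shows "trig_inner \<mu> (Psi t n) l = trig_inner \<mu> (Phi t n) (n - l)"
proof -
  have "Re (cpoly (Psi t n) (circ x) * cnj (circ x) ^ l) =
        Re (cpoly (Phi t n) (circ x) * cnj (circ x) ^ (n - l))" for x
  proof -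
    have "cpoly (Psi t n) (circ x) * cnj (circ x) ^ l =
       (circ x ^ n * cnj (circ x) ^ l) * cnj (cpoly (Phi t n) (circ x))"
      by (subst cpoly_Psi_circle) simp_all
    also have "\<dots> = cnj (cpoly (Phi t n) (circ x) * cnj (circ x) ^ (n - l))"
      using assms by (simp add: circ_power_diff)
    finally show ?thesis by (metis cnj.simps(1))
  qed
  then show ?thesis by (simp add: trig_inner_def)
qed

text \<open>The first exponent beyond the reflection. The value is \<open>verb\<close> times
  \<open>Err\<close>, which produces the factor 1 - a^2 in the next error.\<close>

lemma trig_inner_Psi_Suc: "trig_inner \<mu> (Psi t n) (Suc n) = trig_inner \<mu> (pCons 0 (Phi t n)) 0"
proof -
  have "Re (cpoly (Psi t n) (circ x) * cnj (circ x) ^ Suc n) =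
        Re (circ x * cpoly (Phi t n) (circ x))" for x
  proof -
    have "cpoly (Psi t n) (circ x) * cnj (circ x) ^ Suc n =
       (circ x ^ n * cnj (circ x) ^ n) * (cnj (circ x) * cnj (cpoly (Phi t n) (circ x)))"
      by (subst cpoly_Psi_circle) simp_all
    also have "\<dots> = cnj (circ x * cpoly (Phi t n) (circ x))"
      by (simp add: circ_power_diff)
    finally show ?thesis by (metis cnj.simps(1))
  qed
  then show ?thesis by (simp add: trig_inner_def)
qed

lemma trig_inner_expand:
  assumes "\<mu> \<in> moment_measures {0..1}" "degree p \<le> n"
  shows "trig_inner \<mu> (pCons 0 p) 0 = (\<Sum>k\<le>n. coeff p k * (\<integral>x. Re (circ x ^ Suc k) \<partial>\<mu>))"
proof -
  have "trig_inner \<mu> (pCons 0 p) 0 = (\<integral>x. (\<Sum>k\<le>n. coeff p k * Re (circ x ^ Suc k)) \<partial>\<mu>)"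
    unfolding trig_inner_def
    by (intro Bochner_Integration.integral_cong)
       (auto simp: cpoly_altdef[OF assms(2)] sum_distrib_left algebra_simps)
  also have "\<dots> = (\<Sum>k\<le>n. coeff p k * (\<integral>x. Re (circ x ^ Suc k) \<partial>\<mu>))"
    by (subst Bochner_Integration.integral_sum)
       (auto intro!: moment_measures_integrable[OF assms(1)] continuous_intros simp del: power_Suc)
  finally show ?thesis .
qed

lemma integral_cpoly_norm:
  assumes "\<mu> \<in> moment_measures {0..1}" "degree p \<le> n"
  shows "(\<integral>x. (norm (cpoly p (circ x)))\<^sup>2 \<partial>\<mu>) = (\<Sum>k\<le>n. coeff p k * trig_inner \<mu> p k)"
proof -
  have "(norm (cpoly p (circ x)))\<^sup>2 = (\<Sum>k\<le>n. coeff p k * Re (cpoly p (circ x) * cnj (circ x) ^ k))" for x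
  proof -
    have "(norm (cpoly p (circ x)))\<^sup>2 = Re (cpoly p (circ x) * cnj (cpoly p (circ x)))"
      by (simp add: complex_norm_square[symmetric] del: of_real_power)
    also have "cnj (cpoly p (circ x)) = (\<Sum>k\<le>n. of_real (coeff p k) * cnj (circ x) ^ k)"
      by (simp add: cpoly_altdef[OF assms(2)])
    also have "cpoly p (circ x) * \<dots> = (\<Sum>k\<le>n. of_real (coeff p k) * (cpoly p (circ x) * cnj (circ x) ^ k))"
      by (simp add: sum_distrib_left mult_ac)
    finally show ?thesis by simp
  qed
  then show ?thesis
    unfolding trig_inner_def using trig_inner_integrable[OF assms(1)]
    by (simp add: Bochner_Integration.integral_sum del: Re_sum)
qed

text \<open>Shifting and reflecting settle every exponent from 1 to n. Only exponent 0 involves the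
  new moment, and \<open>verb\<close> is defined precisely so as to cancel it.\<close>

lemma Phi_orthogonal:
  assumes \<mu>: "\<mu> \<in> moment_measures {0..1}"
    and t: "\<And>j. j \<le> n \<Longrightarrow> t j = (\<integral>x. Re (circ x ^ j) \<partial>\<mu>)"
    and "\<And>j. j < n \<Longrightarrow> Err t j \<noteq> 0"
  shows "(\<forall>l<n. trig_inner \<mu> (Phi t n) l = 0) \<and> trig_inner \<mu> (Phi t n) n = Err t n"
  using t assms(3)
proof (induction n)
  case 0
  interpret prob_space \<mu> by (rule moment_measuresD[OF \<mu>])
  show ?case by (simp add: trig_inner_def prob_space)
next
  case (Suc n)
  let ?a = "verb t n" and ?E = "Err t n"
  have IH: "\<And>l. l < n \<Longrightarrow> trig_inner \<mu> (Phi t n) l = 0" "trig_inner \<mu> (Phi t n) n = ?E" and E: "?E \<noteq> 0"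
    using Suc by auto
  have "trig_inner \<mu> (pCons 0 (Phi t n)) 0 = (\<Sum>k\<le>n. coeff (Phi t n) k * t (Suc k))"
    unfolding trig_inner_expand[OF \<mu> degree_szego(1)] using Suc.prems(1) by (intro sum.cong) auto
  then have base: "trig_inner \<mu> (pCons 0 (Phi t n)) 0 = ?a * ?E"
    using E by (simp add: verb_def)
  have "trig_inner \<mu> (Phi t (Suc n)) l = 0" if "l < Suc n" for l
  proof (cases l)
    case 0
    then show ?thesis by (simp add: szego_Suc trig_inner_lin[OF \<mu>] base trig_inner_Psi IH)
  next
    case (Suc k)
    then show ?thesis using that
      by (simp add: szego_Suc trig_inner_lin[OF \<mu>] trig_inner_shift trig_inner_Psi IH)
  qed
  moreover have "trig_inner \<mu> (Phi t (Suc n)) (Suc n) = Err t (Suc n)"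
    by (simp add: szego_Suc trig_inner_lin[OF \<mu>] trig_inner_shift trig_inner_Psi_Suc IH base
        algebra_simps power2_eq_square)
  ultimately show ?case by blast
qed

text \<open>Orthogonality leaves only the top term of the squared norm, and \<open>Phi\<close> is
  monic.\<close>

lemma Err_eq_integral:
  assumes "\<mu> \<in> moment_measures {0..1}"
    and "\<And>j. j \<le> n \<Longrightarrow> t j = (\<integral>x. Re (circ x ^ j) \<partial>\<mu>)"
    and "\<And>j. j < n \<Longrightarrow> Err t j \<noteq> 0"
  shows "Err t n = (\<integral>x. (norm (cpoly (Phi t n) (circ x)))\<^sup>2 \<partial>\<mu>)"
proof -
  note o = Phi_orthogonal[OF assms]
  have "(\<Sum>k\<le>n. coeff (Phi t n) k * trig_inner \<mu> (Phi t n) k) = (\<Sum>k\<in>{n}. Err t n)"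
    using o by (intro sum.mono_neutral_cong_right) auto
  then show ?thesis using integral_cpoly_norm[OF assms(1) degree_szego(1)] by simp
qed

section \<open>Positivity of the errors and breakdown of the recursion\<close>

lemma Err_zero_stays: "Err t k = 0 \<Longrightarrow> k \<le> n \<Longrightarrow> Err t n = 0"
  by (induction n) (auto simp: szego_Suc le_Suc_eq)

lemma Err_nonneg:
  assumes "\<mu> \<in> moment_measures {0..1}"
    and "\<And>j. j \<le> n \<Longrightarrow> t j = (\<integral>x. Re (circ x ^ j) \<partial>\<mu>)"
  shows "Err t n \<ge> 0"
proof (cases "\<exists>j<n. Err t j = 0")
  case True
  then show ?thesis using Err_zero_stays[of t _ n] by force
next
  case False
  then show ?thesis using Err_eq_integral[OF assms] by auto
qed

lemma Err_antimono:
  assumes "Err t n \<ge> 0"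
  shows "Err t (Suc n) \<le> Err t n"
  using assms by (simp add: szego_Suc mult_left_le)

lemma verb_le_1:
  assumes "\<mu> \<in> moment_measures {0..1}"
    and "\<And>j. j \<le> Suc n \<Longrightarrow> t j = (\<integral>x. Re (circ x ^ j) \<partial>\<mu>)"
  shows "\<bar>verb t n\<bar> \<le> 1"
proof (cases "Err t n = 0")
  case False
  with Err_nonneg[of \<mu> n t] assms have "Err t n > 0" by force
  moreover have "Err t n * (1 - (verb t n)\<^sup>2) \<ge> 0"
    using Err_nonneg[OF assms(1), of "Suc n" t] assms(2) by (simp add: szego_Suc)
  ultimately have "(verb t n)\<^sup>2 \<le> 1" by (simp add: zero_le_mult_iff)
  then show ?thesis by (simp add: abs_square_le_1)
qed (simp add: verb_def)

text \<open>If the recursion breaks down at \<open>k\<close>, then \<open>\<mu>\<close> lives on the zeros of \<open>Phi t k\<close>; multiplying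
  the vanishing polynomial by powers of \<open>circ\<close> gives a linear recurrence for all later moments.\<close>

lemma degenerate_recurrence:
  assumes "\<mu> \<in> moment_measures {0..1}"
    and "\<And>j. j \<le> k \<Longrightarrow> t j = (\<integral>x. Re (circ x ^ j) \<partial>\<mu>)"
    and "\<And>j. j < k \<Longrightarrow> Err t j \<noteq> 0" "Err t k = 0"
  shows "(\<integral>x. Re (circ x ^ (k + d)) \<partial>\<mu>) =
    - (\<Sum>j<k. coeff (Phi t k) j * (\<integral>x. Re (circ x ^ (j + d)) \<partial>\<mu>))"
proof -
  have i: "integrable \<mu> (\<lambda>x. (norm (cpoly (Phi t k) (circ x)))\<^sup>2)"
    by (intro moment_measures_integrable[OF assms(1)] continuous_intros)
  have "(\<integral>x. (norm (cpoly (Phi t k) (circ x)))\<^sup>2 \<partial>\<mu>) = 0"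
    using Err_eq_integral[OF assms(1-3)] assms(4) by simp
  then have ae: "AE x in \<mu>. cpoly (Phi t k) (circ x) = 0"
    by (subst (asm) integral_nonneg_eq_0_iff_AE[OF i]) auto
  have i': "integrable \<mu> (\<lambda>x. Re (circ x ^ j))" for j
    by (intro moment_measures_integrable[OF assms(1)] continuous_intros)
  have "(\<integral>x. Re (circ x ^ d * cpoly (Phi t k) (circ x)) \<partial>\<mu>) = (\<integral>x. 0 \<partial>\<mu>)"
    using ae by (intro integral_cong_AE moment_measures_measurable[OF assms(1)] continuous_intros) auto
  moreover have "Re (circ x ^ d * cpoly (Phi t k) (circ x)) =
      (\<Sum>j\<le>k. coeff (Phi t k) j * Re (circ x ^ (j + d)))" for x
  proof -
    have "circ x ^ d * cpoly (Phi t k) (circ x) =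
      (\<Sum>j\<le>k. of_real (coeff (Phi t k) j) * circ x ^ (j + d))"
      by (simp add: cpoly_altdef[OF degree_szego(1)] sum_distrib_left power_add mult_ac)
    then show ?thesis by simp
  qed
  ultimately have "(\<Sum>j\<le>k. coeff (Phi t k) j * (\<integral>x. Re (circ x ^ (j + d)) \<partial>\<mu>)) = 0"
    using i' by (simp add: Bochner_Integration.integral_sum)
  then show ?thesis by (simp add: lessThan_Suc_atMost[symmetric])
qed

section \<open>Bernstein-Szego measures\<close>

text \<open>The function |Psi|^2 / Err on the circle, written as a polynomial in x: the real part of
  z^a times the conjugate of z^b is a Chebyshev polynomial of order |a - b|. This form also shows
  that the degree is at most \<open>n\<close>.\<close>

definition bs_poly :: "(nat \<Rightarrow> real) \<Rightarrow> nat \<Rightarrow> real poly" where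
  "bs_poly t n = smult (1 / Err t n)
     (\<Sum>a\<le>n. \<Sum>b\<le>n. smult (coeff (Psi t n) a * coeff (Psi t n) b) (cheb (nat \<bar>int a - int b\<bar>)))"

lemma degree_bs_poly: "degree (bs_poly t n) \<le> n"
  unfolding bs_poly_def
  by (intro order_trans[OF degree_smult_le] degree_sum_le order_trans[OF degree_cheb]) auto

lemma poly_bs_poly:
  assumes "x \<in> {0..1}"
  shows "poly (bs_poly t n) x = (norm (cpoly (Psi t n) (circ x)))\<^sup>2 / Err t n"
proof -
  have Re_pow: "Re (circ x ^ a * cnj (circ x) ^ b) = poly (cheb (nat \<bar>int a - int b\<bar>)) x" for a b
  proof (cases "b \<le> a")
    case True
    then have "nat \<bar>int a - int b\<bar> = a - b" by simp
    then show ?thesis by (simp only: circ_power_diff[OF True] poly_cheb[OF assms])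
  next
    case False
    then have "nat \<bar>int a - int b\<bar> = b - a" by simp
    moreover have "circ x ^ a * cnj (circ x) ^ b = cnj (circ x ^ (b - a))"
      using False by (simp add: circ_power_diff[symmetric] mult.commute)
    ultimately show ?thesis by (simp only: cnj.simps poly_cheb[OF assms])
  qed
  have "(norm (cpoly (Psi t n) (circ x)))\<^sup>2 =
      Re (cpoly (Psi t n) (circ x) * cnj (cpoly (Psi t n) (circ x)))"
    by (simp add: complex_norm_square[symmetric] del: of_real_power)
  also have "cpoly (Psi t n) (circ x) * cnj (cpoly (Psi t n) (circ x)) =
     (\<Sum>a\<le>n. \<Sum>b\<le>n. of_real (coeff (Psi t n) a * coeff (Psi t n) b) * (circ x ^ a * cnj (circ x) ^ b))"
    unfolding cpoly_altdef[OF degree_szego(2)] by (simp add: sum_product mult_ac)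
  also have "Re \<dots> = (\<Sum>a\<le>n. \<Sum>b\<le>n. (coeff (Psi t n) a * coeff (Psi t n) b) *
      poly (cheb (nat \<bar>int a - int b\<bar>)) x)"
    by (simp only: Re_sum Re_complex_of_real times_complex.sel Im_complex_of_real
        Re_pow[unfolded times_complex.sel] mult_zero_left diff_zero)
  finally show ?thesis by (simp add: bs_poly_def poly_sum)
qed

text \<open>No measure is given here. Positive errors up to order \<open>n\<close> are the data, and
  a measure with these moments is constructed from them in \<open>bs_measure\<close>.\<close>

locale regular_moments =
  fixes t :: "nat \<Rightarrow> real" and n :: nat
  assumes Err_pos: "j \<le> n \<Longrightarrow> Err t j > 0" and t_0: "t 0 = 1"
begin

lemma verb_less_1: "j < n \<Longrightarrow> \<bar>verb t j\<bar> < 1"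
  using Err_pos Err_pos_imp_verb by blast

lemma Psi_nonzero: "j \<le> n \<Longrightarrow> norm z \<le> 1 \<Longrightarrow> cpoly (Psi t j) z \<noteq> 0"
  and Phi_le_Psi: "j \<le> n \<Longrightarrow> norm z \<le> 1 \<Longrightarrow> norm (cpoly (Phi t j) z) \<le> norm (cpoly (Psi t j) z)"
  using Psi_nonzero_disc[of j t z] verb_less_1 by auto

lemma bs_poly_pos: "x \<in> {0..1} \<Longrightarrow> poly (bs_poly t n) x > 0"
  using Err_pos[of n] Psi_nonzero[of n "circ x"] by (simp add: poly_bs_poly)

text \<open>On the circle the integrand is \<open>Err\<close> times the real part of z^(n-l) / Psi,
  by the reversal identity. This is holomorphic in the disc because \<open>Psi\<close> has no zeros
  there, and at 0 it is 1 or 0 according to whether l = n.\<close>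

lemma integral_trig_bs:
  assumes "l \<le> n"
  shows "(\<integral>x. Re (cpoly (Phi t n) (circ x) * cnj (circ x) ^ l) / poly (bs_poly t n) x \<partial>arcsine) =
    (if l = n then Err t n else 0)"
proof -
  define F where "F z = z ^ (n - l) / cpoly (Psi t n) z" for z
  have "(\<integral>x. Re (F (circ x)) \<partial>arcsine) = Re (F 0)"
  proof (rule arcsine_mean_value)
    show "continuous_on (cball 0 1) F" "F holomorphic_on ball 0 1"
      unfolding F_def using Psi_nonzero[of n]
      by (auto intro!: continuous_intros holomorphic_intros)
    show "F (cnj z) = cnj (F z)" for z by (simp add: F_def cpoly_cnj)
  qed
  also have "Re (F 0) = (if l = n then 1 else 0)" using assms by (simp add: F_def power_0_left)
  finally have I: "(\<integral>x. Re (F (circ x)) \<partial>arcsine) = (if l = n then 1 else 0)" .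
  have "Re (cpoly (Phi t n) (circ x) * cnj (circ x) ^ l) / poly (bs_poly t n) x = Err t n * Re (F (circ x))"
    if "x \<in> {0..1}" for x
  proof -
    let ?c = "circ x" and ?\<Psi> = "cpoly (Psi t n) (circ x)"
    have nz: "?\<Psi> \<noteq> 0" using Psi_nonzero[of n ?c] by simp
    have "?c ^ (n - l) * cnj ?\<Psi> = cnj (?c ^ n * cnj ?c ^ (n - l)) * cpoly (Phi t n) ?c"
      by (subst cpoly_Psi_circle) simp_all
    also have "?c ^ n * cnj ?c ^ (n - l) = ?c ^ l"
      using assms circ_power_diff[of "n - l" n x] by simp
    finally have "cpoly (Phi t n) ?c * cnj ?c ^ l = ?c ^ (n - l) * cnj ?\<Psi>" by simp
    also have "\<dots> = F ?c * (?\<Psi> * cnj ?\<Psi>)"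
      using nz by (simp add: F_def)
    also have "\<dots> = of_real ((norm ?\<Psi>)\<^sup>2) * F ?c"
      by (simp only: complex_norm_square mult.commute)
    finally have "Re (cpoly (Phi t n) ?c * cnj ?c ^ l) = (norm ?\<Psi>)\<^sup>2 * Re (F ?c)"
      by (simp only: times_complex.sel Re_complex_of_real Im_complex_of_real mult_zero_left diff_zero)
    then show ?thesis using nz Err_pos[of n] by (simp only: poly_bs_poly[OF that]) simp
  qed
  then have "(\<integral>x. Re (cpoly (Phi t n) (circ x) * cnj (circ x) ^ l) / poly (bs_poly t n) x \<partial>arcsine) =
      (\<integral>x. Err t n * Re (F (circ x)) \<partial>arcsine)"
    by (intro Bochner_Integration.integral_cong) (auto simp del: times_complex.sel)
  then show ?thesis using I by simp
qed

text \<open>Orthogonality is first known at the top order \<open>n\<close> only. Running the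
  recursion backwards carries it down to order 0, where it fixes the total mass; going up again, it
  determines the moments.\<close>

lemma bs_measure:
  "density arcsine (\<lambda>x. ennreal (1 / poly (bs_poly t n) x)) \<in> moment_measures {0..1}" (is ?th1)
  "\<And>j. j \<le> n \<Longrightarrow> t j = (\<integral>x. Re (circ x ^ j) \<partial>density arcsine (\<lambda>x. ennreal (1 / poly (bs_poly t n) x)))"
proof -
  let ?p = "poly (bs_poly t n)"
  note aI = moment_measures_integrable[OF arcsine_in_moment_measures]
  note aM = moment_measures_measurable[OF arcsine_in_moment_measures]
  have nz: "\<And>x. x \<in> {0..1} \<Longrightarrow> ?p x \<noteq> 0" using bs_poly_pos by force
  have cont: "continuous_on {0..1} (\<lambda>x. 1 / ?p x)"
    using nz by (intro continuous_intros) auto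
  \<comment> \<open>A provisional normalisation: it makes the facts on probability measures
    available before the mass is known to be 1.\<close>
  define c where "c = (\<integral>x. 1 / ?p x \<partial>arcsine)"
  have "c \<ge> 0" unfolding c_def
    using bs_poly_pos by (intro integral_nonneg_AE AE_I2) (auto intro: less_imp_le)
  moreover have "c \<noteq> 0"
  proof
    assume "c = 0"
    then have "AE x in arcsine. 1 / ?p x = 0"
      unfolding c_def using bs_poly_pos
      by (subst (asm) integral_nonneg_eq_0_iff_AE) (auto intro!: aI cont AE_I2 intro: less_imp_le)
    then have "AE x in arcsine. False"
      using AE_space by eventually_elim (use nz in auto)
    then show False by simp
  qed
  ultimately have c: "c > 0" by simp
  define \<nu> where "\<nu> = density arcsine (\<lambda>x. ennreal (1 / (c * ?p x)))"
  have cont': "continuous_on {0..1} (\<lambda>x. 1 / (c * ?p x))"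
    using nz c by (intro continuous_intros) auto
  have int_\<nu>: "(\<integral>x. f x \<partial>\<nu>) = (\<integral>x. f x / ?p x \<partial>arcsine) / c" if "continuous_on {0..1} f" for f :: "real \<Rightarrow> real"
  proof -
    have "(\<integral>x. f x \<partial>\<nu>) = (\<integral>x. (1 / (c * ?p x)) *\<^sub>R f x \<partial>arcsine)"
      unfolding \<nu>_def using bs_poly_pos c
      by (intro integral_density aM cont' that AE_I2) (auto intro: less_imp_le)
    also have "\<dots> = (\<integral>x. (f x / ?p x) / c \<partial>arcsine)" by (simp add: field_simps)
    finally show ?thesis by (simp only: integral_divide_zero)
  qed
  have "emeasure \<nu> (space \<nu>) = (\<integral>\<^sup>+x. ennreal (1 / (c * ?p x)) \<partial>arcsine)"
    unfolding \<nu>_def using aM[OF cont'] sets.top[of arcsine] by (subst emeasure_density) (auto intro!: nn_integral_cong)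
  also have "\<dots> = ennreal (\<integral>x. 1 / (c * ?p x) \<partial>arcsine)"
    using bs_poly_pos c by (intro nn_integral_eq_integral aI cont' AE_I2) (auto intro: less_imp_le)
  also have "(\<integral>x. 1 / (c * ?p x) \<partial>arcsine) = (\<integral>x. (1 / ?p x) / c \<partial>arcsine)" by (simp add: field_simps)
  also have "\<dots> = 1" using c by (simp only: integral_divide_zero c_def[symmetric]) simp
  finally have \<nu>: "\<nu> \<in> moment_measures {0..1}"
    by (intro moment_measuresI prob_spaceI) (simp_all add: \<nu>_def sets_arcsine)
  have top: "trig_inner \<nu> (Phi t n) l = (if l = n then Err t n / c else 0)" if "l \<le> n" for l
    unfolding trig_inner_def
    by (subst int_\<nu>) (auto intro!: continuous_intros simp: integral_trig_bs[OF that] simp del: times_complex.sel)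
  \<comment> \<open>Downward induction from \<open>n\<close>; the unknown constant \<open>c\<close>
    is carried along unchanged.\<close>
  have orth: "(\<forall>l<j. trig_inner \<nu> (Phi t j) l = 0) \<and> trig_inner \<nu> (Phi t j) j = Err t j / c"
    if "j \<le> n" for j
    using that
  proof (induction j rule: inc_induct)
    case base
    show ?case using top by auto
  next
    case (step j)
    let ?a = "verb t j"
    have a: "1 - ?a\<^sup>2 > 0" using verb_less_1[OF \<open>j < n\<close>] by (simp add: abs_square_less_1)
    \<comment> \<open>The inverted recursion step: Phi_(j+1) + a Psi_(j+1) = (1 - a^2) z Phi_j,
      where 1 - a^2 is positive.\<close>
    have eq: "trig_inner \<nu> (pCons 0 (Phi t j)) l * (1 - ?a\<^sup>2) =
        trig_inner \<nu> (Phi t (Suc j)) l + ?a * trig_inner \<nu> (Psi t (Suc j)) l" for l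
      by (simp add: szego_Suc trig_inner_lin[OF \<nu>] algebra_simps power2_eq_square del: smult_pCons)
    have down: "trig_inner \<nu> (Phi t j) l * (1 - ?a\<^sup>2) =
        trig_inner \<nu> (Phi t (Suc j)) (Suc l) + ?a * trig_inner \<nu> (Phi t (Suc j)) (j - l)" if "l \<le> j" for l
      using eq[of "Suc l"] that by (simp add: trig_inner_shift trig_inner_Psi)
    have "trig_inner \<nu> (Phi t j) l = 0" if "l < j" for l
      using down[of l] that step.IH a by simp
    moreover have "trig_inner \<nu> (Phi t j) j * (1 - ?a\<^sup>2) = (Err t j / c) * (1 - ?a\<^sup>2)"
      using down[of j] step.IH by (simp add: szego_Suc(3))
    then have "trig_inner \<nu> (Phi t j) j = Err t j / c" using a by (metis less_irrefl mult_right_cancel)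
    ultimately show ?case by blast
  qed
  \<comment> \<open>At order 0 the inner product is the mass 1 of \<nu>, and by \<open>orth\<close>
    it is 1 / c.\<close>
  have "trig_inner \<nu> (Phi t 0) 0 = 1"
    using moment_measuresD(1)[OF \<nu>] by (simp add: trig_inner_def prob_space.prob_space)
  with orth[of 0] have c1: "c = 1" using c by simp
  have \<nu>_eq: "\<nu> = density arcsine (\<lambda>x. ennreal (1 / ?p x))" by (simp add: \<nu>_def c1)
  show ?th1 using \<nu> by (simp add: \<nu>_eq)
  fix j assume "j \<le> n"
  then have "t j = (\<integral>x. Re (circ x ^ j) \<partial>\<nu>)"
  proof (induction j rule: less_induct)
    case (less j)
    show ?case
    proof (cases j)
      case 0
      then show ?thesis using moment_measuresD(1)[OF \<nu>] t_0 by (simp add: prob_space.prob_space)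
    next
      case (Suc i)
      then have i: "i < n" using less by simp
      let ?s = "\<lambda>k. \<integral>x. Re (circ x ^ k) \<partial>\<nu>"
      \<comment> \<open>Orthogonality of \<open>Phi t (Suc i)\<close> to the constants is a linear
        equation in which the moment of order i + 1 has coefficient 1. Both \<nu> and
        \<open>t\<close> satisfy it, and they agree on all lower orders.\<close>
      have "trig_inner \<nu> (Phi t (Suc i)) 0 = 0" using orth[of "Suc i"] i by simp
      then have "(\<Sum>k\<le>i. coeff (Phi t i) k * ?s (Suc k)) = verb t i * Err t i"
        using orth[of i] i c1
        by (simp add: szego_Suc trig_inner_lin[OF \<nu>] trig_inner_expand[OF \<nu> degree_szego(1)] trig_inner_Psi
                 del: power_Suc)
      also have "\<dots> = (\<Sum>k\<le>i. coeff (Phi t i) k * t (Suc k))"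
        using Err_pos[of i] i by (simp add: verb_def)
      finally have "(\<Sum>k<i. coeff (Phi t i) k * ?s (Suc k)) + ?s (Suc i) =
         (\<Sum>k<i. coeff (Phi t i) k * t (Suc k)) + t (Suc i)"
        by (simp only: lessThan_Suc_atMost[symmetric] sum.lessThan_Suc coeff_Phi_monic mult_1_left)
      moreover have "(\<Sum>k<i. coeff (Phi t i) k * ?s (Suc k)) = (\<Sum>k<i. coeff (Phi t i) k * t (Suc k))"
        using less Suc by (intro sum.cong) (auto simp del: power_Suc)
      ultimately show ?thesis by (simp add: Suc del: power_Suc)
    qed
  qed
  then show "t j = (\<integral>x. Re (circ x ^ j) \<partial>density arcsine (\<lambda>x. ennreal (1 / ?p x)))" by (simp add: \<nu>_eq)
qed

text \<open>Each step multiplies \<open>Psi\<close> by 1 - u with |u| < 1 on the closed disc and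
  u(0) = 0. Such a factor stays in the right half plane, so its principal logarithm is holomorphic
  with value 0 at the centre. Working factor by factor avoids choosing a logarithm of
  \<open>Psi\<close> itself.\<close>

lemma integral_ln_Psi:
  "j \<le> n \<Longrightarrow> (\<integral>x. ln (norm (cpoly (Psi t j) (circ x))) \<partial>arcsine) = 0"
proof (induction j)
  case (Suc j)
  let ?a = "verb t j"
  define u where "u z = of_real ?a * (z * cpoly (Phi t j) z / cpoly (Psi t j) z)" for z
  have nz: "cpoly (Psi t j) z \<noteq> 0" if "norm z \<le> 1" for z using Psi_nonzero[of j z] that Suc.prems by simp
  have nu: "norm (u z) < 1" if "norm z \<le> 1" for z
  proof -
    have "norm z * norm (cpoly (Phi t j) z) \<le> 1 * norm (cpoly (Psi t j) z)"
      using that Phi_le_Psi[of j z] Suc.prems by (intro mult_mono) auto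
    then have "norm (z * cpoly (Phi t j) z / cpoly (Psi t j) z) \<le> 1"
      using nz[OF that] by (simp add: norm_mult norm_divide)
    then have "norm (u z) \<le> \<bar>?a\<bar> * 1" unfolding u_def norm_mult by (intro mult_mono) auto
    also have "\<dots> < 1" using verb_less_1[of j] Suc.prems by simp
    finally show ?thesis .
  qed
  have Re_pos: "Re (1 - u z) > 0" if "norm z \<le> 1" for z
    using nu[OF that] abs_Re_le_cmod[of "u z"] by simp
  then have nonpos: "1 - u z \<notin> \<real>\<^sub>\<le>\<^sub>0" if "norm z \<le> 1" for z
    using that by (force simp: complex_nonpos_Reals_iff)
  have "(\<integral>x. Re (Ln (1 - u (circ x))) \<partial>arcsine) = Re (Ln (1 - u 0))"
  proof (rule arcsine_mean_value)
    show "continuous_on (cball 0 1) (\<lambda>z. Ln (1 - u z))"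
      using nz nonpos unfolding u_def by (intro continuous_intros) auto
    show "(\<lambda>z. Ln (1 - u z)) holomorphic_on ball 0 1"
      using nz nonpos unfolding u_def by (intro holomorphic_intros) auto
    show "Ln (1 - u (cnj z)) = cnj (Ln (1 - u z))" if "norm z = 1" for z
      using nonpos[of z] that by (subst cnj_Ln) (auto simp: u_def cpoly_cnj)
  qed
  then have I: "(\<integral>x. Re (Ln (1 - u (circ x))) \<partial>arcsine) = 0" by (simp add: u_def)
  have "ln (norm (cpoly (Psi t (Suc j)) (circ x))) =
      ln (norm (cpoly (Psi t j) (circ x))) + Re (Ln (1 - u (circ x)))" for x
  proof -
    have "cpoly (Psi t (Suc j)) (circ x) = cpoly (Psi t j) (circ x) * (1 - u (circ x))"
      using nz[of "circ x"] by (simp add: szego_Suc u_def field_simps)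
    moreover have "1 - u (circ x) \<noteq> 0" using Re_pos[of "circ x"] by force
    ultimately show ?thesis using nz[of "circ x"] by (simp add: norm_mult ln_mult)
  qed
  then have "(\<integral>x. ln (norm (cpoly (Psi t (Suc j)) (circ x))) \<partial>arcsine) =
     (\<integral>x. ln (norm (cpoly (Psi t j) (circ x))) + Re (Ln (1 - u (circ x))) \<partial>arcsine)"
    by simp
  also have "\<dots> = 0"
  proof (subst Bochner_Integration.integral_add)
    show "integrable arcsine (\<lambda>x. ln (norm (cpoly (Psi t j) (circ x))))"
      using nz by (intro moment_measures_integrable[OF arcsine_in_moment_measures] continuous_intros) auto
    show "integrable arcsine (\<lambda>x. Re (Ln (1 - u (circ x))))"
      using nz nonpos unfolding u_def
      by (intro moment_measures_integrable[OF arcsine_in_moment_measures] continuous_intros) auto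
  qed (use Suc I in simp)
  finally show ?case .
qed simp

lemma integral_ln_bs_poly: "(\<integral>x. ln (poly (bs_poly t n) x) \<partial>arcsine) = - ln (Err t n)"
proof -
  have "(\<integral>x. ln (poly (bs_poly t n) x) \<partial>arcsine) =
      (\<integral>x. 2 * ln (norm (cpoly (Psi t n) (circ x))) - ln (Err t n) \<partial>arcsine)"
    using Psi_nonzero[of n] Err_pos[of n]
    by (intro Bochner_Integration.integral_cong) (auto simp: poly_bs_poly ln_div ln_realpow)
  also have "\<dots> = - ln (Err t n)"
  proof (subst Bochner_Integration.integral_diff)
    show "integrable arcsine (\<lambda>x. 2 * ln (norm (cpoly (Psi t n) (circ x))))"
      using Psi_nonzero[of n]
      by (intro moment_measures_integrable[OF arcsine_in_moment_measures] continuous_intros) auto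
  qed (use integral_ln_Psi[of n] arcsine.prob_space in auto)
  finally show ?thesis .
qed

end

section \<open>Moment spaces\<close>

text \<open>Membership in the moment space for total functions, reading only the coordinates 1, ...,
  n. Coordinates can thus be updated freely without restoring extensionality each time.\<close>

definition is_moments :: "nat \<Rightarrow> (nat \<Rightarrow> real) \<Rightarrow> bool" where
  "is_moments n m \<longleftrightarrow> (\<exists>\<mu>\<in>moment_measures {0..1}. \<forall>j\<in>{1..n}. m j = moment j \<mu>)"

text \<open>\<open>mErr m n / 4 ^ n\<close> is the length of the range of the moment of order \<open>n + 1\<close>, and
  \<open>(1 + mverb m n) / 2\<close> is the canonical moment of order \<open>n + 1\<close>.\<close>

definition mErr :: "(nat \<Rightarrow> real) \<Rightarrow> nat \<Rightarrow> real" where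
  "mErr m n = Err (trig_moment m) n"

definition mverb :: "(nat \<Rightarrow> real) \<Rightarrow> nat \<Rightarrow> real" where
  "mverb m n = verb (trig_moment m) n"

lemma mErr_0 [simp]: "mErr m 0 = 1"
  by (simp add: mErr_def)

lemma mErr_Suc: "mErr m (Suc n) = mErr m n * (1 - (mverb m n)\<^sup>2)"
  by (simp add: mErr_def mverb_def szego_Suc)

lemma mErr_cong: "(\<And>j. 1 \<le> j \<Longrightarrow> j \<le> n \<Longrightarrow> m j = m' j) \<Longrightarrow> mErr m n = mErr m' n"
  unfolding mErr_def by (intro Err_cong trig_moment_cong) auto

lemma is_moments_cong:
  "(\<And>j. 1 \<le> j \<Longrightarrow> j \<le> n \<Longrightarrow> m j = m' j) \<Longrightarrow> is_moments n m \<longleftrightarrow> is_moments n m'"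
  unfolding is_moments_def by auto

lemma is_moments_mono: "is_moments n m \<Longrightarrow> k \<le> n \<Longrightarrow> is_moments k m"
  unfolding is_moments_def by auto

lemma is_moments_trig:
  assumes "is_moments n m"
  obtains \<mu> where "\<mu> \<in> moment_measures {0..1}" "\<And>j. j \<in> {1..n} \<Longrightarrow> m j = moment j \<mu>"
    "\<And>j. j \<le> n \<Longrightarrow> trig_moment m j = (\<integral>x. Re (circ x ^ j) \<partial>\<mu>)"
  using assms trig_moment_measure unfolding is_moments_def by (metis atLeastAtMost_iff)

lemma mErr_nonneg: "is_moments n m \<Longrightarrow> j \<le> n \<Longrightarrow> mErr m j \<ge> 0"
  unfolding mErr_def by (erule is_moments_trig) (rule Err_nonneg, auto)

lemma mErr_antimono:
  assumes "is_moments n m" "j \<le> k" "k \<le> n"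
  shows "mErr m k \<le> mErr m j"
  using assms(2,3)
proof (induction k rule: dec_induct)
  case (step k)
  then have "mErr m (Suc k) \<le> mErr m k"
    using mErr_nonneg[OF assms(1), of k] Err_antimono unfolding mErr_def by simp
  then show ?case using step by simp
qed simp

lemma mErr_le_1: "is_moments n m \<Longrightarrow> j \<le> n \<Longrightarrow> mErr m j \<le> 1"
  using mErr_antimono[of n m 0 j] by simp

lemma mErr_pos_all:
  assumes "is_moments n m" "mErr m n > 0" "j \<le> n"
  shows "mErr m j > 0"
  using mErr_antimono[OF assms(1,3)] assms(2) by force

lemma mverb_le_1: "is_moments (Suc n) m \<Longrightarrow> \<bar>mverb m n\<bar> \<le> 1"
  unfolding mverb_def by (erule is_moments_trig) (rule verb_le_1, auto)

lemma regular_momentsI: "(\<And>j. j \<le> n \<Longrightarrow> mErr m j > 0) \<Longrightarrow> regular_moments (trig_moment m) n"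
  by (simp add: regular_moments_def mErr_def)

lemma bs_measure_moments:
  assumes "\<And>j. j \<le> n \<Longrightarrow> mErr m j > 0"
  shows "\<exists>p. degree p \<le> n \<and> (\<forall>x\<in>{0..1}. poly p x > 0) \<and>
    density arcsine (\<lambda>x. ennreal (1 / poly p x)) \<in> moment_measures {0..1} \<and>
    (\<forall>j\<in>{1..n}. m j = moment j (density arcsine (\<lambda>x. ennreal (1 / poly p x)))) \<and>
    (\<integral>x. ln (poly p x) \<partial>arcsine) = - ln (mErr m n)"
proof -
  interpret regular_moments "trig_moment m" n by (rule regular_momentsI) (rule assms)
  let ?\<nu> = "density arcsine (\<lambda>x. ennreal (1 / poly (bs_poly (trig_moment m) n) x))"
  have "m j = moment j ?\<nu>" if "j \<in> {1..n}" for j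
  proof (rule trig_moment_inj[of n m "\<lambda>j. moment j ?\<nu>"])
    fix k assume "k \<le> n"
    then show "trig_moment m k = trig_moment (\<lambda>j. moment j ?\<nu>) k"
      using trig_moment_measure[OF bs_measure(1), of n "\<lambda>j. moment j ?\<nu>" k] bs_measure(2) by simp
  qed (use that in auto)
  then show ?thesis
    using degree_bs_poly bs_poly_pos bs_measure(1) integral_ln_bs_poly
    by (intro exI[of _ "bs_poly (trig_moment m) n"]) (simp add: mErr_def)
qed

lemma is_momentsI: "(\<And>j. j \<le> n \<Longrightarrow> mErr m j > 0) \<Longrightarrow> is_moments n m"
  using bs_measure_moments[of n m] unfolding is_moments_def by blast

text \<open>Take the first order k at which the error vanishes. Measures for \<open>m\<close> and
  \<open>m'\<close> share the moments up to k, hence obey the same linear recurrence, and it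
  expresses the trigonometric moment of order n + 1 through those of order at most n.\<close>

lemma next_moment_unique:
  assumes "is_moments (Suc n) m" "is_moments (Suc n) m'" "mErr m n = 0"
    and eq: "\<And>j. 1 \<le> j \<Longrightarrow> j \<le> n \<Longrightarrow> m j = m' j"
  shows "m (Suc n) = m' (Suc n)"
proof -
  define k where "k = (LEAST k. mErr m k = 0)"
  let ?P = "\<lambda>k. mErr m k = 0"
  have k: "mErr m k = 0" "k \<le> n"
    unfolding k_def using LeastI[of ?P, OF assms(3)] Least_le[of ?P, OF assms(3)] by auto
  have k_least: "mErr m j \<noteq> 0" if "j < k" for j
    using not_less_Least[of j ?P] that unfolding k_def by simp
  obtain \<mu> where \<mu>: "\<mu> \<in> moment_measures {0..1}"
    "\<And>j. j \<le> Suc n \<Longrightarrow> trig_moment m j = (\<integral>x. Re (circ x ^ j) \<partial>\<mu>)"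
    by (rule is_moments_trig[OF assms(1)], rule that, assumption+)
  obtain \<mu>' where \<mu>': "\<mu>' \<in> moment_measures {0..1}"
    "\<And>j. j \<le> Suc n \<Longrightarrow> trig_moment m' j = (\<integral>x. Re (circ x ^ j) \<partial>\<mu>')"
    by (rule is_moments_trig[OF assms(2)], rule that, assumption+)
  have teq: "trig_moment m j = trig_moment m' j" if "j \<le> n" for j
    using that by (intro trig_moment_cong eq) auto
  define d where "d = Suc n - k"
  have kd: "k + d = Suc n" using k(2) by (simp add: d_def)
  have "trig_moment m (Suc n) = - (\<Sum>j<k. coeff (Phi (trig_moment m) k) j * (\<integral>x. Re (circ x ^ (j + d)) \<partial>\<mu>))"
    using degenerate_recurrence[of \<mu> k "trig_moment m" d] \<mu> k k_least unfolding kd mErr_def by (simp del: power_Suc)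
  also have "\<dots> = - (\<Sum>j<k. coeff (Phi (trig_moment m) k) j * (\<integral>x. Re (circ x ^ (j + d)) \<partial>\<mu>'))"
  proof (intro arg_cong[where f = uminus] sum.cong refl)
    fix j assume "j \<in> {..<k}"
    then have "j + d \<le> n" using kd by simp
    then have "(\<integral>x. Re (circ x ^ (j + d)) \<partial>\<mu>) = (\<integral>x. Re (circ x ^ (j + d)) \<partial>\<mu>')"
      using \<mu>(2)[of "j + d"] \<mu>'(2)[of "j + d"] teq[of "j + d"] by simp
    then show "coeff (Phi (trig_moment m) k) j * (\<integral>x. Re (circ x ^ (j + d)) \<partial>\<mu>) =
        coeff (Phi (trig_moment m) k) j * (\<integral>x. Re (circ x ^ (j + d)) \<partial>\<mu>')" by simp
  qed
  also have "\<dots> = trig_moment m' (Suc n)"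
    using degenerate_recurrence[of \<mu>' k "trig_moment m" d] \<mu>' k k_least teq unfolding kd mErr_def
    by (simp del: power_Suc)
  finally have "trig_moment m j = trig_moment m' j" if "j \<le> Suc n" for j
    using teq[of j] that by (cases "j = Suc n") auto
  then show ?thesis by (rule trig_moment_inj[of "Suc n"]) auto
qed

definition verb_offset :: "(nat \<Rightarrow> real) \<Rightarrow> nat \<Rightarrow> real" where
  "verb_offset m n = mverb (m(Suc n := 0)) n"

text \<open>The new moment enters \<open>verb\<close> only through the trigonometric moment of order
  n + 1, with coefficient 2 * 4^n, and is multiplied there by the leading coefficient 1 of
  \<open>Phi\<close>.\<close>

lemma mverb_affine:
  "mverb (m(Suc n := y)) n = verb_offset m n + 2 * 4 ^ n / mErr m n * y"
proof -
  let ?m = "m(Suc n := y)" and ?mz = "m(Suc n := 0)"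
  have t: "trig_moment ?m j = trig_moment ?mz j" if "j \<le> n" for j
    using that by (intro trig_moment_cong) auto
  have P: "Phi (trig_moment ?m) n = Phi (trig_moment ?mz) n"
    and E: "Err (trig_moment ?m) n = mErr m n" "Err (trig_moment ?mz) n = mErr m n"
    using t Phi_Psi_cong[of n "trig_moment ?m" "trig_moment ?mz"]
    by (auto simp: mErr_def intro!: Err_cong trig_moment_cong)
  let ?S = "\<lambda>m. \<Sum>l\<le>n. coeff (cheb (Suc n)) l * (if l = 0 then 1 else m l)"
  have "?S ?m = ?S ?mz" by (intro sum.cong) auto
  then have "trig_moment ?m (Suc n) = 2 * 4 ^ n * y + ?S ?mz"
    unfolding trig_moment_Suc by (simp only: fun_upd_same)
  moreover have "trig_moment ?mz (Suc n) = ?S ?mz"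
    unfolding trig_moment_Suc by (simp only: fun_upd_same mult_zero_right add_0_left)
  ultimately have "trig_moment ?m (Suc n) = trig_moment ?mz (Suc n) + 2 * 4 ^ n * y"
    by (simp only: add.commute)
  moreover have "(\<Sum>k<n. coeff (Phi (trig_moment ?mz) n) k * trig_moment ?m (Suc k)) =
      (\<Sum>k<n. coeff (Phi (trig_moment ?mz) n) k * trig_moment ?mz (Suc k))"
    using t by (intro sum.cong) auto
  ultimately show ?thesis
    unfolding verb_offset_def mverb_def verb_def P E
    by (simp add: lessThan_Suc_atMost[symmetric] add_divide_distrib)
qed

text \<open>All outputs of the recursion are rational in the moments, with earlier errors as the
  only denominators. \<open>P\<close> is any class of functions closed under arithmetic, and
  \<open>N\<close> the side condition under which it admits division.\<close>

lemma szego_closure: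
  fixes P :: "('a \<Rightarrow> real) \<Rightarrow> bool"
  assumes const: "\<And>c. P (\<lambda>_. c)"
    and add: "\<And>f g. P f \<Longrightarrow> P g \<Longrightarrow> P (\<lambda>s. f s + g s)"
    and mult: "\<And>f g. P f \<Longrightarrow> P g \<Longrightarrow> P (\<lambda>s. f s * g s)"
    and divide: "\<And>f g. P f \<Longrightarrow> P g \<Longrightarrow> N g \<Longrightarrow> P (\<lambda>s. f s / g s)"
    and t: "\<And>j. j \<le> n \<Longrightarrow> P (\<lambda>s. t s j)" and N: "\<And>j. j < n \<Longrightarrow> N (\<lambda>s. Err (t s) j)"
  shows "(\<forall>k. P (\<lambda>s. coeff (Phi (t s) n) k)) \<and> (\<forall>k. P (\<lambda>s. coeff (Psi (t s) n) k)) \<and> P (\<lambda>s. Err (t s) n)"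
  using t N
proof (induction n)
  case 0
  show ?case using const by simp
next
  case (Suc n)
  have diff: "P (\<lambda>s. f s - g s)" if "P f" "P g" for f g
    using add[OF that(1) mult[OF const[of "-1"] that(2)]] by simp
  have sum: "P (\<lambda>s. \<Sum>k\<in>A. f k s)" if "finite A" "\<And>k. k \<in> A \<Longrightarrow> P (f k)" for A :: "nat set" and f
    using that by (induction A) (auto intro: const add)
  have IH: "\<And>k. P (\<lambda>s. coeff (Phi (t s) n) k)" "\<And>k. P (\<lambda>s. coeff (Psi (t s) n) k)" "P (\<lambda>s. Err (t s) n)"
    using Suc by auto
  have a: "P (\<lambda>s. verb (t s) n)"
    unfolding verb_def by (intro divide sum mult IH) (use Suc.prems in auto)
  have sh: "P (\<lambda>s. coeff (pCons 0 (Phi (t s) n)) k)" for k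
    using IH(1) const by (cases k) auto
  have "P (\<lambda>s. coeff (Phi (t s) (Suc n)) k)" for k
    unfolding szego_Suc coeff_diff coeff_smult by (intro diff mult a sh IH)
  moreover have "P (\<lambda>s. coeff (Psi (t s) (Suc n)) k)" for k
    unfolding szego_Suc coeff_diff coeff_smult by (intro diff mult a sh IH)
  moreover have "P (\<lambda>s. Err (t s) (Suc n))"
    unfolding szego_Suc power2_eq_square by (intro diff mult a IH const)
  ultimately show ?case by blast
qed

text \<open>Serves three times: for measurability, for limits along sequences and for second-order
  expansions along lines.\<close>

lemma mErr_closure:
  fixes P :: "('a \<Rightarrow> real) \<Rightarrow> bool"
  assumes const: "\<And>c. P (\<lambda>_. c)"
    and add: "\<And>f g. P f \<Longrightarrow> P g \<Longrightarrow> P (\<lambda>s. f s + g s)"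
    and mult: "\<And>f g. P f \<Longrightarrow> P g \<Longrightarrow> P (\<lambda>s. f s * g s)"
    and divide: "\<And>f g. P f \<Longrightarrow> P g \<Longrightarrow> N g \<Longrightarrow> P (\<lambda>s. f s / g s)"
    and m: "\<And>j. 1 \<le> j \<Longrightarrow> j \<le> n \<Longrightarrow> P (\<lambda>s. m s j)" and N: "\<And>j. j < n \<Longrightarrow> N (\<lambda>s. mErr (m s) j)"
  shows "P (\<lambda>s. mErr (m s) n)"
proof -
  have sum: "P (\<lambda>s. \<Sum>k\<in>A. f k s)" if "finite A" "\<And>k. k \<in> A \<Longrightarrow> P (f k)" for A :: "nat set" and f
    using that by (induction A) (auto intro: const add)
  have "P (\<lambda>s. trig_moment (m s) j)" if "j \<le> n" for j
    unfolding trig_moment_def moment_functional_altdef[OF degree_cheb]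
  proof (intro sum mult const)
    show "P (\<lambda>s. if l = 0 then 1 else m s l)" if "l \<in> {..j}" for l
      using m[of l] const \<open>j \<le> n\<close> that by (cases "l = 0") auto
  qed simp
  then show ?thesis
    using szego_closure[of P N n "\<lambda>s. trig_moment (m s)"] assms unfolding mErr_def by blast
qed

section \<open>Measurability, compactness and closedness\<close>

lemma isCont_coordinate: "isCont (\<lambda>m. m j) (m0 :: nat \<Rightarrow> real)"
  by (metis UNIV_I continuous_on_eq_continuous_at continuous_on_product_coordinates open_UNIV)

lemma mErr_measurable:
  assumes "\<And>j. 1 \<le> j \<Longrightarrow> j \<le> n \<Longrightarrow> (\<lambda>s. m s j) \<in> borel_measurable M"
  shows "(\<lambda>s. mErr (m s) n) \<in> borel_measurable M"
  by (rule mErr_closure[where P = "\<lambda>f. f \<in> borel_measurable M" and N = "\<lambda>_. True"])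
     (use assms in auto)

text \<open>Extended to the whole line the measures are tight, so Helly's selection theorem applies.
  Clipping the limit law back to the interval spares a proof that it is carried there: the clipped
  powers are bounded and continuous, and coincide with the powers on the interval.\<close>

lemma moment_measures_seq_compact:
  assumes "\<And>k. \<mu> k \<in> moment_measures {0..1}"
  shows "\<exists>(r :: nat \<Rightarrow> nat) \<nu>. strict_mono r \<and> \<nu> \<in> moment_measures {0..1} \<and>
    (\<forall>j. (\<lambda>k. moment j (\<mu> (r k))) \<longlonglongrightarrow> moment j \<nu>)"
proof -
  let ?clip = "\<lambda>x::real. max 0 (min 1 x)"
  define M where "M k = distr (\<mu> k) borel (\<lambda>x. x)" for k
  have id: "(\<lambda>x. x) \<in> measurable (\<mu> k) borel" for k
    by (subst measurable_cong_sets[OF moment_measuresD(2)[OF assms] refl])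
       (rule measurable_restrict_space1, simp)
  have rd: "real_distribution (M k)" for k
    unfolding M_def real_distribution_def real_distribution_axioms_def
    using moment_measuresD(1)[OF assms] id by (simp add: prob_space.prob_space_distr)
  \<comment> \<open>Tightness is stated with half-open intervals, and the left end -1 keeps a
    possible atom at 0 inside.\<close>
  have "measure (M k) {-1<..1} = 1" for k
  proof -
    have "(\<lambda>x. x) -` {-1<..1} \<inter> space (\<mu> k) = space (\<mu> k)"
      by (auto simp: moment_measuresD(3)[OF assms])
    then show ?thesis
      unfolding M_def using id prob_space.prob_space[OF moment_measuresD(1)[OF assms]]
      by (simp add: measure_distr)
  qed
  then have "tight M"
    unfolding tight_def using rd by (intro conjI allI impI exI[of _ "-1::real"] exI[of _ "1::real"]) auto
  then obtain r M' where r: "strict_mono (r :: nat \<Rightarrow> nat)" "real_distribution M'" "weak_conv_m (M \<circ> id \<circ> r) M'"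
    using tight_imp_convergent_subsubsequence[of M id] strict_mono_id by auto
  interpret M': real_distribution M' by fact
  have clip_meas: "?clip \<in> measurable borel (restrict_space borel {0..1})"
    by (rule measurable_restrict_space2) auto
  define \<nu> where "\<nu> = distr M' (restrict_space borel {0..1}) ?clip"
  have clip': "?clip \<in> measurable M' (restrict_space borel {0..1})"
    by (subst measurable_cong_sets[OF M'.events_eq_borel refl]) (rule clip_meas)
  have "\<nu> \<in> moment_measures {0..1}"
    unfolding \<nu>_def by (intro moment_measuresI M'.prob_space_distr clip') simp
  moreover have "(\<lambda>k. moment j (\<mu> (r k))) \<longlonglongrightarrow> moment j \<nu>" for j
  proof -
    have "(\<lambda>k. integral\<^sup>L ((M \<circ> id \<circ> r) k) (\<lambda>x. ?clip x ^ j)) \<longlonglongrightarrow> integral\<^sup>L M' (\<lambda>x. ?clip x ^ j)"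
      by (rule weak_conv_imp_integral_bdd_continuous_conv[where B = 1])
         (use rd r in \<open>auto intro!: continuous_intros simp: power_le_one comp_def\<close>)
    moreover have "integral\<^sup>L M' (\<lambda>x. ?clip x ^ j) = moment j \<nu>"
      unfolding \<nu>_def moment_def using clip'
      by (subst integral_distr) (auto intro!: measurable_restrict_space1)
    moreover have "integral\<^sup>L ((M \<circ> id \<circ> r) k) (\<lambda>x. ?clip x ^ j) = moment j (\<mu> (r k))" for k
      unfolding M_def moment_def o_def id_def using id[of "r k"]
      by (subst integral_distr) (auto intro!: Bochner_Integration.integral_cong simp: moment_measuresD(3)[OF assms])
    ultimately show ?thesis by simp
  qed
  ultimately show ?thesis using r(1) by blast
qed

text \<open>Serves to make the slices Borel sets.\<close>

lemma closed_is_moments: "closed {m. is_moments n m}"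
proof -
  have "l \<in> {m. is_moments n m}" if mem: "\<And>k. f k \<in> {m. is_moments n m}" and lim: "f \<longlonglongrightarrow> l" for f l
  proof -
    have "\<forall>k. \<exists>\<mu>\<in>moment_measures {0..1}. \<forall>j\<in>{1..n}. f k j = moment j \<mu>"
      using mem by (simp add: is_moments_def)
    then obtain \<mu> where \<mu>: "\<And>k. \<mu> k \<in> moment_measures {0..1}" "\<And>k j. j \<in> {1..n} \<Longrightarrow> f k j = moment j (\<mu> k)"
      by metis
    obtain r \<nu> where r: "strict_mono (r :: nat \<Rightarrow> nat)" "\<nu> \<in> moment_measures {0..1}"
      "\<And>j. (\<lambda>k. moment j (\<mu> (r k))) \<longlonglongrightarrow> moment j \<nu>"
      using moment_measures_seq_compact[of \<mu>] \<mu>(1) by blast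
    have "l j = moment j \<nu>" if "j \<in> {1..n}" for j
    proof (rule LIMSEQ_unique)
      have "(\<lambda>k. f k j) \<longlonglongrightarrow> l j"
        by (rule isCont_tendsto_compose[OF isCont_coordinate lim])
      then show "(\<lambda>k. f (r k) j) \<longlonglongrightarrow> l j"
        using LIMSEQ_subseq_LIMSEQ[OF _ r(1)] by (force simp: o_def)
      show "(\<lambda>k. f (r k) j) \<longlonglongrightarrow> moment j \<nu>" using r(3) \<mu>(2)[OF that] by simp
    qed
    then show ?thesis using r(2) by (auto simp: is_moments_def)
  qed
  then show ?thesis by (subst closed_sequential_limits) blast
qed

section \<open>The range of the next moment\<close>

lemma next_moments_iff:
  assumes "\<mu> \<in> moment_measures {0..1}"
  shows "x \<in> next_moments l (moment_vector l \<mu>) \<longleftrightarrow> is_moments (Suc l) ((\<lambda>j. moment j \<mu>)(Suc l := x))"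
proof -
  have "((moment_vector l \<mu>)(Suc l := x)) j = moment_vector (Suc l) \<nu> j \<longleftrightarrow>
      (j \<in> {1..Suc l} \<longrightarrow> ((\<lambda>j. moment j \<mu>)(Suc l := x)) j = moment j \<nu>)" for j \<nu>
    by (auto simp: moment_vector_def)
  then have "(moment_vector l \<mu>)(Suc l := x) = moment_vector (Suc l) \<nu> \<longleftrightarrow>
      (\<forall>j\<in>{1..Suc l}. ((\<lambda>j. moment j \<mu>)(Suc l := x)) j = moment j \<nu>)" for \<nu>
    by (simp only: fun_eq_iff[of "(moment_vector l \<mu>)(Suc l := x)"] Ball_def)
  then show ?thesis
    by (simp only: next_moments_def moment_space_def is_moments_def image_iff mem_Collect_eq)
qed

text \<open>The next coefficient is an increasing affine function of the next moment. All values in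
  the open interval from -1 to 1 occur and none outside the closed one, so whether the end points
  occur does not affect \<open>Sup\<close> and \<open>Inf\<close>.\<close>

lemma moment_range_eq:
  assumes "\<mu> \<in> moment_measures {0..1}" "mErr (\<lambda>j. moment j \<mu>) l > 0"
  shows "moment_range l \<mu> = mErr (\<lambda>j. moment j \<mu>) l / 4 ^ l"
proof -
  define m where "m = (\<lambda>j. moment j \<mu>)"
  define a where "a = 2 * 4 ^ l / mErr m l"
  define b where "b = verb_offset m l"
  define N where "N = next_moments l (moment_vector l \<mu>)"
  have pos: "mErr m l > 0" using assms(2) by (simp add: m_def)
  have a: "a > 0" using assms(2) by (simp add: a_def m_def)
  have im: "is_moments l m" using assms(1) by (auto simp: is_moments_def m_def)
  have N: "x \<in> N \<longleftrightarrow> is_moments (Suc l) (m(Suc l := x))" for x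
    unfolding N_def m_def by (rule next_moments_iff[OF assms(1)])
  have v: "mverb (m(Suc l := x)) l = b + a * x" for x
    unfolding a_def b_def by (rule mverb_affine)
  define lo hi where "lo = (-1 - b) / a" and "hi = (1 - b) / a"
  have lohi: "lo < hi" using a by (simp add: lo_def hi_def divide_strict_right_mono)
  have sub1: "N \<subseteq> {lo..hi}"
  proof
    fix x assume "x \<in> N"
    then have "\<bar>b + a * x\<bar> \<le> 1" using mverb_le_1[of l "m(Suc l := x)"] by (simp add: N v)
    then show "x \<in> {lo..hi}" using a by (auto simp: lo_def hi_def field_simps)
  qed
  have sub2: "{lo<..<hi} \<subseteq> N"
  proof
    fix x assume "x \<in> {lo<..<hi}"
    then have 1: "\<bar>b + a * x\<bar> < 1" using a by (auto simp: lo_def hi_def field_simps)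
    have le: "mErr (m(Suc l := x)) j = mErr m j" if "j \<le> l" for j
      using that by (intro mErr_cong) auto
    have "mErr (m(Suc l := x)) j > 0" if "j \<le> Suc l" for j
    proof (cases "j = Suc l")
      case True
      then show ?thesis using 1 pos le[of l]
        by (simp add: mErr_Suc v abs_square_less_1)
    qed (use that le mErr_pos_all[OF im pos] in simp)
    then show "x \<in> N" unfolding N by (rule is_momentsI)
  qed
  have ne: "N \<noteq> {}" and bdd: "bdd_above N" "bdd_below N"
    using sub1 sub2 lohi dense[OF lohi] by (auto intro: bdd_above_mono bdd_below_mono)
  have "Sup N = hi"
  proof (rule antisym)
    show "Sup N \<le> hi" using sub1 by (intro cSup_least ne) auto
    show "hi \<le> Sup N" using cSup_subset_mono[OF _ bdd(1) sub2] lohi by simp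
  qed
  moreover have "Inf N = lo"
  proof (rule antisym)
    show "lo \<le> Inf N" using sub1 by (intro cInf_greatest ne) auto
    show "Inf N \<le> lo" using cInf_superset_mono[OF _ bdd(2) sub2] lohi by simp
  qed
  ultimately have "moment_range l \<mu> = hi - lo"
    by (simp add: moment_range_def upper_moment_def lower_moment_def N_def)
  also have "\<dots> = mErr m l / 4 ^ l"
    unfolding hi_def lo_def diff_divide_distrib[symmetric] by (simp add: a_def)
  finally show ?thesis by (simp add: m_def)
qed

section \<open>Volumes\<close>

definition fill :: "(nat \<rightharpoonup> real) \<Rightarrow> (nat \<Rightarrow> real) \<Rightarrow> nat \<Rightarrow> real" where
  "fill C x = (\<lambda>j. case C j of Some c \<Rightarrow> c | None \<Rightarrow> x j)"

definition slice :: "(nat \<rightharpoonup> real) \<Rightarrow> nat \<Rightarrow> (nat \<Rightarrow> real) set" where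
  "slice C n = (\<lambda>m. restrict m (free_coordinates C n)) ` constrained_moment_space C n {0..1}"

abbreviation lebesgue_on_coords :: "nat set \<Rightarrow> (nat \<Rightarrow> real) measure" where
  "lebesgue_on_coords J \<equiv> \<Pi>\<^sub>M j\<in>J. lborel"

lemma finite_free_coordinates [simp]: "finite (free_coordinates C n)"
  by (simp add: free_coordinates_def)

lemma last_index_ge:
  assumes "moment_constraint C" "j \<in> dom C"
  shows "1 \<le> j" "j \<le> last_index C"
  using assms by (auto simp: moment_constraint_def last_index_def intro!: Suc_leI Max_ge)

lemma slice_iff:
  assumes C: "moment_constraint C" and n: "last_index C \<le> n"
  shows "x \<in> slice C n \<longleftrightarrow> x \<in> extensional (free_coordinates C n) \<and> is_moments n (fill C x)"
proof
  assume "x \<in> slice C n"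
  then obtain \<mu> where \<mu>: "\<mu> \<in> moment_measures {0..1}" "\<And>i c. C i = Some c \<Longrightarrow> moment i \<mu> = c"
    and x: "x = restrict (moment_vector n \<mu>) (free_coordinates C n)"
    by (auto simp: slice_def constrained_moment_space_def constrained_measures_def)
  have "fill C x j = moment j \<mu>" if "j \<in> {1..n}" for j
    using that \<mu>(2)[of j]
    by (cases "C j") (auto simp: fill_def x free_coordinates_def moment_vector_def)
  then show "x \<in> extensional (free_coordinates C n) \<and> is_moments n (fill C x)"
    using \<mu>(1) by (auto simp: x is_moments_def)
next
  assume "x \<in> extensional (free_coordinates C n) \<and> is_moments n (fill C x)"
  then obtain \<mu> where x: "x \<in> extensional (free_coordinates C n)" and \<mu>: "\<mu> \<in> moment_measures {0..1}"
    "\<And>j. j \<in> {1..n} \<Longrightarrow> fill C x j = moment j \<mu>"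
    by (auto simp: is_moments_def)
  have "moment i \<mu> = c" if "C i = Some c" for i c
  proof -
    have "i \<in> {1..n}" using last_index_ge[OF C, of i] that n by (simp add: domI)
    then show ?thesis using \<mu>(2)[of i] that by (simp add: fill_def)
  qed
  then have "\<mu> \<in> constrained_measures C {0..1}" using \<mu>(1) by (simp add: constrained_measures_def)
  moreover have "x = restrict (moment_vector n \<mu>) (free_coordinates C n)"
  proof
    fix j
    show "x j = restrict (moment_vector n \<mu>) (free_coordinates C n) j"
    proof (cases "j \<in> free_coordinates C n")
      case True
      then have "j \<in> {1..n}" "C j = None" by (auto simp: free_coordinates_def)
      then show ?thesis using True \<mu>(2)[of j] by (simp add: fill_def moment_vector_def)
    qed (use x in \<open>auto simp: extensional_def\<close>)
  qed
  ultimately show "x \<in> slice C n"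
    by (auto simp: slice_def constrained_moment_space_def)
qed

lemma fill_measurable:
  assumes "1 \<le> j" "j \<le> n"
  shows "(\<lambda>x. fill C x j) \<in> borel_measurable (lebesgue_on_coords (free_coordinates C n))"
proof (cases "C j")
  case None
  then have "j \<in> free_coordinates C n" using assms by (auto simp: free_coordinates_def)
  then have "(\<lambda>x. x j) \<in> measurable (lebesgue_on_coords (free_coordinates C n)) lborel"
    by (rule measurable_component_singleton)
  then show ?thesis using None by (simp add: fill_def)
qed (simp add: fill_def)

lemma slice_measurable:
  assumes C: "moment_constraint C" and n: "last_index C \<le> n"
  shows "slice C n \<in> sets (lebesgue_on_coords (free_coordinates C n))"
proof -
  let ?M = "lebesgue_on_coords (free_coordinates C n)"
  \<comment> \<open>Setting the remaining coordinates to 0 gives a measurable map into the full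
    sequence space, where \<open>closed_is_moments\<close> is stated.\<close>
  define f where "f x = (\<lambda>j. if j \<in> {1..n} then fill C x j else 0)" for x
  have "f \<in> borel_measurable ?M"
  proof (rule measurable_coordinatewise_then_product)
    show "(\<lambda>x. f x j) \<in> borel_measurable ?M" for j
      using fill_measurable[of j n C] by (cases "j \<in> {1..n}") (auto simp: f_def)
  qed
  then have "f -` {m. is_moments n m} \<inter> space ?M \<in> sets ?M"
    by (rule measurable_sets[OF _ borel_closed[OF closed_is_moments]])
  also have "f -` {m. is_moments n m} \<inter> space ?M = slice C n"
  proof -
    have "is_moments n (f x) \<longleftrightarrow> is_moments n (fill C x)" for x
      by (rule is_moments_cong) (simp add: f_def)
    then have "x \<in> f -` {m. is_moments n m} \<inter> space ?M \<longleftrightarrow> x \<in> slice C n" for x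
      by (simp add: slice_iff[OF C n] space_PiM PiE_def conj_commute)
    then show ?thesis by blast
  qed
  finally show ?thesis .
qed

text \<open>With c = (1 + a) / 2 this is the integral of (c (1 - c))^N over the unit interval, the
  Beta value B(N + 1, N + 1).\<close>

definition canonical_weight :: "nat \<Rightarrow> ennreal" where
  "canonical_weight N =
    (\<integral>\<^sup>+a. indicator {-1..1} a * ennreal (1 / 2 * ((1 - a\<^sup>2) / 4) ^ N) \<partial>lborel)"

text \<open>The exponent counts the coordinates above \<open>n\<close> that have been integrated
  out; exponent 0 gives the volume of the slice.\<close>

definition slice_integral :: "(nat \<rightharpoonup> real) \<Rightarrow> nat \<Rightarrow> nat \<Rightarrow> ennreal" where
  "slice_integral C n N = (\<integral>\<^sup>+x. indicator (slice C n) x * ennreal ((mErr (fill C x) n / 4 ^ n) ^ N)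
     \<partial>lebesgue_on_coords (free_coordinates C n))"

text \<open>Let R be the range of the moment of order n + 1 and a its coefficient. Then the
  following range is R (1 - a^2) / 4 and dy = (R / 2) da, so integrating over the fibre raises the
  power of R by one and splits off a Beta integral.\<close>

lemma fibre_integral:
  fixes m :: "nat \<Rightarrow> real" and n N :: nat
  defines "m' \<equiv> \<lambda>y. m(Suc n := y)"
  shows "(\<integral>\<^sup>+y. indicator {y. is_moments (Suc n) (m' y)} y *
      ennreal ((mErr (m' y) (Suc n) / 4 ^ Suc n) ^ N) \<partial>lborel) =
    canonical_weight N * (indicator {m. is_moments n m} m * ennreal ((mErr m n / 4 ^ n) ^ Suc N))"
    (is "integral\<^sup>N lborel ?F = ?rhs")
proof -
  have le: "mErr (m' y) j = mErr m j" if "j \<le> n" for j y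
    using that unfolding m'_def by (intro mErr_cong) auto
  have im: "is_moments n (m' y) \<longleftrightarrow> is_moments n m" for y
    unfolding m'_def by (intro is_moments_cong) auto
  consider (out) "\<not> is_moments n m" | (zero) "is_moments n m" "mErr m n = 0"
    | (pos) "is_moments n m" "mErr m n > 0"
    using mErr_nonneg[of n m n] by force
  then show ?thesis
  proof cases
    case out
    then have "?F y = 0" for y using im[of y] is_moments_mono[of "Suc n" "m' y" n]
      by (cases "is_moments (Suc n) (m' y)") auto
    then have "integral\<^sup>N lborel ?F = integral\<^sup>N lborel (\<lambda>_::real. 0)"
      by (rule nn_integral_cong)
    then show ?thesis using out by simp
  next
    case zero
    \<comment> \<open>On the boundary the fibre has at most one point and is a null set, matching
      the factor 0 on the right.\<close>
    have "\<exists>y0. \<forall>y. is_moments (Suc n) (m' y) \<longrightarrow> y = y0"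
    proof (cases "\<exists>y0. is_moments (Suc n) (m' y0)")
      case True
      then obtain y0 where y0: "is_moments (Suc n) (m' y0)" by blast
      have "y = y0" if "is_moments (Suc n) (m' y)" for y
        using next_moment_unique[OF that y0] zero le[of n y] by (simp add: m'_def)
      then show ?thesis by blast
    qed auto
    then obtain y0 where y0: "\<And>y. is_moments (Suc n) (m' y) \<Longrightarrow> y = y0" by blast
    have "AE y in lborel. ?F y = 0"
      using AE_lborel_singleton[of y0]
    proof eventually_elim
      case (elim y)
      then have "\<not> is_moments (Suc n) (m' y)" using y0 by blast
      then show ?case by simp
    qed
    then have "integral\<^sup>N lborel ?F = integral\<^sup>N lborel (\<lambda>_::real. 0)"
      by (rule nn_integral_cong_AE)
    then show ?thesis using zero by simp
  next
    case pos
    define R where "R = mErr m n / 4 ^ n"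
    define a b where "a = 2 * 4 ^ n / mErr m n" and "b = verb_offset m n"
    have R: "R > 0" and a: "a > 0" "a = 2 / R" using pos by (simp_all add: R_def a_def)
    let ?g = "\<lambda>\<alpha>::real. indicator {-1..1} \<alpha> * ennreal (1 / 2 * ((1 - \<alpha>\<^sup>2) / 4) ^ N)"
    have v: "mverb (m' y) n = b + a * y" for y
      unfolding a_def b_def m'_def by (rule mverb_affine)
    have F: "?F y = ennreal (2 * R ^ N) * ?g (b + a * y)" if "b + a * y \<noteq> 1" "b + a * y \<noteq> -1" for y
    proof (cases "\<bar>b + a * y\<bar> < 1")
      case True
      have "mErr (m' y) j > 0" if "j \<le> Suc n" for j
      proof (cases "j = Suc n")
        case j: True
        then show ?thesis using True pos(2) le[of n y]
          by (simp add: mErr_Suc v abs_square_less_1)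
      qed (use that le mErr_pos_all[OF pos] in simp)
      then have mem: "is_moments (Suc n) (m' y)" by (rule is_momentsI)
      have q: "mErr (m' y) (Suc n) / 4 ^ Suc n = R * ((1 - (b + a * y)\<^sup>2) / 4)"
        by (simp add: mErr_Suc v le R_def)
      have nn: "(1 - (b + a * y)\<^sup>2) / 4 \<ge> 0" using True by (simp add: abs_square_le_1)
      have "?F y = ennreal ((R * ((1 - (b + a * y)\<^sup>2) / 4)) ^ N)"
        unfolding q using mem by simp
      also have "\<dots> = ennreal (2 * R ^ N) * ennreal (1 / 2 * ((1 - (b + a * y)\<^sup>2) / 4) ^ N)"
        using R nn by (subst ennreal_mult[symmetric])
          (simp_all only: power_mult_distrib, auto intro!: zero_le_power)
      also have "\<dots> = ennreal (2 * R ^ N) * ?g (b + a * y)"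
        using True by (auto simp: indicator_def abs_less_iff)
      finally show ?thesis .
    next
      case False
      then have "\<bar>b + a * y\<bar> > 1" using that by auto
      then have "\<not> is_moments (Suc n) (m' y)" using mverb_le_1[of n "m' y"] by (auto simp: v)
      then show ?thesis using False \<open>\<bar>b + a * y\<bar> > 1\<close> by (auto simp: indicator_def)
    qed
    \<comment> \<open>The two values of \<open>y\<close> with coefficient 1 or -1 are dropped: there
      the criterion \<open>is_momentsI\<close> does not apply.\<close>
    have "AE y in lborel. ?F y = ennreal (2 * R ^ N) * ?g (b + a * y)"
      using AE_lborel_singleton[of "(1 - b) / a"] AE_lborel_singleton[of "(-1 - b) / a"]
    proof eventually_elim
      case (elim y)
      then show ?case using a(1) by (intro F) (auto simp: field_simps)
    qed
    then have "integral\<^sup>N lborel ?F = (\<integral>\<^sup>+y. ennreal (2 * R ^ N) * ?g (b + a * y) \<partial>lborel)"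
      by (rule nn_integral_cong_AE)
    also have "\<dots> = ennreal (2 * R ^ N) * (\<integral>\<^sup>+y. ?g (b + a * y) \<partial>lborel)"
      by (rule nn_integral_cmult) measurable
    also have "2 * R ^ N = R ^ Suc N * a" using R a(2) by simp
    also have "ennreal (R ^ Suc N * a) * (\<integral>\<^sup>+y. ?g (b + a * y) \<partial>lborel) =
        ennreal (R ^ Suc N) * (ennreal \<bar>a\<bar> * (\<integral>\<^sup>+y. ?g (b + a * y) \<partial>lborel))"
    proof -
      have "ennreal (R ^ Suc N * a) = ennreal (R ^ Suc N) * ennreal \<bar>a\<bar>"
        using R a(1) by (subst ennreal_mult[symmetric]) auto
      then show ?thesis by (simp only: mult.assoc)
    qed
    also have "ennreal \<bar>a\<bar> * (\<integral>\<^sup>+y. ?g (b + a * y) \<partial>lborel) = canonical_weight N"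
      unfolding canonical_weight_def using a(1) by (intro nn_integral_real_affine[symmetric]) auto
    finally show ?thesis using pos by (simp add: R_def mult.commute)
  qed
qed

lemma slice_integral_Suc:
  assumes C: "moment_constraint C" and n: "last_index C \<le> n"
  shows "slice_integral C (Suc n) N = canonical_weight N * slice_integral C n (Suc N)"
proof -
  interpret product_sigma_finite "\<lambda>_::nat. lborel :: real measure" by unfold_locales
  let ?J = "free_coordinates C n"
  let ?f = "\<lambda>x. indicator (slice C (Suc n)) x * ennreal ((mErr (fill C x) (Suc n) / 4 ^ Suc n) ^ N)"
  have CS: "C (Suc n) = None" using last_index_ge[OF C, of "Suc n"] n by auto
  then have J: "free_coordinates C (Suc n) = insert (Suc n) ?J" "Suc n \<notin> ?J"
    by (auto simp: free_coordinates_def)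
  have n': "last_index C \<le> Suc n" using n by simp
  have [measurable]: "slice C (Suc n) \<in> sets (lebesgue_on_coords (free_coordinates C (Suc n)))"
    using C n' by (rule slice_measurable)
  have [measurable]: "slice C n \<in> sets (lebesgue_on_coords (free_coordinates C n))"
    using C n by (rule slice_measurable)
  have [measurable]: "(\<lambda>x. mErr (fill C x) k) \<in> borel_measurable (lebesgue_on_coords (free_coordinates C k))" for k
    by (intro mErr_measurable fill_measurable)
  have meas: "?f \<in> borel_measurable (lebesgue_on_coords (free_coordinates C (Suc n)))" by measurable
  have "slice_integral C (Suc n) N =
      (\<integral>\<^sup>+x. (\<integral>\<^sup>+y. ?f (x(Suc n := y)) \<partial>lborel) \<partial>lebesgue_on_coords ?J)"
    unfolding slice_integral_def J(1)
    using meas J by (intro product_nn_integral_insert) auto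
  also have "\<dots> = (\<integral>\<^sup>+x. canonical_weight N *
      (indicator (slice C n) x * ennreal ((mErr (fill C x) n / 4 ^ n) ^ Suc N)) \<partial>lebesgue_on_coords ?J)"
  proof (rule nn_integral_cong)
    fix x assume "x \<in> space (lebesgue_on_coords ?J)"
    then have x: "x \<in> extensional ?J" by (simp add: space_PiM PiE_def)
    have f: "fill C (x(Suc n := y)) = (fill C x)(Suc n := y)" for y
      using CS by (auto simp: fill_def fun_eq_iff split: option.split)
    have e: "x(Suc n := y) \<in> extensional (insert (Suc n) ?J)" for y
      using x by (auto simp: extensional_def)
    have "indicator (slice C (Suc n)) (x(Suc n := y)) =
        (indicator {y. is_moments (Suc n) ((fill C x)(Suc n := y))} y :: ennreal)" for y
      using e[of y] by (simp add: slice_iff[OF C n'] f J(1) indicator_def)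
    moreover have "indicator {m. is_moments n m} (fill C x) = (indicator (slice C n) x :: ennreal)"
      using x by (simp add: slice_iff[OF C n] indicator_def)
    ultimately show "(\<integral>\<^sup>+y. ?f (x(Suc n := y)) \<partial>lborel) = canonical_weight N *
      (indicator (slice C n) x * ennreal ((mErr (fill C x) n / 4 ^ n) ^ Suc N))"
      using fibre_integral[of n "fill C x" N] by (simp only: f)
  qed
  also have "\<dots> = canonical_weight N * slice_integral C n (Suc N)"
    unfolding slice_integral_def by (rule nn_integral_cmult) measurable
  finally show ?thesis .
qed

lemma slice_integral_unfold:
  assumes C: "moment_constraint C"
  shows "slice_integral C (last_index C + d) N =
    (\<Prod>l<d. canonical_weight (N + l)) * slice_integral C (last_index C) (N + d)"
proof (induction d arbitrary: N)
  case (Suc d)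
  have "slice_integral C (last_index C + Suc d) N =
      canonical_weight N * (\<Prod>l<d. canonical_weight (Suc N + l)) * slice_integral C (last_index C) (Suc N + d)"
    using slice_integral_Suc[OF C, of "last_index C + d" N] Suc by (simp add: mult.assoc)
  also have "canonical_weight N * (\<Prod>l<d. canonical_weight (Suc N + l)) = (\<Prod>l<Suc d. canonical_weight (N + l))"
    by (subst prod.lessThan_Suc_shift) simp
  finally show ?case by simp
qed simp

section \<open>Volumes as slice integrals\<close>

lemma constrained_volume_eq:
  assumes "moment_constraint C" "last_index C \<le> n"
  shows "constrained_volume C n = enn2real (slice_integral C n 0)"
  using slice_measurable[OF assms]
  by (simp add: constrained_volume_def vol_def slice_integral_def slice_def[symmetric] measure_def)

lemma slice_integral_empty: "slice_integral Map.empty 0 N = 1"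
proof -
  let ?C = "Map.empty :: nat \<rightharpoonup> real"
  have C: "moment_constraint ?C" "last_index ?C = 0"
    by (simp_all add: moment_constraint_def last_index_def)
  have J: "free_coordinates ?C 0 = {}" by (simp add: free_coordinates_def)
  have "(\<lambda>_. undefined) \<in> slice ?C 0"
    using slice_iff[OF C(1), of 0] arcsine_in_moment_measures
    by (auto simp: C(2) J is_moments_def)
  moreover have "space (lebesgue_on_coords {}) = {\<lambda>_. undefined}" by (simp add: space_PiM)
  ultimately have "slice_integral ?C 0 N = (\<integral>\<^sup>+x. 1 \<partial>lebesgue_on_coords {})"
    unfolding slice_integral_def J by (intro nn_integral_cong) auto
  then show ?thesis by (simp add: emeasure_PiM_empty space_PiM_empty)
qed

lemma moment_space_volume:
  "vol {1..n} (moment_space n {0..1}) = enn2real (\<Prod>l<n. canonical_weight l)"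
proof -
  let ?C = "Map.empty :: nat \<rightharpoonup> real"
  have C: "moment_constraint ?C" and last: "last_index ?C = 0"
    by (simp_all add: moment_constraint_def last_index_def)
  have J: "free_coordinates ?C n = {1..n}" for n by (simp add: free_coordinates_def)
  have "(\<lambda>m. restrict m {1..n}) ` constrained_moment_space ?C n {0..1} = moment_space n {0..1}"
    by (simp add: constrained_moment_space_def constrained_measures_def moment_space_def image_image
        moment_vector_def)
  then have "vol {1..n} (moment_space n {0..1}) = constrained_volume ?C n"
    by (simp add: constrained_volume_def J)
  also have "\<dots> = enn2real (slice_integral ?C (last_index ?C + n) 0)"
    using constrained_volume_eq[OF C, of n] by (simp add: last)
  also have "\<dots> = enn2real ((\<Prod>l<n. canonical_weight l) * slice_integral ?C 0 n)"
    unfolding slice_integral_unfold[OF C] by (simp add: last)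
  finally show ?thesis by (simp add: slice_integral_empty)
qed

section \<open>Maximising the range of the next moment\<close>

lemma mErr_tendsto:
  assumes "\<And>j. 1 \<le> j \<Longrightarrow> j \<le> n \<Longrightarrow> (\<lambda>k. m k j) \<longlonglongrightarrow> l j" "\<And>j. j < n \<Longrightarrow> mErr l j \<noteq> 0"
  shows "(\<lambda>k. mErr (m k) n) \<longlonglongrightarrow> mErr l n"
proof -
  \<comment> \<open>The sequence and its limit are bundled into one function on
    \<open>nat option\<close>, so that the closure principle can speak of both; denominators need to
    be nonzero only in the limit.\<close>
  let ?m = "case_option l m"
  have "(\<lambda>k. mErr (?m (Some k)) n) \<longlonglongrightarrow> mErr (?m None) n"
    by (rule mErr_closure[where P = "\<lambda>f. (\<lambda>k. f (Some k)) \<longlonglongrightarrow> f None" and N = "\<lambda>g. g None \<noteq> 0"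
          and m = ?m and n = n])
       (use assms in \<open>auto intro!: tendsto_intros\<close>)
  then show ?thesis by simp
qed

text \<open>A Taylor expansion of order two at 0 in a form closed under arithmetic by plain algebra.
  It demands less than two derivatives near 0 and is all that the pointwise limit in the Laplace
  method uses.\<close>

definition expands2 :: "(real \<Rightarrow> real) \<Rightarrow> bool" where
  "expands2 f \<longleftrightarrow> (\<exists>b h c. (\<forall>s. s \<noteq> 0 \<longrightarrow> f s = f 0 + b * s + h s * s\<^sup>2) \<and> (h \<longlongrightarrow> c) (at 0))"

lemma expands2I:
  assumes "\<And>s. s \<noteq> 0 \<Longrightarrow> f s = f 0 + b * s + h s * s\<^sup>2" "(h \<longlongrightarrow> c) (at 0)"
  shows "expands2 f"
  using assms unfolding expands2_def by blast

lemma expands2E: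
  assumes "expands2 f"
  obtains b h c where "\<And>s. s \<noteq> 0 \<Longrightarrow> f s = f 0 + b * s + h s * s\<^sup>2" "(h \<longlongrightarrow> c) (at 0)"
  using assms unfolding expands2_def by blast

lemma expands2_const: "expands2 (\<lambda>_. c)"
  by (rule expands2I[of _ 0 "\<lambda>_. 0" 0]) auto

lemma expands2_linear: "expands2 (\<lambda>s. a + s * b)"
  by (rule expands2I[of _ b "\<lambda>_. 0" 0]) auto

lemma expands2_add:
  assumes "expands2 f" "expands2 g"
  shows "expands2 (\<lambda>s. f s + g s)"
proof -
  obtain b h c where f: "\<And>s. s \<noteq> 0 \<Longrightarrow> f s = f 0 + b * s + h s * s\<^sup>2" "(h \<longlongrightarrow> c) (at 0)"
    by (rule expands2E[OF assms(1)], rule that, assumption+)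
  obtain b' h' c' where g: "\<And>s. s \<noteq> 0 \<Longrightarrow> g s = g 0 + b' * s + h' s * s\<^sup>2" "(h' \<longlongrightarrow> c') (at 0)"
    by (rule expands2E[OF assms(2)], rule that, assumption+)
  show ?thesis
  proof (rule expands2I[of _ "b + b'" "\<lambda>s. h s + h' s"])
    show "f s + g s = f 0 + g 0 + (b + b') * s + (h s + h' s) * s\<^sup>2" if "s \<noteq> 0" for s
      using f(1)[OF that] g(1)[OF that] by (simp add: algebra_simps)
    show "((\<lambda>s. h s + h' s) \<longlongrightarrow> c + c') (at 0)" by (intro tendsto_intros f g)
  qed
qed

lemma expands2_mult:
  assumes "expands2 f" "expands2 g"
  shows "expands2 (\<lambda>s. f s * g s)"
proof -
  obtain b h c where f: "\<And>s. s \<noteq> 0 \<Longrightarrow> f s = f 0 + b * s + h s * s\<^sup>2" "(h \<longlongrightarrow> c) (at 0)"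
    by (rule expands2E[OF assms(1)], rule that, assumption+)
  obtain b' h' c' where g: "\<And>s. s \<noteq> 0 \<Longrightarrow> g s = g 0 + b' * s + h' s * s\<^sup>2" "(h' \<longlongrightarrow> c') (at 0)"
    by (rule expands2E[OF assms(2)], rule that, assumption+)
  define k where "k s = h s * g 0 + f 0 * h' s + b * b' + (b * h' s + b' * h s) * s + h s * h' s * s\<^sup>2" for s
  show ?thesis
  proof (rule expands2I[of _ "b * g 0 + f 0 * b'" k])
    show "f s * g s = f 0 * g 0 + (b * g 0 + f 0 * b') * s + k s * s\<^sup>2" if "s \<noteq> 0" for s
      unfolding k_def by (subst f(1)[OF that], subst g(1)[OF that]) (simp add: algebra_simps power2_eq_square)
    show "(k \<longlongrightarrow> c * g 0 + f 0 * c' + b * b' + (b * c' + b' * c) * 0 + c * c' * 0\<^sup>2) (at 0)"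
      unfolding k_def by (intro tendsto_intros f g)
  qed
qed

lemma expands2_tendsto:
  assumes "expands2 f"
  shows "(f \<longlongrightarrow> f 0) (at 0)"
proof -
  obtain b h c where f: "\<And>s. s \<noteq> 0 \<Longrightarrow> f s = f 0 + b * s + h s * s\<^sup>2" "(h \<longlongrightarrow> c) (at 0)"
    by (rule expands2E[OF assms], rule that, assumption+)
  have "((\<lambda>s. f 0 + b * s + h s * s\<^sup>2) \<longlongrightarrow> f 0 + b * 0 + c * 0\<^sup>2) (at 0)"
    by (intro tendsto_intros f)
  then have "((\<lambda>s. f 0 + b * s + h s * s\<^sup>2) \<longlongrightarrow> f 0) (at 0)" by simp
  moreover have "eventually (\<lambda>s. f 0 + b * s + h s * s\<^sup>2 = f s) (at 0)"
    using f(1) by (auto simp: eventually_at_filter)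
  ultimately show ?thesis by (rule Lim_transform_eventually)
qed

lemma expands2_inverse:
  assumes "expands2 f" "f 0 \<noteq> 0"
  shows "expands2 (\<lambda>s. inverse (f s))"
proof -
  obtain b h c where f: "\<And>s. s \<noteq> 0 \<Longrightarrow> f s = f 0 + b * s + h s * s\<^sup>2" "(h \<longlongrightarrow> c) (at 0)"
    by (rule expands2E[OF assms(1)], rule that, assumption+)
  define a where "a = f 0"
  have a: "a \<noteq> 0" using assms by (simp add: a_def)
  \<comment> \<open>\<open>f\<close> may vanish away from 0, so \<open>k\<close> is the quotient
    that makes the expansion hold for every nonzero s. Near 0 it agrees with \<open>g\<close>, whose
    limit is evident.\<close>
  define k where "k s = (inverse (f s) - inverse a + b / a\<^sup>2 * s) / s\<^sup>2" for s
  define g where "g s = (b\<^sup>2 - h s * a + h s * b * s) / (a\<^sup>2 * f s)" for s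
  show ?thesis
  proof (rule expands2I[of _ "- b / a\<^sup>2" k])
    show "inverse (f s) = inverse (f 0) + - b / a\<^sup>2 * s + k s * s\<^sup>2" if "s \<noteq> 0" for s
      using that by (simp add: k_def a_def)
    have "(g \<longlongrightarrow> (b\<^sup>2 - c * a + c * b * 0) / (a\<^sup>2 * f 0)) (at 0)"
      unfolding g_def using a assms(2) by (intro tendsto_intros f expands2_tendsto[OF assms(1)]) auto
    moreover have "eventually (\<lambda>s. g s = k s) (at 0)"
    proof -
      have "eventually (\<lambda>s. f s \<noteq> 0) (at 0)"
        using tendsto_imp_eventually_ne[OF expands2_tendsto[OF assms(1)] assms(2)] .
      moreover have "eventually (\<lambda>s::real. s \<noteq> 0) (at 0)" by (simp add: eventually_at_filter)
      ultimately show ?thesis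
      proof eventually_elim
        case (elim s)
        have fs: "f s = a + b * s + h s * s\<^sup>2" using f(1) elim by (simp add: a_def)
        have "(inverse (f s) - inverse a + b / a\<^sup>2 * s) * (a\<^sup>2 * f s) = a\<^sup>2 - a * f s + b * s * f s"
          using a elim by (simp add: field_simps power2_eq_square)
        also have "\<dots> = (b\<^sup>2 - h s * a + h s * b * s) * s\<^sup>2"
          unfolding fs by (simp add: algebra_simps power2_eq_square)
        finally show ?case
          using a elim by (simp add: g_def k_def frac_eq_eq)
      qed
    qed
    ultimately show "(k \<longlongrightarrow> (b\<^sup>2 - c * a + c * b * 0) / (a\<^sup>2 * f 0)) (at 0)"
      by (rule Lim_transform_eventually)
  qed
qed

lemma expands2_divide:
  "expands2 f \<Longrightarrow> expands2 g \<Longrightarrow> g 0 \<noteq> 0 \<Longrightarrow> expands2 (\<lambda>s. f s / g s)"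
  unfolding divide_inverse by (intro expands2_mult expands2_inverse)

lemma expands2_DERIV:
  assumes "\<And>s. s \<noteq> 0 \<Longrightarrow> f s = f 0 + b * s + h s * s\<^sup>2" "(h \<longlongrightarrow> c) (at 0)"
  shows "(f has_real_derivative b) (at 0)"
proof -
  have "((\<lambda>s. b + h s * s) \<longlongrightarrow> b + c * 0) (at 0)" by (intro tendsto_intros assms(2))
  then have "((\<lambda>s. b + h s * s) \<longlongrightarrow> b) (at 0)" by simp
  moreover have "eventually (\<lambda>s. b + h s * s = (f (0 + s) - f 0) / s) (at 0)"
    using assms(1) by (auto simp: eventually_at_filter field_simps power2_eq_square)
  ultimately have "((\<lambda>s. (f (0 + s) - f 0) / s) \<longlongrightarrow> b) (at 0)" by (rule Lim_transform_eventually)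
  then show ?thesis by (simp add: DERIV_def)
qed

lemma mErr_expands2:
  assumes "\<And>j. j < n \<Longrightarrow> mErr m j \<noteq> 0"
  shows "expands2 (\<lambda>s. mErr (\<lambda>j. m j + s * y j) n)"
  by (rule mErr_closure[where P = expands2 and N = "\<lambda>g. g 0 \<noteq> 0" and m = "\<lambda>s j. m j + s * y j"])
     (use assms in \<open>auto intro: expands2_const expands2_add expands2_mult expands2_divide expands2_linear\<close>)

lemma mErr_line_pos:
  assumes "\<And>j. j \<le> n \<Longrightarrow> mErr m j > 0"
  shows "eventually (\<lambda>s. \<forall>j\<le>n. mErr (\<lambda>j. m j + s * y j) j > 0) (at 0)"
proof -
  have "eventually (\<lambda>s. mErr (\<lambda>j. m j + s * y j) j > 0) (at 0)" if "j \<le> n" for j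
  proof -
    have "((\<lambda>s. mErr (\<lambda>j. m j + s * y j) j) \<longlongrightarrow> mErr (\<lambda>j. m j + 0 * y j) j) (at 0)"
    proof (rule expands2_tendsto, rule mErr_expands2)
      show "mErr m i \<noteq> 0" if "i < j" for i
        using assms[of i] that \<open>j \<le> n\<close> by simp
    qed
    then show ?thesis using assms[OF that] by (intro order_tendstoD(1)) auto
  qed
  then have "eventually (\<lambda>s. \<forall>j\<in>{..n}. mErr (\<lambda>j. m j + s * y j) j > 0) (at 0)"
    by (intro eventually_ball_finite) auto
  then show ?thesis by (rule eventually_mono) auto
qed

section \<open>Measures with a reciprocal polynomial density\<close>

definition inv_poly_measure :: "real poly \<Rightarrow> real measure" where
  "inv_poly_measure p = density arcsine (\<lambda>x. ennreal (1 / poly p x))"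

definition pos_poly :: "real poly \<Rightarrow> bool" where
  "pos_poly p \<longleftrightarrow> (\<forall>x\<in>{0..1}. poly p x > 0)"

lemma pos_polyD: "pos_poly p \<Longrightarrow> x \<in> {0..1} \<Longrightarrow> poly p x > 0"
  by (simp add: pos_poly_def)

lemma arcsine_integrable:
  fixes f :: "real \<Rightarrow> real"
  shows "continuous_on {0..1} f \<Longrightarrow> integrable arcsine f"
  by (rule moment_measures_integrable[OF arcsine_in_moment_measures])

lemma arcsine_measurable: "continuous_on {0..1} f \<Longrightarrow> f \<in> borel_measurable arcsine"
  by (rule moment_measures_measurable[OF arcsine_in_moment_measures])

lemma continuous_on_inv_poly:
  "pos_poly p \<Longrightarrow> continuous_on {0..1} (\<lambda>x. 1 / poly p x)"
  by (intro continuous_intros) (auto dest: pos_polyD)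

lemma integral_inv_poly_measure:
  fixes f :: "real \<Rightarrow> real"
  assumes p: "pos_poly p" and f: "continuous_on {0..1} f"
  shows "(\<integral>x. f x \<partial>inv_poly_measure p) = (\<integral>x. f x / poly p x \<partial>arcsine)"
proof -
  have "(\<integral>x. f x \<partial>inv_poly_measure p) = (\<integral>x. (1 / poly p x) *\<^sub>R f x \<partial>arcsine)"
    unfolding inv_poly_measure_def using pos_polyD[OF p]
    by (intro integral_density arcsine_measurable continuous_on_inv_poly p f AE_I2) (auto intro: less_imp_le)
  then show ?thesis by simp
qed

lemma integral_poly_inv_poly_measure:
  assumes p: "pos_poly p"
  shows "(\<integral>x. poly p x \<partial>inv_poly_measure p) = 1"
proof -
  have "(\<integral>x. poly p x \<partial>inv_poly_measure p) = (\<integral>x. poly p x / poly p x \<partial>arcsine)"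
    by (intro integral_inv_poly_measure[OF p] continuous_intros)
  also have "\<dots> = (\<integral>x. 1 \<partial>arcsine)"
  proof (rule Bochner_Integration.integral_cong[OF refl])
    fix x assume "x \<in> space arcsine"
    then show "poly p x / poly p x = 1" using pos_polyD[OF p, of x] by simp
  qed
  finally show ?thesis using arcsine.prob_space by simp
qed

lemma regular_poly:
  assumes "\<And>j. j \<le> n \<Longrightarrow> mErr m j > 0"
  obtains p where "degree p \<le> n" "pos_poly p" "inv_poly_measure p \<in> moment_measures {0..1}"
    "\<And>j. j \<in> {1..n} \<Longrightarrow> m j = moment j (inv_poly_measure p)"
    "(\<integral>x. ln (poly p x) \<partial>arcsine) = - ln (mErr m n)"
  using bs_measure_moments[OF assms] unfolding inv_poly_measure_def pos_poly_def by blast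

text \<open>Integrate \<open>ln y \<le> y - 1\<close> at \<open>y = q / p\<close>, where \<open>1 / p\<close> is the Bernstein-Szego density of \<open>m\<close>.\<close>

lemma ln_mErr_le:
  assumes m: "\<And>j. j \<le> n \<Longrightarrow> mErr m j > 0" and q: "pos_poly q" "degree q \<le> n"
  shows "ln (mErr m n) \<le> moment_functional m q - 1 - (\<integral>x. ln (poly q x) \<partial>arcsine)"
proof -
  obtain p where p: "pos_poly p" "inv_poly_measure p \<in> moment_measures {0..1}"
    "\<And>j. j \<in> {1..n} \<Longrightarrow> m j = moment j (inv_poly_measure p)"
    "(\<integral>x. ln (poly p x) \<partial>arcsine) = - ln (mErr m n)"
    using regular_poly[OF m] by metis
  have cp: "continuous_on {0..1} (\<lambda>x. ln (poly r x))" if "pos_poly r" for r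
    using pos_polyD[OF that] by (intro continuous_intros) force
  have cq: "continuous_on {0..1} (\<lambda>x. poly q x / poly p x)"
    using pos_polyD[OF p(1)] by (intro continuous_intros) force
  have "(\<integral>x. ln (poly q x) - ln (poly p x) \<partial>arcsine) \<le> (\<integral>x. poly q x / poly p x - 1 \<partial>arcsine)"
  proof (rule integral_mono)
    fix x assume "x \<in> space arcsine"
    then have "poly q x > 0" "poly p x > 0" using pos_polyD p(1) q(1) by auto
    then show "ln (poly q x) - ln (poly p x) \<le> poly q x / poly p x - 1"
      using ln_le_minus_one[of "poly q x / poly p x"] by (simp add: ln_div)
  qed (intro arcsine_integrable continuous_intros cp cq p q)+
  also have "\<dots> = moment_functional m q - 1"
    using integral_poly[OF p(2) q(2), of m] p(3) integral_inv_poly_measure[OF p(1), of "poly q"]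
      arcsine_integrable[OF cq] arcsine.prob_space
    by (simp add: continuous_on_poly continuous_on_id)
  also have "(\<integral>x. ln (poly q x) - ln (poly p x) \<partial>arcsine) =
      (\<integral>x. ln (poly q x) \<partial>arcsine) + ln (mErr m n)"
    using arcsine_integrable[OF cp[OF p(1)]] arcsine_integrable[OF cp[OF q(1)]] p(4) by simp
  finally show ?thesis by simp
qed

section \<open>Admissibility and the constrained maximum\<close>

definition satisfies :: "(nat \<rightharpoonup> real) \<Rightarrow> (nat \<Rightarrow> real) \<Rightarrow> bool" where
  "satisfies C m \<longleftrightarrow> (\<forall>j c. C j = Some c \<longrightarrow> m j = c)"

lemma constrained_measures_iff:
  "\<mu> \<in> constrained_measures C {0..1} \<longleftrightarrow>
    \<mu> \<in> moment_measures {0..1} \<and> satisfies C (\<lambda>j. moment j \<mu>)"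
  by (auto simp: constrained_measures_def satisfies_def)

text \<open>At the first vanishing error the preceding coefficient has modulus 1. Moving that single
  coordinate outwards makes the modulus exceed 1, which no measure allows, although an interior
  point leaves room for the move.\<close>

lemma interior_mErr_pos:
  assumes "m \<in> (product_topology (\<lambda>_. euclideanreal) {1..n}) interior_of (moment_space n {0..1})"
  shows "mErr m n > 0"
proof (rule ccontr)
  assume neg: "\<not> mErr m n > 0"
  have ms: "is_moments n x" if "x \<in> moment_space n {0..1}" for x
    using that by (auto simp: moment_space_def is_moments_def moment_vector_def)
  obtain T where T: "openin (product_topology (\<lambda>_. euclideanreal) {1..n}) T" "m \<in> T"
    "T \<subseteq> moment_space n {0..1}"
    using assms by (auto simp: interior_of_def)
  then obtain U where U: "\<And>i. i \<in> {1..n} \<Longrightarrow> open (U i)" "m \<in> Pi\<^sub>E {1..n} U" "Pi\<^sub>E {1..n} U \<subseteq> T"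
    unfolding openin_product_topology_alt by (metis open_openin)
  have im: "is_moments n m" using T ms by blast
  then have "mErr m n = 0" using mErr_nonneg[of n m n] neg by simp
  define k where "k = (LEAST k. mErr m k = 0)"
  have k: "mErr m k = 0" "k \<le> n"
    unfolding k_def using LeastI[of "\<lambda>k. mErr m k = 0", OF \<open>mErr m n = 0\<close>]
      Least_le[of "\<lambda>k. mErr m k = 0", OF \<open>mErr m n = 0\<close>] by auto
  then obtain l where l: "k = Suc l" by (cases k) auto
  have "mErr m l \<noteq> 0"
    using not_less_Least[of l "\<lambda>k. mErr m k = 0"] l unfolding k_def by simp
  then have lpos: "mErr m l > 0" using mErr_nonneg[OF im, of l] k(2) l by simp
  have sq: "(mverb m l)\<^sup>2 = 1" using k(1) lpos by (simp add: l mErr_Suc)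
  define a where "a = 2 * 4 ^ l / mErr m l"
  have a: "a > 0" using lpos by (simp add: a_def)
  have aff: "mverb (m(Suc l := y)) l = verb_offset m l + a * y" for y
    unfolding a_def by (rule mverb_affine)
  have kn: "Suc l \<in> {1..n}" using k(2) l by simp
  have "m (Suc l) \<in> U (Suc l)" using U(2) kn by auto
  then obtain e where e: "e > 0" "\<And>y. dist y (m (Suc l)) < e \<Longrightarrow> y \<in> U (Suc l)"
    using U(1)[OF kn] unfolding open_dist by blast
  have bound: "\<bar>mverb (m(Suc l := y)) l\<bar> \<le> 1" if "dist y (m (Suc l)) < e" for y
  proof -
    have "m(Suc l := y) \<in> Pi\<^sub>E {1..n} U"
      using U(2) e(2)[OF that] kn by (auto simp: PiE_iff extensional_def)
    then have "is_moments n (m(Suc l := y))" using U(3) T(3) ms by blast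
    then show ?thesis using is_moments_mono[of n _ "Suc l"] kn by (intro mverb_le_1) auto
  qed
  \<comment> \<open>The sign is that of the coefficient, since the slope of the affine map is
    positive: the move increases the modulus.\<close>
  define \<delta> where "\<delta> = e / 2 * sgn (mverb m l)"
  have v0: "\<bar>mverb m l\<bar> = 1" using sq by (auto simp: power2_eq_1_iff)
  have "\<bar>\<delta>\<bar> < e" using e(1) v0 by (auto simp: \<delta>_def abs_mult abs_sgn_eq)
  then have "\<bar>mverb (m(Suc l := m (Suc l) + \<delta>)) l\<bar> \<le> 1" by (intro bound) (simp add: dist_real_def)
  moreover have "mverb (m(Suc l := m (Suc l) + \<delta>)) l = mverb m l + a * \<delta>"
    using aff[of "m (Suc l) + \<delta>"] aff[of "m (Suc l)"] by (simp add: algebra_simps)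
  moreover have "\<bar>mverb m l + a * \<delta>\<bar> > 1"
  proof (cases "mverb m l > 0")
    case True
    then show ?thesis using v0 a e(1) by (simp add: \<delta>_def)
  next
    case False
    then have "mverb m l = -1" using v0 by linarith
    then show ?thesis using mult_pos_pos[OF a e(1)] by (simp add: \<delta>_def)
  qed
  ultimately show False by simp
qed

lemma admissible_imp_mErr_pos:
  assumes "admissible C {0..1}"
  shows "\<exists>\<mu>\<in>constrained_measures C {0..1}. mErr (\<lambda>j. moment j \<mu>) (last_index C) > 0"
proof -
  obtain \<mu> where \<mu>: "\<mu> \<in> constrained_measures C {0..1}"
    "moment_vector (last_index C) \<mu> \<in>
      (product_topology (\<lambda>_. euclideanreal) {1..last_index C}) interior_of (moment_space (last_index C) {0..1})"
    using assms by (auto simp: admissible_def constrained_moment_space_def)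
  have "mErr (\<lambda>j. moment j \<mu>) (last_index C) = mErr (moment_vector (last_index C) \<mu>) (last_index C)"
    by (rule mErr_cong) (simp add: moment_vector_def)
  then show ?thesis using interior_mErr_pos[OF \<mu>(2)] by (intro bexI[OF _ \<mu>(1)]) simp
qed

text \<open>\<open>mErr\<close> is known to be continuous only where the earlier errors do not
  vanish, so compactness alone does not suffice: the limit of a maximising sequence must be shown to
  be nondegenerate.\<close>

lemma mErr_maximiser:
  assumes \<mu>0: "\<mu>0 \<in> constrained_measures C {0..1}" and pos0: "mErr (\<lambda>j. moment j \<mu>0) i > 0"
  obtains \<nu> where "\<nu> \<in> constrained_measures C {0..1}" "mErr (\<lambda>j. moment j \<nu>) i > 0"
    "\<And>\<mu>. \<mu> \<in> constrained_measures C {0..1} \<Longrightarrow> mErr (\<lambda>j. moment j \<mu>) i \<le> mErr (\<lambda>j. moment j \<nu>) i"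
proof -
  let ?P = "constrained_measures C {0..1}" and ?E = "\<lambda>\<mu>. mErr (\<lambda>j. moment j \<mu>) i"
  have im: "is_moments n (\<lambda>j. moment j \<mu>)" if "\<mu> \<in> ?P" for \<mu> n
    using that by (auto simp: is_moments_def constrained_measures_iff)
  define s where "s = (SUP \<mu>\<in>?P. ?E \<mu>)"
  have bdd: "bdd_above (?E ` ?P)"
    using mErr_le_1[OF im] by (intro bdd_aboveI2[of _ _ 1]) auto
  have le_s: "?E \<mu> \<le> s" if "\<mu> \<in> ?P" for \<mu>
    unfolding s_def using bdd that by (rule cSUP_upper2) simp
  have "\<exists>\<mu>\<in>?P. ?E \<mu> > s - 1 / real (Suc k)" for k
  proof -
    have "s - 1 / real (Suc k) < s" by simp
    then show ?thesis unfolding s_def using bdd \<mu>0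
      by (subst (asm) less_cSUP_iff) (auto simp: s_def)
  qed
  then obtain \<mu> where \<mu>: "\<And>k. \<mu> k \<in> ?P" "\<And>k. ?E (\<mu> k) > s - 1 / real (Suc k)" by metis
  obtain r \<nu> where r: "strict_mono (r :: nat \<Rightarrow> nat)" "\<nu> \<in> moment_measures {0..1}"
    "\<And>j. (\<lambda>k. moment j (\<mu> (r k))) \<longlonglongrightarrow> moment j \<nu>"
    using moment_measures_seq_compact[of \<mu>] \<mu>(1) by (auto simp: constrained_measures_iff)
  have \<nu>: "\<nu> \<in> ?P"
  proof -
    have "moment j \<nu> = c" if "C j = Some c" for j c
    proof (rule LIMSEQ_unique[OF r(3)])
      have "moment j (\<mu> (r k)) = c" for k
        using \<mu>(1)[of "r k"] that by (auto simp: constrained_measures_def)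
      then show "(\<lambda>k. moment j (\<mu> (r k))) \<longlonglongrightarrow> c" by simp
    qed
    then show ?thesis using r(2) by (auto simp: constrained_measures_def)
  qed
  have "(\<lambda>k. ?E (\<mu> k)) \<longlonglongrightarrow> s"
  proof (rule tendsto_sandwich)
    show "(\<lambda>k. s - 1 / real (Suc k)) \<longlonglongrightarrow> s"
      using tendsto_diff[OF tendsto_const LIMSEQ_inverse_real_of_nat, of s] by (simp add: inverse_eq_divide)
    show "eventually (\<lambda>k. s - 1 / real (Suc k) \<le> ?E (\<mu> k)) sequentially"
      using \<mu>(2) by (intro always_eventually allI less_imp_le)
    show "eventually (\<lambda>k. ?E (\<mu> k) \<le> s) sequentially"
      using le_s[OF \<mu>(1)] by (intro always_eventually allI)
  qed (rule tendsto_const)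
  then have lim: "(\<lambda>k. ?E (\<mu> (r k))) \<longlonglongrightarrow> s"
    using LIMSEQ_subseq_LIMSEQ[OF _ r(1)] by (force simp: o_def)
  have s: "s > 0" using pos0 le_s[OF \<mu>0] by simp
  \<comment> \<open>Order by order: once the earlier errors of the limit are nonzero, the error of
    order k is continuous there, and along the sequence it dominates the error of order i, which
    tends to \<open>s\<close> > 0.\<close>
  have nz: "mErr (\<lambda>j. moment j \<nu>) k > 0" if "k \<le> i" for k
    using that
  proof (induction k rule: less_induct)
    case (less k)
    have "(\<lambda>n. mErr (\<lambda>j. moment j (\<mu> (r n))) k) \<longlonglongrightarrow> mErr (\<lambda>j. moment j \<nu>) k"
      using less by (intro mErr_tendsto r(3)) force
    then have "s \<le> mErr (\<lambda>j. moment j \<nu>) k"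
      using mErr_antimono[OF im[OF \<mu>(1)] less.prems order_refl]
      by (intro LIMSEQ_le[OF lim]) auto
    then show ?case using s by simp
  qed
  have "mErr (\<lambda>j. moment j \<nu>) k \<noteq> 0" if "k < i" for k using nz[of k] that by simp
  then have "(\<lambda>n. ?E (\<mu> (r n))) \<longlonglongrightarrow> ?E \<nu>" by (intro mErr_tendsto r(3))
  with lim have "?E \<nu> = s" by (metis LIMSEQ_unique)
  then show thesis using that[of \<nu>] \<nu> s le_s by simp
qed

text \<open>Vary one free coordinate c by s. The error \<phi> has a maximum at s = 0, hence
  derivative 0. By \<open>ln_mErr_le\<close> its logarithm also lies below a line of slope
  \<open>coeff p c\<close> that touches it at 0, so its logarithmic derivative is that coefficient,
  which therefore vanishes. No formula for the derivative of the error is needed.\<close>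

lemma maximiser_poly:
  assumes C: "moment_constraint C" and i: "last_index C \<le> i"
    and \<mu>0: "\<mu>0 \<in> constrained_measures C {0..1}" "mErr (\<lambda>j. moment j \<mu>0) i > 0"
  obtains p where "degree p \<le> i" "pos_poly p" "inv_poly_measure p \<in> constrained_measures C {0..1}"
    "mErr (\<lambda>j. moment j (inv_poly_measure p)) i > 0"
    "(\<integral>x. ln (poly p x) \<partial>arcsine) = - ln (mErr (\<lambda>j. moment j (inv_poly_measure p)) i)"
    "\<And>j. 1 \<le> j \<Longrightarrow> j \<notin> dom C \<Longrightarrow> coeff p j = 0"
proof -
  obtain \<nu> where \<nu>: "\<nu> \<in> constrained_measures C {0..1}" "mErr (\<lambda>j. moment j \<nu>) i > 0"
    and max: "\<And>\<mu>. \<mu> \<in> constrained_measures C {0..1} \<Longrightarrow> mErr (\<lambda>j. moment j \<mu>) i \<le> mErr (\<lambda>j. moment j \<nu>) i"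
    using mErr_maximiser[OF \<mu>0] by metis
  define m where "m = (\<lambda>j. moment j \<nu>)"
  have im: "is_moments i m" using \<nu>(1) by (auto simp: is_moments_def m_def constrained_measures_iff)
  have mpos: "mErr m j > 0" if "j \<le> i" for j
    using mErr_pos_all[OF im _ that] \<nu>(2) by (simp add: m_def)
  obtain p where p: "degree p \<le> i" "pos_poly p" "inv_poly_measure p \<in> moment_measures {0..1}"
    "\<And>j. j \<in> {1..i} \<Longrightarrow> m j = moment j (inv_poly_measure p)"
    "(\<integral>x. ln (poly p x) \<partial>arcsine) = - ln (mErr m i)"
    using regular_poly[OF mpos] by metis
  have E: "mErr (\<lambda>j. moment j (inv_poly_measure p)) i = mErr m i"
    using p(4) by (intro mErr_cong) auto
  have dom: "j \<in> {1..i}" if "j \<in> dom C" for j using last_index_ge[OF C that] i by simp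
  have cons: "\<mu> \<in> constrained_measures C {0..1}"
    if "\<mu> \<in> moment_measures {0..1}" "\<And>j. j \<in> dom C \<Longrightarrow> moment j \<mu> = m j" for \<mu>
    using that \<nu>(1) by (auto simp: constrained_measures_def m_def)
  have one: "moment_functional m p = 1"
    using integral_poly[OF p(3) p(1), of m] p(4) integral_poly_inv_poly_measure[OF p(2)] by simp
  have "coeff p c = 0" if c: "1 \<le> c" "c \<notin> dom C" for c
  proof (cases "c \<le> i")
    case False
    then show ?thesis using p(1) by (intro coeff_eq_0) simp
  next
    case True
    define y :: "nat \<Rightarrow> real" where "y = (\<lambda>j. if j = c then 1 else 0)"
    define \<phi> where "\<phi> s = mErr (\<lambda>j. m j + s * y j) i" for s
    define \<kappa> where "\<kappa> = coeff p c"
    have \<phi>0: "\<phi> 0 = mErr m i" by (simp add: \<phi>_def)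
    have "mErr m j \<noteq> 0" if "j < i" for j using mpos[of j] that by simp
    then have "expands2 \<phi>" unfolding \<phi>_def by (intro mErr_expands2)
    then obtain b where D: "(\<phi> has_real_derivative b) (at 0)"
      using expands2_DERIV by (metis expands2E)
    have "eventually (\<lambda>s. \<forall>j\<le>i. mErr (\<lambda>j. m j + s * y j) j > 0) (at 0)"
      by (rule mErr_line_pos) (rule mpos)
    then obtain d where d: "d > 0" "\<And>s j. s \<noteq> 0 \<Longrightarrow> \<bar>s\<bar> < d \<Longrightarrow> j \<le> i \<Longrightarrow> mErr (\<lambda>j. m j + s * y j) j > 0"
      unfolding eventually_at by (auto simp: dist_real_def)
    have small: "\<phi> s \<le> \<phi> 0 \<and> ln (\<phi> s) \<le> ln (\<phi> 0) + s * \<kappa> \<and> \<phi> s > 0" if "s \<noteq> 0" "\<bar>s\<bar> < d" for s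
    proof -
      let ?m = "\<lambda>j. m j + s * y j"
      have pos: "mErr ?m j > 0" if "j \<le> i" for j using d(2)[OF \<open>s \<noteq> 0\<close> \<open>\<bar>s\<bar> < d\<close> that] .
      have "is_moments i ?m" using pos by (rule is_momentsI)
      then obtain \<mu> where \<mu>: "\<mu> \<in> moment_measures {0..1}" "\<And>j. j \<in> {1..i} \<Longrightarrow> ?m j = moment j \<mu>"
        by (auto simp: is_moments_def)
      have "moment j \<mu> = m j" if "j \<in> dom C" for j
      proof -
        have "j \<noteq> c" using that c(2) by blast
        then show ?thesis using \<mu>(2)[OF dom[OF that]] by (simp add: y_def)
      qed
      then have "\<mu> \<in> constrained_measures C {0..1}" using cons \<mu>(1) by blast
      then have "mErr (\<lambda>j. moment j \<mu>) i \<le> \<phi> 0" using max by (simp add: \<phi>0 m_def)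
      moreover have "mErr (\<lambda>j. moment j \<mu>) i = \<phi> s"
        unfolding \<phi>_def using \<mu>(2) by (intro mErr_cong) auto
      moreover have "ln (\<phi> s) \<le> moment_functional ?m p - 1 - (- ln (\<phi> 0))"
        using ln_mErr_le[OF pos p(2,1)] p(5) by (simp add: \<phi>_def)
      moreover have "moment_functional ?m p = moment_functional m p + s * \<kappa>"
      proof -
        have "moment_functional ?m p = (\<Sum>l\<le>i. coeff p l * (if l = 0 then 1 else m l) + (if l = c then s * \<kappa> else 0))"
          unfolding moment_functional_altdef[OF p(1)] using c(1)
          by (intro sum.cong) (auto simp: y_def \<kappa>_def algebra_simps)
        then show ?thesis using True by (simp add: sum.distrib moment_functional_altdef[OF p(1)])
      qed
      moreover have "\<phi> s > 0" using pos[of i] by (simp add: \<phi>_def)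
      ultimately show ?thesis using one by simp
    qed
    have "b = 0"
    proof (rule DERIV_local_max[OF D d(1)], intro allI impI)
      fix s :: real assume "\<bar>0 - s\<bar> < d"
      then show "\<phi> s \<le> \<phi> 0" using small[of s] by (cases "s = 0") auto
    qed
    have "\<phi> 0 > 0" using mpos[of i] by (simp add: \<phi>0)
    \<comment> \<open>The tangent bound, exponentiated to compare with \<phi> itself; the difference
      is maximal at 0.\<close>
    have D2: "((\<lambda>s. \<phi> s - \<phi> 0 * exp (s * \<kappa>)) has_real_derivative (b - \<phi> 0 * \<kappa>)) (at 0)"
      by (auto intro!: derivative_eq_intros D)
    have "b - \<phi> 0 * \<kappa> = 0"
    proof (rule DERIV_local_max[OF D2 d(1)], intro allI impI)
      fix s :: real assume "\<bar>0 - s\<bar> < d"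
      show "\<phi> s - \<phi> 0 * exp (s * \<kappa>) \<le> \<phi> 0 - \<phi> 0 * exp (0 * \<kappa>)"
      proof (cases "s = 0")
        case False
        then have *: "ln (\<phi> s) \<le> ln (\<phi> 0) + s * \<kappa>" "\<phi> s > 0" using small[of s] \<open>\<bar>0 - s\<bar> < d\<close> by auto
        have "\<phi> s = exp (ln (\<phi> s))" using *(2) by simp
        also have "\<dots> \<le> exp (ln (\<phi> 0) + s * \<kappa>)" using *(1) by simp
        also have "\<dots> = \<phi> 0 * exp (s * \<kappa>)" using \<open>\<phi> 0 > 0\<close> by (simp add: exp_add)
        finally show ?thesis by simp
      qed simp
    qed
    then show ?thesis using \<open>b = 0\<close> \<open>\<phi> 0 > 0\<close> by (simp add: \<kappa>_def)
  qed
  moreover have "inv_poly_measure p \<in> constrained_measures C {0..1}"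
    using p(3,4) dom by (intro cons) auto
  ultimately show thesis using that[of p] p mpos[of i] E by simp
qed

section \<open>The entropy minimiser\<close>

lemma rel_entropy_density:
  fixes f :: "real \<Rightarrow> real"
  assumes \<mu>: "prob_space \<mu>" and f: "f \<in> borel_measurable \<mu>" "\<And>x. x \<in> space \<mu> \<Longrightarrow> f x \<ge> 0"
    and arc: "density \<mu> (\<lambda>x. ennreal (f x)) = arcsine"
  shows "absolutely_continuous \<mu> arcsine"
    "AE x in arcsine. entropy_density (exp 1) \<mu> arcsine x = ln (f x)"
proof -
  interpret prob_space \<mu> by fact
  have s: "sets arcsine = sets \<mu>" using arc by (metis sets_density)
  have m: "(\<lambda>x. ennreal (f x)) \<in> borel_measurable \<mu>" using f(1) by simp
  show ac: "absolutely_continuous \<mu> arcsine"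
    using absolutely_continuousI_density[OF m] arc by simp
  have "AE x in \<mu>. ennreal (f x) = RN_deriv \<mu> arcsine x"
    using RN_deriv_unique[OF m arc] .
  moreover have "AE x in \<mu>. x \<in> space \<mu>" by simp
  ultimately have "AE x in \<mu>. entropy_density (exp 1) \<mu> arcsine x = ln (f x)"
  proof eventually_elim
    case (elim x)
    then have "enn2real (RN_deriv \<mu> arcsine x) = f x" using f(2) by (metis enn2real_ennreal)
    then show ?case by (simp add: entropy_density_def log_def)
  qed
  then show "AE x in arcsine. entropy_density (exp 1) \<mu> arcsine x = ln (f x)"
    by (rule absolutely_continuous_AE[OF s ac])
qed

lemma entropy_density_arcsine_measurable:
  assumes "sets \<mu> = sets arcsine"
  shows "entropy_density (exp 1) \<mu> arcsine \<in> borel_measurable arcsine"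
  by (subst measurable_cong_sets[OF assms[symmetric] refl]) simp

lemma inv_poly_measure_density:
  assumes p: "pos_poly p"
  shows "density (inv_poly_measure p) (\<lambda>x. ennreal (poly p x)) = arcsine"
proof -
  have [measurable]: "(\<lambda>x. poly p x) \<in> borel_measurable arcsine" "(\<lambda>x. 1 / poly p x) \<in> borel_measurable arcsine"
    by (intro arcsine_measurable continuous_intros continuous_on_inv_poly p)+
  have "density (inv_poly_measure p) (\<lambda>x. ennreal (poly p x)) =
      density arcsine (\<lambda>x. ennreal (1 / poly p x) * ennreal (poly p x))"
    unfolding inv_poly_measure_def by (rule density_density_eq) measurable
  also have "\<dots> = density arcsine (\<lambda>_. 1)"
  proof (rule density_cong)
    have "ennreal (1 / poly p x) * ennreal (poly p x) = 1" if "x \<in> {0..1}" for x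
      using pos_polyD[OF p that] by (subst ennreal_mult[symmetric]) auto
    then show "AE x in arcsine. ennreal (1 / poly p x) * ennreal (poly p x) = 1"
      by (intro AE_I2) simp
  qed measurable
  finally show ?thesis by (simp add: density_1)
qed

lemma rel_entropy_inv_poly_measure:
  assumes p: "pos_poly p" and P: "inv_poly_measure p \<in> moment_measures {0..1}"
  shows "rel_entropy arcsine (inv_poly_measure p) = ereal (\<integral>x. ln (poly p x) \<partial>arcsine)"
proof -
  let ?\<nu> = "inv_poly_measure p"
  have "continuous_on {0..1} (poly p)" by (intro continuous_intros)
  then have f: "poly p \<in> borel_measurable ?\<nu>" "\<And>x. x \<in> space ?\<nu> \<Longrightarrow> poly p x \<ge> 0"
    using moment_measures_measurable[OF P] pos_polyD[OF p] moment_measuresD(3)[OF P]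
    by (auto intro: less_imp_le)
  note d = rel_entropy_density[OF moment_measuresD(1)[OF P] f inv_poly_measure_density[OF p]]
  have c: "continuous_on {0..1} (\<lambda>x. ln (poly p x))"
    using pos_polyD[OF p] by (intro continuous_intros) force
  have s: "sets ?\<nu> = sets arcsine" by (simp add: inv_poly_measure_def)
  have m: "entropy_density (exp 1) ?\<nu> arcsine \<in> borel_measurable arcsine"
    using s by (rule entropy_density_arcsine_measurable)
  have "integrable arcsine (entropy_density (exp 1) ?\<nu> arcsine)"
    using arcsine_integrable[OF c] integrable_cong_AE[OF m arcsine_measurable[OF c] d(2)] by simp
  moreover have "KL_divergence (exp 1) ?\<nu> arcsine = (\<integral>x. ln (poly p x) \<partial>arcsine)"
    unfolding KL_divergence_def by (rule integral_cong_AE[OF m arcsine_measurable[OF c] d(2)])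
  ultimately show ?thesis using d(1) by (simp add: rel_entropy_def)
qed

text \<open>With \<open>D = d arcsine / d \<mu>\<close> and \<open>g = p / D\<close> one has \<open>\<integral>g \<le> \<integral>p d\<mu> = 1\<close> while
  \<open>\<integral>ln g \<ge> 0\<close>; as \<open>ln g \<le> g - 1\<close>, equality holds throughout.\<close>

lemma inv_poly_measure_unique:
  assumes p: "pos_poly p" and P: "inv_poly_measure p \<in> moment_measures {0..1}"
    and \<mu>: "\<mu> \<in> moment_measures {0..1}" and one: "(\<integral>x. poly p x \<partial>\<mu>) = 1"
    and le: "rel_entropy arcsine \<mu> \<le> rel_entropy arcsine (inv_poly_measure p)"
  shows "\<mu> = inv_poly_measure p"
proof -
  interpret prob_space \<mu> by (rule moment_measuresD[OF \<mu>])
  have s: "sets \<mu> = sets arcsine" using moment_measuresD(2)[OF \<mu>] sets_arcsine by simp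
  have sp: "space \<mu> = {0..1}" by (rule moment_measuresD(3)[OF \<mu>])
  note m_cong = measurable_cong_sets[OF s refl]
  have "rel_entropy arcsine \<mu> \<noteq> \<infinity>" using le rel_entropy_inv_poly_measure[OF p P] by auto
  then have ac: "absolutely_continuous \<mu> arcsine"
    and int: "integrable arcsine (entropy_density (exp 1) \<mu> arcsine)"
    by (auto simp: rel_entropy_def split: if_splits)
  obtain D where D: "D \<in> borel_measurable \<mu>" "AE x in \<mu>. RN_deriv \<mu> arcsine x = ennreal (D x)"
    "AE x in arcsine. 0 < D x" "\<And>x. 0 \<le> D x"
    using real_RN_deriv[OF arcsine.finite_measure_axioms ac s[symmetric]] by metis
  have arc: "density \<mu> (\<lambda>x. ennreal (D x)) = arcsine"
  proof -
    have "density \<mu> (\<lambda>x. ennreal (D x)) = density \<mu> (RN_deriv \<mu> arcsine)"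
      using D(1,2) by (intro density_cong) auto
    then show ?thesis using density_RN_deriv[OF ac s[symmetric]] by simp
  qed
  have D': "D \<in> borel_measurable arcsine" using D(1) by (simp add: m_cong)
  have pm: "poly p \<in> borel_measurable arcsine" "poly p \<in> borel_measurable \<mu>"
    by (intro arcsine_measurable moment_measures_measurable[OF \<mu>] continuous_intros)+
  note [measurable] = D(1) D' pm
  note e = rel_entropy_density(2)[OF prob_space_axioms D(1) D(4) arc]
  have em: "entropy_density (exp 1) \<mu> arcsine \<in> borel_measurable arcsine"
    using s by (rule entropy_density_arcsine_measurable)
  have lnD_m: "(\<lambda>x. ln (D x)) \<in> borel_measurable arcsine" by measurable
  have lnD_i: "integrable arcsine (\<lambda>x. ln (D x))"
    using int integrable_cong_AE[OF em lnD_m e] by simp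
  have "rel_entropy arcsine \<mu> = ereal (\<integral>x. ln (D x) \<partial>arcsine)"
    using ac int integral_cong_AE[OF em lnD_m e] by (simp add: rel_entropy_def KL_divergence_def)
  then have ent: "(\<integral>x. ln (D x) \<partial>arcsine) \<le> (\<integral>x. ln (poly p x) \<partial>arcsine)"
    using le rel_entropy_inv_poly_measure[OF p P] by simp
  have lnp: "integrable arcsine (\<lambda>x. ln (poly p x))"
    using pos_polyD[OF p] by (intro arcsine_integrable continuous_intros) force
  define g where "g x = poly p x / D x" for x
  have gm[measurable]: "g \<in> borel_measurable arcsine" unfolding g_def by measurable
  have p\<mu>: "(\<integral>\<^sup>+x. ennreal (poly p x) \<partial>\<mu>) = 1"
  proof -
    have "integrable \<mu> (poly p)"
      by (intro moment_measures_integrable[OF \<mu>] continuous_intros)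
    then have "(\<integral>\<^sup>+x. ennreal (poly p x) \<partial>\<mu>) = ennreal (\<integral>x. poly p x \<partial>\<mu>)"
      using pos_polyD[OF p] sp by (intro nn_integral_eq_integral AE_I2) (auto intro: less_imp_le)
    then show ?thesis by (simp add: one)
  qed
  \<comment> \<open>The zeros of \<open>D\<close> carry no arcsine mass but possibly \<mu> mass.
    Cutting them out is what turns the equality of integrals into an inequality.\<close>
  have g\<mu>: "(\<integral>\<^sup>+x. ennreal (g x) \<partial>arcsine) = (\<integral>\<^sup>+x. (if D x = 0 then 0 else ennreal (poly p x)) \<partial>\<mu>)"
  proof -
    have "(\<integral>\<^sup>+x. ennreal (g x) \<partial>arcsine) = (\<integral>\<^sup>+x. ennreal (g x) \<partial>density \<mu> (\<lambda>x. ennreal (D x)))"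
      by (simp add: arc)
    also have "\<dots> = (\<integral>\<^sup>+x. ennreal (D x) * ennreal (g x) \<partial>\<mu>)"
      by (rule nn_integral_density) (simp_all add: g_def)
    also have "\<dots> = (\<integral>\<^sup>+x. (if D x = 0 then 0 else ennreal (poly p x)) \<partial>\<mu>)"
    proof (rule nn_integral_cong)
      fix x assume "x \<in> space \<mu>"
      then have "poly p x > 0" using pos_polyD[OF p] sp by simp
      then show "ennreal (D x) * ennreal (g x) = (if D x = 0 then 0 else ennreal (poly p x))"
        using D(4)[of x] by (subst ennreal_mult[symmetric]) (auto simp: g_def)
    qed
    finally show ?thesis .
  qed
  also have "\<dots> \<le> (\<integral>\<^sup>+x. ennreal (poly p x) \<partial>\<mu>)" by (intro nn_integral_mono) auto
  finally have gle: "(\<integral>\<^sup>+x. ennreal (g x) \<partial>arcsine) \<le> 1" using p\<mu> by simp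
  have gpos: "AE x in arcsine. g x > 0"
    using D(3) AE_space
  proof eventually_elim
    case (elim x)
    then show ?case using pos_polyD[OF p, of x] by (simp add: g_def)
  qed
  have g0: "AE x in arcsine. 0 \<le> g x" using gpos by eventually_elim simp
  have gi: "integrable arcsine g"
    using gle g0 by (intro integrableI_nonneg gm) (auto simp: top_unique intro: le_less_trans)
  have gI: "(\<integral>x. g x \<partial>arcsine) \<le> 1"
  proof -
    have "ennreal (\<integral>x. g x \<partial>arcsine) \<le> ennreal 1"
      using gle nn_integral_eq_integral[OF gi g0] by simp
    then show ?thesis by (simp del: ennreal_1)
  qed
  have lng: "AE x in arcsine. ln (g x) = ln (poly p x) - ln (D x)"
    using D(3) AE_space
  proof eventually_elim
    case (elim x)
    then show ?case using pos_polyD[OF p, of x] by (simp add: g_def ln_div)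
  qed
  define G where "G x = g x - 1 - (ln (poly p x) - ln (D x))" for x
  have Gi: "integrable arcsine G" unfolding G_def using gi lnp lnD_i by simp
  have Gnn: "AE x in arcsine. 0 \<le> G x"
    using lng gpos
  proof eventually_elim
    case (elim x)
    then show ?case using ln_le_minus_one[of "g x"] by (simp add: G_def)
  qed
  have "(\<integral>x. G x \<partial>arcsine) \<le> 0"
    using gI ent gi lnp lnD_i arcsine.prob_space by (simp add: G_def)
  moreover have "(\<integral>x. G x \<partial>arcsine) \<ge> 0" using Gnn by (rule integral_nonneg_AE)
  ultimately have "AE x in arcsine. G x = 0"
    using integral_nonneg_eq_0_iff_AE[OF Gi Gnn] by simp
  then have Dp: "AE x in arcsine. D x = poly p x"
    using lng gpos
  proof eventually_elim
    case (elim x)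
    then have "g x = 1" using ln_eq_minus_one[of "g x"] by (simp add: G_def)
    then show ?case by (simp add: g_def divide_eq_1_iff)
  qed
  have g1: "(\<integral>\<^sup>+x. ennreal (g x) \<partial>arcsine) = 1"
  proof -
    have "(\<integral>\<^sup>+x. ennreal (g x) \<partial>arcsine) = (\<integral>\<^sup>+x. 1 \<partial>arcsine)"
      using Dp gpos by (intro nn_integral_cong_AE, eventually_elim) (auto simp: g_def)
    then show ?thesis using arcsine.emeasure_space_1 by simp
  qed
  \<comment> \<open>Since \<integral>g = 1, nothing was lost on the zeros of \<open>D\<close>. As
    \<open>p\<close> is positive, \<mu> has no part singular to the arcsine law.\<close>
  have "(\<integral>\<^sup>+x. (if D x = 0 then ennreal (poly p x) else 0) \<partial>\<mu>) = 0"
  proof -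
    have "1 = (\<integral>\<^sup>+x. (if D x = 0 then 0 else ennreal (poly p x)) + (if D x = 0 then ennreal (poly p x) else 0) \<partial>\<mu>)"
      unfolding p\<mu>[symmetric] by (intro nn_integral_cong) auto
    also have "\<dots> = 1 + (\<integral>\<^sup>+x. (if D x = 0 then ennreal (poly p x) else 0) \<partial>\<mu>)"
      using g\<mu> g1 by (subst nn_integral_add) auto
    finally have "1 + (\<integral>\<^sup>+x. (if D x = 0 then ennreal (poly p x) else 0) \<partial>\<mu>) = 1 + 0" by simp
    then show ?thesis by (subst (asm) ennreal_add_left_cancel) simp
  qed
  then have "AE x in \<mu>. (if D x = 0 then ennreal (poly p x) else 0) = 0"
    by (subst (asm) nn_integral_0_iff_AE) auto
  moreover have "AE x in \<mu>. 0 < ennreal (D x) \<longrightarrow> D x = poly p x"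
    using Dp unfolding arc[symmetric] by (subst (asm) AE_density) auto
  ultimately have "AE x in \<mu>. D x = poly p x"
    using AE_space
  proof eventually_elim
    case (elim x)
    have "poly p x > 0" using elim pos_polyD[OF p] sp by simp
    then have "D x \<noteq> 0" using elim(1) by (auto split: if_splits)
    then show ?case using elim(2) D(4)[of x] by simp
  qed
  then have "arcsine = density \<mu> (\<lambda>x. ennreal (poly p x))"
    unfolding arc[symmetric] by (intro density_cong) auto
  then have "inv_poly_measure p = density (density \<mu> (\<lambda>x. ennreal (poly p x))) (\<lambda>x. ennreal (1 / poly p x))"
    by (simp add: inv_poly_measure_def)
  also have "\<dots> = density \<mu> (\<lambda>x. ennreal (poly p x) * ennreal (1 / poly p x))"
    by (rule density_density_eq) measurable
  also have "\<dots> = density \<mu> (\<lambda>_. 1)"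
  proof (rule density_cong)
    have "ennreal (poly p x) * ennreal (1 / poly p x) = 1" if "x \<in> {0..1}" for x
      using pos_polyD[OF p that] by (subst ennreal_mult[symmetric]) auto
    then show "AE x in \<mu>. ennreal (poly p x) * ennreal (1 / poly p x) = 1"
      using sp by (intro AE_I2) simp
  qed measurable
  finally show ?thesis by (simp add: density_1)
qed

text \<open>Any competitor whose entropy is not larger must coincide with the measure; as the order
  is linear, this gives minimality and uniqueness at once.\<close>

lemma entropy_minimizer_eq:
  assumes p: "pos_poly p" and P: "inv_poly_measure p \<in> constrained_measures C {0..1}"
    and one: "\<And>\<mu>. \<mu> \<in> constrained_measures C {0..1} \<Longrightarrow> (\<integral>x. poly p x \<partial>\<mu>) = 1"
  shows "entropy_minimizer C = inv_poly_measure p"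
proof -
  have P': "inv_poly_measure p \<in> moment_measures {0..1}" using P by (simp add: constrained_measures_iff)
  have uniq: "\<mu> = inv_poly_measure p"
    if "\<mu> \<in> constrained_measures C {0..1}"
      "rel_entropy arcsine \<mu> \<le> rel_entropy arcsine (inv_poly_measure p)" for \<mu>
    using inv_poly_measure_unique[OF p P' _ one] that by (simp add: constrained_measures_iff)
  show ?thesis
    unfolding entropy_minimizer_def
  proof (rule the_equality)
    show "is_arg_min (rel_entropy arcsine) (\<lambda>\<mu>. \<mu> \<in> constrained_measures C {0..1}) (inv_poly_measure p)"
      unfolding is_arg_min_def using P uniq by (metis less_imp_le less_irrefl)
    show "\<mu> = inv_poly_measure p"
      if "is_arg_min (rel_entropy arcsine) (\<lambda>\<mu>. \<mu> \<in> constrained_measures C {0..1}) \<mu>" for \<mu>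
      using that P uniq unfolding is_arg_min_def by (metis not_less)
  qed
qed

section \<open>Quadratic decay away from the maximum\<close>

lemma nn_integral_lebesgue_affine:
  fixes J :: "nat set"
  assumes "finite J" "r > 0" "f \<in> borel_measurable (lebesgue_on_coords J)"
  shows "(\<integral>\<^sup>+x. f x \<partial>lebesgue_on_coords J) =
    ennreal (r ^ card J) * (\<integral>\<^sup>+y. f (\<lambda>j\<in>J. a j + r * y j) \<partial>lebesgue_on_coords J)"
  using assms(1,3)
proof (induction J arbitrary: f)
  case empty
  have "f (\<lambda>j\<in>{}. a j + r * x j) = f x" if "x \<in> space (lebesgue_on_coords {})" for x
    using that by (simp add: space_PiM restrict_def)
  then have "(\<integral>\<^sup>+x. f (\<lambda>j\<in>{}. a j + r * x j) \<partial>lebesgue_on_coords {}) = (\<integral>\<^sup>+x. f x \<partial>lebesgue_on_coords {})"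
    by (rule nn_integral_cong)
  then show ?case by (simp only: card.empty power_0 ennreal_1 mult_1_left)
next
  case (insert k J)
  interpret product_sigma_finite "\<lambda>_::nat. lborel :: real measure" by unfold_locales
  note f[measurable] = insert.prems
  have upd[measurable]: "(\<lambda>(x, y). x(k := y)) \<in> measurable (lebesgue_on_coords J \<Otimes>\<^sub>M lborel) (lebesgue_on_coords (insert k J))"
    using measurable_add_dim[of k J "\<lambda>_. lborel"] by simp
  define F where "F x = (\<integral>\<^sup>+y. f (x(k := a k + r * y)) \<partial>lborel)" for x
  have F_meas: "F \<in> borel_measurable (lebesgue_on_coords J)"
  proof -
    have "(\<lambda>(x, y). f (x(k := a k + r * y))) \<in> borel_measurable (lebesgue_on_coords J \<Otimes>\<^sub>M lborel)"
    proof -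
      have "(\<lambda>(x, y). (x, a k + r * y)) \<in> measurable (lebesgue_on_coords J \<Otimes>\<^sub>M lborel) (lebesgue_on_coords J \<Otimes>\<^sub>M (lborel :: real measure))"
        by measurable
      from measurable_compose[OF measurable_compose[OF this upd] f]
      show ?thesis by (simp add: case_prod_beta)
    qed
    then show ?thesis unfolding F_def by (rule lborel.borel_measurable_nn_integral)
  qed
  have "(\<integral>\<^sup>+x. f x \<partial>lebesgue_on_coords (insert k J)) =
      (\<integral>\<^sup>+x. (\<integral>\<^sup>+y. f (x(k := y)) \<partial>lborel) \<partial>lebesgue_on_coords J)"
    using insert by (intro product_nn_integral_insert) auto
  also have "\<dots> = (\<integral>\<^sup>+x. ennreal r * F x \<partial>lebesgue_on_coords J)"
  proof (rule nn_integral_cong)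
    fix x assume x: "x \<in> space (lebesgue_on_coords J)"
    have "(\<lambda>y. f (x(k := y))) \<in> borel_measurable lborel"
      using measurable_compose[OF measurable_Pair1'[OF x] measurable_compose[OF upd f]]
      by (simp only: prod.case)
    then show "(\<integral>\<^sup>+y. f (x(k := y)) \<partial>lborel) = ennreal r * F x"
      unfolding F_def using \<open>r > 0\<close> by (subst nn_integral_real_affine[of _ r "a k"]) auto
  qed
  also have "\<dots> = ennreal r * (\<integral>\<^sup>+x. F x \<partial>lebesgue_on_coords J)"
    by (rule nn_integral_cmult[OF F_meas])
  also have "(\<integral>\<^sup>+x. F x \<partial>lebesgue_on_coords J) =
      ennreal (r ^ card J) * (\<integral>\<^sup>+x. F (\<lambda>j\<in>J. a j + r * x j) \<partial>lebesgue_on_coords J)"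
    by (rule insert.IH[OF F_meas])
  also have "(\<integral>\<^sup>+x. F (\<lambda>j\<in>J. a j + r * x j) \<partial>lebesgue_on_coords J) =
      (\<integral>\<^sup>+x. (\<integral>\<^sup>+y. f (\<lambda>j\<in>insert k J. a j + r * (x(k := y)) j) \<partial>lborel) \<partial>lebesgue_on_coords J)"
  proof -
    have "(\<lambda>j\<in>J. a j + r * x j)(k := a k + r * y) = (\<lambda>j\<in>insert k J. a j + r * (x(k := y)) j)" for x y
      using insert(2) by (auto simp: fun_eq_iff restrict_def)
    then show ?thesis by (simp add: F_def)
  qed
  also have "\<dots> = (\<integral>\<^sup>+x. f (\<lambda>j\<in>insert k J. a j + r * x j) \<partial>lebesgue_on_coords (insert k J))"
  proof (rule product_nn_integral_insert[symmetric])
    have "(\<lambda>x. \<lambda>j\<in>insert k J. a j + r * x j) \<in>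
        measurable (lebesgue_on_coords (insert k J)) (lebesgue_on_coords (insert k J))"
      by measurable
    then show "(\<lambda>x. f (\<lambda>j\<in>insert k J. a j + r * x j)) \<in> borel_measurable (lebesgue_on_coords (insert k J))"
      by (rule measurable_compose[OF _ f])
  qed (use insert in auto)
  also have "ennreal r * (ennreal (r ^ card J) * (\<integral>\<^sup>+x. f (\<lambda>j\<in>insert k J. a j + r * x j) \<partial>lebesgue_on_coords (insert k J))) =
      ennreal (r ^ card (insert k J)) * (\<integral>\<^sup>+x. f (\<lambda>j\<in>insert k J. a j + r * x j) \<partial>lebesgue_on_coords (insert k J))"
  proof -
    have "ennreal (r ^ card (insert k J)) = ennreal r * ennreal (r ^ card J)"
      using insert(1,2) \<open>r > 0\<close> by (simp add: ennreal_mult)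
    then show ?thesis by (simp only: mult.assoc)
  qed
  finally show ?case .
qed

lemma gaussian_nn_integral_finite:
  fixes c :: real
  assumes "c > 0"
  shows "(\<integral>\<^sup>+y. ennreal (exp (- c * y\<^sup>2)) \<partial>lborel) < \<infinity>"
proof -
  define \<sigma> where "\<sigma> = 1 / sqrt (2 * c)"
  have \<sigma>: "\<sigma> > 0" "\<sigma>\<^sup>2 = 1 / (2 * c)" using assms by (simp_all add: \<sigma>_def power_divide)
  have "integrable lborel (\<lambda>y. sqrt (2 * pi * \<sigma>\<^sup>2) * normal_density 0 \<sigma> y)"
    using \<sigma> by (intro integrable_mult_right integrable_normal_density)
  also have "(\<lambda>y. sqrt (2 * pi * \<sigma>\<^sup>2) * normal_density 0 \<sigma> y) = (\<lambda>y. exp (- c * y\<^sup>2))"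
    using \<sigma> assms by (auto simp: normal_density_def fun_eq_iff)
  finally show ?thesis
    by (subst nn_integral_eq_integral) auto
qed

lemma tendsto_power_exp:
  fixes u :: "nat \<Rightarrow> real"
  assumes "(\<lambda>n. real n * u n) \<longlonglongrightarrow> a" "u \<longlonglongrightarrow> 0"
  shows "(\<lambda>n. (1 + u n) ^ n) \<longlonglongrightarrow> exp a"
proof -
  \<comment> \<open>The value 1 at 0 makes g continuous there, so indices with
    \<open>u n = 0\<close> need no separate treatment.\<close>
  define g where "g t = (if t = 0 then 1 else ln (1 + t) / t)" for t :: real
  have "((\<lambda>t. (ln (1 + t) - ln 1) / t) \<longlongrightarrow> 1) (at (0::real))"
    using DERIV_ln_divide[of 1] by (simp add: DERIV_def)
  moreover have "eventually (\<lambda>t. (ln (1 + t) - ln 1) / t = g t) (at 0)"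
    by (auto simp: g_def eventually_at_filter)
  ultimately have "(g \<longlongrightarrow> 1) (at 0)" by (rule Lim_transform_eventually)
  then have "isCont g 0" by (simp add: isCont_def g_def)
  then have "(\<lambda>n. g (u n)) \<longlonglongrightarrow> g 0" using assms(2) by (rule isCont_tendsto_compose)
  then have "(\<lambda>n. exp (real n * u n * g (u n))) \<longlonglongrightarrow> exp (a * g 0)"
    by (intro tendsto_intros assms)
  moreover have "eventually (\<lambda>n. u n > -1) sequentially"
    using assms(2) by (rule order_tendstoD) simp
  then have "eventually (\<lambda>n. exp (real n * u n * g (u n)) = (1 + u n) ^ n) sequentially"
  proof eventually_elim
    case (elim n)
    have "real n * u n * g (u n) = real n * ln (1 + u n)" by (simp add: g_def)
    then have "exp (real n * u n * g (u n)) = exp (real n * ln (1 + u n))" by (simp only:)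
    also have "\<dots> = (1 + u n) ^ n" using elim by (simp add: exp_of_nat_mult)
    finally show ?case .
  qed
  ultimately show ?thesis by (simp add: g_def Lim_transform_eventually)
qed

text \<open>The vanishing of the free coefficients pays off here: the integral of \<open>p\<close>
  is the same for all constrained measures.\<close>

lemma moment_functional_satisfies:
  assumes "\<And>j. 1 \<le> j \<Longrightarrow> j \<notin> dom C \<Longrightarrow> coeff p j = 0" "satisfies C m" "satisfies C m'"
  shows "moment_functional m p = moment_functional m' p"
  unfolding moment_functional_def
proof (rule sum.cong[OF refl])
  fix l
  show "coeff p l * (if l = 0 then 1 else m l) = coeff p l * (if l = 0 then 1 else m' l)"
    using assms(1)[of l] assms(2,3) by (cases "l = 0"; cases "C l") (auto simp: satisfies_def domIff)
qed

text \<open>A substitute for the Cauchy-Schwarz inequality: the family of bounds is optimised at t =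
  sqrt D / 2, and for D = 0 the parameter tends to 0 instead.\<close>

lemma square_le_of_am_gm:
  fixes a D :: real
  assumes "\<And>t. t > 0 \<Longrightarrow> a \<le> D / (2 * t) + 2 * t" "0 \<le> a" "0 \<le> D"
  shows "a\<^sup>2 \<le> 4 * D"
proof (cases "D = 0")
  case True
  have "a \<le> 0"
  proof (rule ccontr)
    assume "\<not> a \<le> 0"
    then show False using assms(1)[of "a / 4"] True by simp
  qed
  then show ?thesis using assms(2) True by simp
next
  case False
  then have D: "D > 0" using assms(3) by simp
  have "a \<le> D / (2 * (sqrt D / 2)) + 2 * (sqrt D / 2)" using D by (intro assms(1)) simp
  also have "\<dots> = 2 * sqrt D" using D by (simp add: real_div_sqrt)
  finally have "a\<^sup>2 \<le> (2 * sqrt D)\<^sup>2" using assms(2) by (rule power_mono)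
  then show ?thesis using D by (simp add: power_mult_distrib)
qed

text \<open>Maximality is encoded by the last assumption: that \<open>p\<close> involves only
  constrained powers gives the upper bound in \<open>quadratic_bound\<close>.\<close>

locale slice_maximum =
  fixes C :: "nat \<rightharpoonup> real" and n :: nat and p :: "real poly"
  assumes C: "moment_constraint C" and n: "last_index C \<le> n"
    and deg: "degree p \<le> n" and pos: "pos_poly p"
    and mem: "inv_poly_measure p \<in> constrained_measures C {0..1}"
    and Emax_pos: "mErr (\<lambda>j. moment j (inv_poly_measure p)) n > 0"
    and ln_Emax: "(\<integral>x. ln (poly p x) \<partial>arcsine) = - ln (mErr (\<lambda>j. moment j (inv_poly_measure p)) n)"
    and coeffs: "\<And>j. 1 \<le> j \<Longrightarrow> j \<notin> dom C \<Longrightarrow> coeff p j = 0"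
begin

definition m\<^sub>0 :: "nat \<Rightarrow> real" where "m\<^sub>0 j = moment j (inv_poly_measure p)"
definition Emax :: real where "Emax = mErr m\<^sub>0 n"
abbreviation J :: "nat set" where "J \<equiv> free_coordinates C n"

lemma Emax_gt_0: "Emax > 0"
  using Emax_pos by (simp add: Emax_def m\<^sub>0_def[abs_def])

lemma moment_measure: "inv_poly_measure p \<in> moment_measures {0..1}"
  and satisfies_m\<^sub>0: "satisfies C m\<^sub>0"
  using mem by (simp_all add: constrained_measures_iff m\<^sub>0_def[abs_def])

lemma mErr_m\<^sub>0_pos: "j \<le> n \<Longrightarrow> mErr m\<^sub>0 j > 0"
  using mErr_pos_all[of n m\<^sub>0 j] Emax_gt_0 moment_measure
  by (auto simp: is_moments_def m\<^sub>0_def Emax_def)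

lemma functional_one:
  assumes "satisfies C m"
  shows "moment_functional m p = 1"
proof -
  have "moment_functional m p = moment_functional m\<^sub>0 p"
    by (rule moment_functional_satisfies[OF coeffs assms satisfies_m\<^sub>0])
  also have "\<dots> = 1"
    using integral_poly[OF moment_measure deg, of m\<^sub>0] integral_poly_inv_poly_measure[OF pos]
    by (simp add: m\<^sub>0_def)
  finally show ?thesis .
qed

lemma integral_one:
  assumes "\<mu> \<in> constrained_measures C {0..1}"
  shows "(\<integral>x. poly p x \<partial>\<mu>) = 1"
  using assms integral_poly[of \<mu> p n "\<lambda>j. moment j \<mu>"] functional_one deg
  by (simp add: constrained_measures_iff)

text \<open>With \<open>u = p / q\<close>, the entropy gap \<open>\<integral>(u - 1 - ln u)\<close> dominates the squared Hellinger
  distance of the two densities, and that in turn dominates all squared moment differences.\<close>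

lemma quadratic_bound:
  "\<exists>c>0. \<forall>m. satisfies C m \<longrightarrow> (\<forall>j\<le>n. mErr m j > 0) \<longrightarrow>
     ln (mErr m n) \<le> ln Emax - c * (\<Sum>j\<in>J. (m j - m\<^sub>0 j)\<^sup>2)"
proof -
  have cp: "continuous_on {0..1} (\<lambda>x. 1 / poly p x)" by (rule continuous_on_inv_poly[OF pos])
  have "bounded ((\<lambda>x. 1 / poly p x) ` {0..1})"
    by (intro compact_imp_bounded compact_continuous_image cp compact_Icc)
  then obtain B where B: "B > 0" "\<And>x. x \<in> {0..1} \<Longrightarrow> \<bar>1 / poly p x\<bar> \<le> B"
    unfolding bounded_pos by auto
  \<comment> \<open>B comes from the bound on 1/p, the 4 from \<open>square_le_of_am_gm\<close>, and
    the cardinality from summing over the free coordinates; adding 1 keeps the denominator positive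
    when there are none.\<close>
  define c where "c = 1 / (4 * B\<^sup>2 * (real (card J) + 1))"
  have c: "c > 0" using B by (simp add: c_def)
  have "ln (mErr m n) \<le> ln Emax - c * (\<Sum>j\<in>J. (m j - m\<^sub>0 j)\<^sup>2)"
    if sat: "satisfies C m" and mpos: "\<And>j. j \<le> n \<Longrightarrow> mErr m j > 0" for m
  proof -
    obtain q where q: "pos_poly q" "inv_poly_measure q \<in> moment_measures {0..1}"
      "\<And>j. j \<in> {1..n} \<Longrightarrow> m j = moment j (inv_poly_measure q)"
      "(\<integral>x. ln (poly q x) \<partial>arcsine) = - ln (mErr m n)"
      using regular_poly[OF mpos] by metis
    define u where "u x = poly p x / poly q x" for x
    have upos: "u x > 0" if "x \<in> {0..1}" for x
      using pos_polyD[OF pos that] pos_polyD[OF q(1) that] by (simp add: u_def)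
    have cu: "continuous_on {0..1} u" unfolding u_def
      using pos_polyD[OF q(1)] by (intro continuous_intros) force
    have cln: "continuous_on {0..1} (\<lambda>x. ln (poly r x))" if "pos_poly r" for r
      using pos_polyD[OF that] by (intro continuous_intros) force
    have clu: "continuous_on {0..1} (\<lambda>x. ln (u x))"
      using cu upos by (intro continuous_intros) force+
    have iu: "(\<integral>x. u x \<partial>arcsine) = 1"
    proof -
      have "(\<integral>x. u x \<partial>arcsine) = (\<integral>x. poly p x \<partial>inv_poly_measure q)"
        unfolding u_def by (intro integral_inv_poly_measure[OF q(1), symmetric] continuous_intros)
      also have "\<dots> = moment_functional m p" using integral_poly[OF q(2) deg, of m] q(3) by simp
      finally show ?thesis using functional_one[OF sat] by simp
    qed
    define D where "D = (\<integral>x. u x - 1 - ln (u x) \<partial>arcsine)"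
    have "(\<integral>x. ln (u x) \<partial>arcsine) = (\<integral>x. ln (poly p x) - ln (poly q x) \<partial>arcsine)"
    proof (rule Bochner_Integration.integral_cong[OF refl])
      fix x assume "x \<in> space arcsine"
      then show "ln (u x) = ln (poly p x) - ln (poly q x)"
        using pos_polyD[OF pos, of x] pos_polyD[OF q(1), of x] by (simp add: u_def ln_div)
    qed
    also have "\<dots> = ln (mErr m n) - ln Emax"
      using arcsine_integrable[OF cln[OF pos]] arcsine_integrable[OF cln[OF q(1)]] q(4) ln_Emax
      by (simp add: Emax_def m\<^sub>0_def[abs_def])
    finally have D_eq: "D = ln Emax - ln (mErr m n)"
      using arcsine_integrable[OF cu] arcsine_integrable[OF clu] iu arcsine.prob_space by (simp add: D_def)
    have sqrt_bound: "(sqrt (u x) - 1)\<^sup>2 \<le> u x - 1 - ln (u x)" if "x \<in> {0..1}" for x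
    proof -
      have "ln (sqrt (u x)) \<le> sqrt (u x) - 1" using upos[OF that] by (intro ln_le_minus_one) simp
      then have "ln (u x) \<le> 2 * (sqrt (u x) - 1)" using upos[OF that] by (simp add: ln_sqrt)
      moreover have "(sqrt (u x) - 1)\<^sup>2 = u x - 2 * sqrt (u x) + 1"
        using upos[OF that] by (simp add: power2_diff)
      ultimately show ?thesis by simp
    qed
    have D0: "D \<ge> 0" unfolding D_def
    proof (rule integral_nonneg_AE, rule AE_I2)
      fix x assume "x \<in> space arcsine"
      then have "x \<in> {0..1}" by simp
      from order_trans[OF zero_le_power2 sqrt_bound[OF this]] show "0 \<le> u x - 1 - ln (u x)" .
    qed
    have cabs: "continuous_on {0..1} (\<lambda>x. \<bar>u x - 1\<bar>)" by (intro continuous_intros cu)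
    define A where "A = (\<integral>x. \<bar>u x - 1\<bar> \<partial>arcsine)"
    have A0: "A \<ge> 0" unfolding A_def by simp
    \<comment> \<open>With |u - 1| = |sqrt u - 1| (sqrt u + 1), a weighted arithmetic-geometric mean
      inequality holds pointwise. Its first term is bounded by the entropy gap, its second by t (u +
      1), whose integral is 2t.\<close>
    have "A \<le> D / (2 * t) + 2 * t" if t: "t > 0" for t
    proof -
      have "A \<le> (\<integral>x. (u x - 1 - ln (u x)) / (2 * t) + t * (u x + 1) \<partial>arcsine)"
        unfolding A_def
      proof (rule integral_mono)
        show "integrable arcsine (\<lambda>x. (u x - 1 - ln (u x)) / (2 * t) + t * (u x + 1))"
          using t by (intro arcsine_integrable continuous_intros cu clu) auto
        fix x assume "x \<in> space arcsine"
        then have x: "x \<in> {0..1}" by simp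
        define v w where "v = \<bar>sqrt (u x) - 1\<bar>" and "w = sqrt (u x) + 1"
        have "\<bar>u x - 1\<bar> = v * w"
        proof -
          have "u x - 1 = (sqrt (u x) - 1) * (sqrt (u x) + 1)"
            using upos[OF x] by (simp add: algebra_simps)
          then show ?thesis using upos[OF x] by (simp add: abs_mult v_def w_def)
        qed
        also have "v * w \<le> v\<^sup>2 / (2 * t) + t * (w\<^sup>2 / 2)"
        proof -
          have "0 \<le> (v - t * w)\<^sup>2" by simp
          then have "2 * t * (v * w) \<le> v\<^sup>2 + t\<^sup>2 * w\<^sup>2" by (simp add: power2_diff power_mult_distrib mult_ac)
          then show ?thesis using t by (simp add: field_simps power2_eq_square)
        qed
        also have "\<dots> \<le> (u x - 1 - ln (u x)) / (2 * t) + t * (u x + 1)"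
        proof (intro add_mono divide_right_mono mult_left_mono)
          show "v\<^sup>2 \<le> u x - 1 - ln (u x)" using sqrt_bound[OF x] by (simp add: v_def)
          have "0 \<le> (sqrt (u x) - 1)\<^sup>2" by simp
          then have "2 * sqrt (u x) \<le> u x + 1" using upos[OF x] by (simp add: power2_diff)
          then show "w\<^sup>2 / 2 \<le> u x + 1" using upos[OF x] by (simp add: w_def power2_sum)
        qed (use t in auto)
        finally show "\<bar>u x - 1\<bar> \<le> (u x - 1 - ln (u x)) / (2 * t) + t * (u x + 1)" .
      qed (rule arcsine_integrable[OF cabs])
      also have "\<dots> = D / (2 * t) + t * 2"
        using arcsine_integrable[OF cu] arcsine_integrable[OF clu] iu arcsine.prob_space
        by (simp add: D_def)
      finally show ?thesis by (simp add: mult.commute)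
    qed
    then have AD: "A\<^sup>2 \<le> 4 * D" by (rule square_le_of_am_gm[OF _ A0 D0])
    have diff: "(m j - m\<^sub>0 j)\<^sup>2 \<le> B\<^sup>2 * (4 * D)" if "j \<in> J" for j
    proof -
      have j: "j \<in> {1..n}" using that by (simp add: free_coordinates_def)
      have ci: "continuous_on {0..1} (\<lambda>x. x ^ j / poly r x)" if "pos_poly r" for r
        using pos_polyD[OF that] by (intro continuous_intros) force
      have "m j - m\<^sub>0 j = (\<integral>x. x ^ j / poly q x \<partial>arcsine) - (\<integral>x. x ^ j / poly p x \<partial>arcsine)"
        unfolding q(3)[OF j] m\<^sub>0_def moment_def
        by (intro arg_cong2[where f = "(-)"] integral_inv_poly_measure q(1) pos continuous_intros)
      also have "\<dots> = (\<integral>x. x ^ j / poly q x - x ^ j / poly p x \<partial>arcsine)"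
        using arcsine_integrable[OF ci[OF q(1)]] arcsine_integrable[OF ci[OF pos]] by simp
      finally have md: "m j - m\<^sub>0 j = (\<integral>x. x ^ j / poly q x - x ^ j / poly p x \<partial>arcsine)" .
      have "\<bar>m j - m\<^sub>0 j\<bar> \<le> (\<integral>x. B * \<bar>u x - 1\<bar> \<partial>arcsine)"
        unfolding md
      proof (rule order_trans[OF integral_abs_bound], rule integral_mono)
        show "integrable arcsine (\<lambda>x. \<bar>x ^ j / poly q x - x ^ j / poly p x\<bar>)"
          by (intro arcsine_integrable continuous_intros ci q(1) pos)
        show "integrable arcsine (\<lambda>x. B * \<bar>u x - 1\<bar>)"
          by (intro arcsine_integrable continuous_intros cu)
        fix x assume "x \<in> space arcsine"
        then have x: "x \<in> {0..1}" by simp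
        \<comment> \<open>Since 1/q = u/p, the densities differ by (u - 1) / p.\<close>
        have "x ^ j / poly q x - x ^ j / poly p x = x ^ j * (1 / poly p x * (u x - 1))"
          using pos_polyD[OF pos x] pos_polyD[OF q(1) x] by (simp add: u_def field_simps)
        then have "\<bar>x ^ j / poly q x - x ^ j / poly p x\<bar> = \<bar>x ^ j\<bar> * (\<bar>1 / poly p x\<bar> * \<bar>u x - 1\<bar>)"
          by (simp only: abs_mult)
        also have "\<dots> \<le> 1 * (B * \<bar>u x - 1\<bar>)"
          using x B by (intro mult_mono) (auto simp: power_le_one)
        finally show "\<bar>x ^ j / poly q x - x ^ j / poly p x\<bar> \<le> B * \<bar>u x - 1\<bar>" by simp
      qed
      also have "\<dots> = B * A" by (simp add: A_def)
      finally have "\<bar>m j - m\<^sub>0 j\<bar>\<^sup>2 \<le> (B * A)\<^sup>2" by (rule power_mono) simp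
      also have "\<dots> \<le> B\<^sup>2 * (4 * D)" using AD by (simp add: power_mult_distrib mult_left_mono)
      finally show ?thesis by simp
    qed
    have "c * (\<Sum>j\<in>J. (m j - m\<^sub>0 j)\<^sup>2) \<le> c * (real (card J) * (B\<^sup>2 * (4 * D)))"
      using c diff sum_bounded_above[of J "\<lambda>j. (m j - m\<^sub>0 j)\<^sup>2" "B\<^sup>2 * (4 * D)"]
      by (intro mult_left_mono) auto
    also have "\<dots> \<le> c * ((real (card J) + 1) * (B\<^sup>2 * (4 * D)))"
      using c D0 by (intro mult_left_mono mult_right_mono) auto
    also have "\<dots> = D"
    proof -
      have cancel: "1 / (4 * b * k) * (k * (b * (4 * D))) = D" if "b \<noteq> 0" "k \<noteq> 0" for b k
        using that by simp
      show ?thesis unfolding c_def by (rule cancel) (use B in auto)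
    qed
    finally show ?thesis using D_eq by simp
  qed
  then show ?thesis using c by blast
qed

end

section \<open>Laplace asymptotics of the slice integrals\<close>

context slice_maximum
begin

text \<open>Blow-up of the maximum at scale N^(-1/2), where the N-th power of a function with a
  quadratic peak has a nontrivial limit.\<close>

definition rescaled_point :: "nat \<Rightarrow> (nat \<Rightarrow> real) \<Rightarrow> nat \<Rightarrow> real" where
  "rescaled_point N y = (\<lambda>j\<in>J. m\<^sub>0 j + 1 / sqrt (real N) * y j)"

definition rescaled_weight :: "nat \<Rightarrow> (nat \<Rightarrow> real) \<Rightarrow> real" where
  "rescaled_weight N y =
    indicator (slice C n) (rescaled_point N y) * (mErr (fill C (rescaled_point N y)) n / Emax) ^ N"

text \<open>Zero in the constrained coordinates, so lines through the maximum in this direction keep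
  the constraint and have the form that \<open>mErr_expands2\<close> asks for.\<close>

definition ext0 :: "(nat \<Rightarrow> real) \<Rightarrow> nat \<Rightarrow> real" where
  "ext0 y j = (if j \<in> J then y j else 0)"

lemma satisfies_fill: "satisfies C (fill C x)"
  by (auto simp: satisfies_def fill_def)

lemma fill_rescaled_point:
  assumes "j \<in> {1..n}"
  shows "fill C (rescaled_point N y) j = m\<^sub>0 j + 1 / sqrt (real N) * ext0 y j"
  using assms satisfies_m\<^sub>0
  by (cases "C j") (auto simp: fill_def rescaled_point_def ext0_def free_coordinates_def satisfies_def)

lemma rescaled_slice_iff:
  "rescaled_point N y \<in> slice C n \<longleftrightarrow> is_moments n (\<lambda>j. m\<^sub>0 j + 1 / sqrt (real N) * ext0 y j)"
proof -
  have "rescaled_point N y \<in> extensional J" by (simp add: rescaled_point_def)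
  moreover have "is_moments n (fill C (rescaled_point N y)) \<longleftrightarrow>
      is_moments n (\<lambda>j. m\<^sub>0 j + 1 / sqrt (real N) * ext0 y j)"
    by (rule is_moments_cong) (rule fill_rescaled_point, simp)
  ultimately show ?thesis by (simp add: slice_iff[OF C n])
qed

lemma mErr_rescaled:
  "mErr (fill C (rescaled_point N y)) n = mErr (\<lambda>j. m\<^sub>0 j + 1 / sqrt (real N) * ext0 y j) n"
  by (rule mErr_cong) (rule fill_rescaled_point, simp)

text \<open>The quadratic bound holds wherever the errors are positive, so no separate estimate away
  from the maximum is needed, and the scale N^(-1/2) cancels the exponent N. Boundary points of the
  slice have weight 0.\<close>

lemma rescaled_weight_bound:
  "\<exists>c>0. \<forall>N>0. \<forall>y. rescaled_weight N y \<le> exp (- c * (\<Sum>j\<in>J. (y j)\<^sup>2))"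
proof -
  obtain c where c: "c > 0" "\<And>m. satisfies C m \<Longrightarrow> (\<forall>j\<le>n. mErr m j > 0) \<Longrightarrow>
       ln (mErr m n) \<le> ln Emax - c * (\<Sum>j\<in>J. (m j - m\<^sub>0 j)\<^sup>2)"
    using quadratic_bound by blast
  have "rescaled_weight N y \<le> exp (- c * (\<Sum>j\<in>J. (y j)\<^sup>2))" if N: "N > 0" for N y
  proof -
    define m where "m = fill C (rescaled_point N y)"
    consider "rescaled_point N y \<notin> slice C n" | "mErr m n = 0" | "rescaled_point N y \<in> slice C n" "mErr m n \<noteq> 0"
      by blast
    then show ?thesis
    proof cases
      case 3
      then have im: "is_moments n m" by (simp add: slice_iff[OF C n] m_def)
      then have E: "mErr m n > 0" using 3 mErr_nonneg[of n m n] by simp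
      have "ln (mErr m n) \<le> ln Emax - c * (\<Sum>j\<in>J. (m j - m\<^sub>0 j)\<^sup>2)"
        using mErr_pos_all[OF im E] satisfies_fill by (intro c) (auto simp: m_def)
      also have "(\<Sum>j\<in>J. (m j - m\<^sub>0 j)\<^sup>2) = (\<Sum>j\<in>J. (y j)\<^sup>2 / real N)"
      proof (rule sum.cong[OF refl])
        fix j assume "j \<in> J"
        then have "m j - m\<^sub>0 j = 1 / sqrt (real N) * y j"
          using fill_rescaled_point[of j N y] by (simp add: m_def ext0_def free_coordinates_def)
        then show "(m j - m\<^sub>0 j)\<^sup>2 = (y j)\<^sup>2 / real N" by (simp add: power_divide)
      qed
      finally have le: "ln (mErr m n / Emax) \<le> - c * (\<Sum>j\<in>J. (y j)\<^sup>2) / real N"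
        using E Emax_gt_0 by (simp add: ln_div sum_divide_distrib[symmetric])
      have "(mErr m n / Emax) ^ N = exp (real N * ln (mErr m n / Emax))"
        using E Emax_gt_0 by (simp add: exp_of_nat_mult)
      also have "\<dots> \<le> exp (real N * (- c * (\<Sum>j\<in>J. (y j)\<^sup>2) / real N))"
        using le by (subst exp_le_cancel_iff) (intro mult_left_mono, auto)
      also have "\<dots> = exp (- c * (\<Sum>j\<in>J. (y j)\<^sup>2))" using N by simp
      finally show ?thesis using 3 by (simp add: rescaled_weight_def m_def)
    qed (use N in \<open>auto simp: rescaled_weight_def m_def zero_power\<close>)
  qed
  then show ?thesis using c(1) by blast
qed

text \<open>Only the second-order expansion of \<open>mErr\<close> along the line through \<open>y\<close> matters; its linear
  term vanishes because \<open>m\<^sub>0\<close> is a maximum.\<close>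

lemma rescaled_weight_tendsto: "\<exists>a>0. (\<lambda>N. rescaled_weight N y) \<longlonglongrightarrow> a"
proof -
  obtain c where c: "c > 0" "\<And>m. satisfies C m \<Longrightarrow> (\<forall>j\<le>n. mErr m j > 0) \<Longrightarrow>
       ln (mErr m n) \<le> ln Emax - c * (\<Sum>j\<in>J. (m j - m\<^sub>0 j)\<^sup>2)"
    using quadratic_bound by blast
  define l where "l s = (\<lambda>j. m\<^sub>0 j + s * ext0 y j)" for s
  define \<phi> where "\<phi> s = mErr (l s) n" for s
  have \<phi>0: "\<phi> 0 = Emax" by (simp add: \<phi>_def l_def Emax_def)
  have sat: "satisfies C (l s)" for s
    using satisfies_m\<^sub>0 by (auto simp: satisfies_def l_def ext0_def free_coordinates_def)
  have "mErr m\<^sub>0 j \<noteq> 0" if "j < n" for j using mErr_m\<^sub>0_pos[of j] that by simp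
  then have "expands2 \<phi>" unfolding \<phi>_def l_def by (intro mErr_expands2)
  then obtain b h k where h: "\<And>s. s \<noteq> 0 \<Longrightarrow> \<phi> s = \<phi> 0 + b * s + h s * s\<^sup>2" "(h \<longlongrightarrow> k) (at 0)"
    by (rule expands2E, blast)
  have ev: "eventually (\<lambda>s. \<forall>j\<le>n. mErr (l s) j > 0) (at 0)"
    unfolding l_def by (rule mErr_line_pos) (rule mErr_m\<^sub>0_pos)
  then obtain d where d: "d > 0" "\<And>s j. s \<noteq> 0 \<Longrightarrow> \<bar>s\<bar> < d \<Longrightarrow> j \<le> n \<Longrightarrow> mErr (l s) j > 0"
    unfolding eventually_at by (auto simp: dist_real_def)
  have D: "(\<phi> has_real_derivative b) (at 0)" by (rule expands2_DERIV[OF h])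
  \<comment> \<open>The quadratic bound contains that \<phi> has a local maximum at 0.\<close>
  have "b = 0"
  proof (rule DERIV_local_max[OF D d(1)], intro allI impI)
    fix s :: real assume s: "\<bar>0 - s\<bar> < d"
    show "\<phi> s \<le> \<phi> 0"
    proof (cases "s = 0")
      case False
      then have pos: "mErr (l s) j > 0" if "j \<le> n" for j using d(2)[of s j] s that by simp
      have "0 \<le> c * (\<Sum>j\<in>J. (l s j - m\<^sub>0 j)\<^sup>2)" using c(1) by (intro mult_nonneg_nonneg sum_nonneg) auto
      moreover have "ln (mErr (l s) n) \<le> ln Emax - c * (\<Sum>j\<in>J. (l s j - m\<^sub>0 j)\<^sup>2)"
        using pos by (intro c(2) sat) blast
      ultimately have "ln (\<phi> s) \<le> ln Emax" by (simp add: \<phi>_def)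
      then have "\<phi> s \<le> Emax" using pos[of n] Emax_gt_0 by (simp add: \<phi>_def)
      then show ?thesis by (simp only: \<phi>0)
    qed simp
  qed
  define \<sigma> where "\<sigma> N = 1 / sqrt (real N)" for N
  have \<sigma>0: "filterlim \<sigma> (at 0) sequentially"
    unfolding filterlim_at
  proof
    show "\<sigma> \<longlonglongrightarrow> 0" unfolding \<sigma>_def by real_asymp
    show "eventually (\<lambda>N. \<sigma> N \<in> UNIV \<and> \<sigma> N \<noteq> 0) sequentially"
      using eventually_gt_at_top[of 0] by eventually_elim (simp add: \<sigma>_def)
  qed
  \<comment> \<open>As the linear term vanishes, 1 + u N is the normalised error at the rescaled
    point, and N times u N converges.\<close>
  define u where "u N = h (\<sigma> N) / Emax * (\<sigma> N)\<^sup>2" for N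
  have hlim: "(\<lambda>N. h (\<sigma> N)) \<longlonglongrightarrow> k" using h(2) \<sigma>0 by (rule filterlim_compose)
  have "(\<lambda>N. (1 + u N) ^ N) \<longlonglongrightarrow> exp (k / Emax)"
  proof (rule tendsto_power_exp)
    have "(\<lambda>N. h (\<sigma> N) / Emax) \<longlonglongrightarrow> k / Emax" by (intro tendsto_divide hlim tendsto_const) (use Emax_gt_0 in simp)
    moreover have "eventually (\<lambda>N. h (\<sigma> N) / Emax = real N * u N) sequentially"
      using eventually_gt_at_top[of 0] by eventually_elim (simp add: u_def \<sigma>_def power_divide)
    ultimately show "(\<lambda>N. real N * u N) \<longlonglongrightarrow> k / Emax" by (rule Lim_transform_eventually)
    have "\<sigma> \<longlonglongrightarrow> 0" using \<sigma>0 by (simp add: filterlim_at)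
    then have "(\<lambda>N. h (\<sigma> N) / Emax * (\<sigma> N)\<^sup>2) \<longlonglongrightarrow> k / Emax * 0\<^sup>2"
      using Emax_gt_0 by (intro tendsto_intros hlim) auto
    then show "u \<longlonglongrightarrow> 0" by (simp add: u_def[abs_def])
  qed
  moreover have "eventually (\<lambda>N. (1 + u N) ^ N = rescaled_weight N y) sequentially"
  proof -
    have "eventually (\<lambda>N. \<forall>j\<le>n. mErr (l (\<sigma> N)) j > 0) sequentially"
      using ev \<sigma>0 by (rule eventually_compose_filterlim)
    moreover have "eventually (\<lambda>N. N > 0) sequentially" by (rule eventually_gt_at_top)
    ultimately show ?thesis
    proof eventually_elim
      case (elim N)
      have "is_moments n (l (\<sigma> N))" using elim by (intro is_momentsI) auto
      then have "rescaled_point N y \<in> slice C n" by (simp add: rescaled_slice_iff l_def \<sigma>_def)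
      moreover have "mErr (fill C (rescaled_point N y)) n / Emax = 1 + u N"
      proof -
        have "\<sigma> N \<noteq> 0" using elim by (simp add: \<sigma>_def)
        from h(1)[OF this] have "\<phi> (\<sigma> N) / Emax = 1 + u N"
          using Emax_gt_0 \<open>b = 0\<close> by (simp add: \<phi>0 u_def add_divide_distrib)
        then show ?thesis by (simp add: mErr_rescaled \<phi>_def l_def \<sigma>_def)
      qed
      ultimately show ?case by (simp add: rescaled_weight_def)
    qed
  qed
  ultimately have "(\<lambda>N. rescaled_weight N y) \<longlonglongrightarrow> exp (k / Emax)" by (rule Lim_transform_eventually)
  then show ?thesis by (intro exI[of _ "exp (k / Emax)"]) simp
qed

section \<open>The limit of the rescaled slice integrals\<close>

lemma slice_integrand_measurable:
  "(\<lambda>x. indicator (slice C n) x * ennreal ((mErr (fill C x) n / b) ^ N)) \<in> borel_measurable (lebesgue_on_coords J)"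
  "(\<lambda>x. indicator (slice C n) x * (mErr (fill C x) n / b) ^ N :: real) \<in> borel_measurable (lebesgue_on_coords J)"
proof -
  have [measurable]: "slice C n \<in> sets (lebesgue_on_coords J)" by (rule slice_measurable[OF C n])
  have [measurable]: "(\<lambda>x. mErr (fill C x) n) \<in> borel_measurable (lebesgue_on_coords J)"
    by (intro mErr_measurable fill_measurable)
  show "(\<lambda>x. indicator (slice C n) x * ennreal ((mErr (fill C x) n / b) ^ N)) \<in> borel_measurable (lebesgue_on_coords J)"
    by measurable
  show "(\<lambda>x. indicator (slice C n) x * (mErr (fill C x) n / b) ^ N :: real) \<in> borel_measurable (lebesgue_on_coords J)"
    by measurable
qed

lemma slice_integral_rescaled:
  assumes "N > 0"
  shows "slice_integral C n N = ennreal ((Emax / 4 ^ n) ^ N * (1 / sqrt (real N)) ^ card J) *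
    (\<integral>\<^sup>+y. ennreal (rescaled_weight N y) \<partial>lebesgue_on_coords J)"
proof -
  let ?R = "(Emax / 4 ^ n) ^ N"
  let ?f = "\<lambda>x. ennreal (indicator (slice C n) x * (mErr (fill C x) n / Emax) ^ N)"
  have R: "?R \<ge> 0" using Emax_gt_0 by simp
  have m: "?f \<in> borel_measurable (lebesgue_on_coords J)"
    using slice_integrand_measurable(2) by simp
  have "slice_integral C n N = (\<integral>\<^sup>+x. ennreal ?R * ?f x \<partial>lebesgue_on_coords J)"
    unfolding slice_integral_def
  proof (rule nn_integral_cong)
    fix x
    show "indicator (slice C n) x * ennreal ((mErr (fill C x) n / 4 ^ n) ^ N) = ennreal ?R * ?f x"
    proof (cases "x \<in> slice C n")
      case True
      then have "mErr (fill C x) n \<ge> 0" using mErr_nonneg[of n _ n] by (simp add: slice_iff[OF C n])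
      then show ?thesis using True Emax_gt_0 R
        by (simp add: ennreal_mult[symmetric] power_mult_distrib[symmetric] del: power_mult_distrib)
    qed simp
  qed
  also have "\<dots> = ennreal ?R * (\<integral>\<^sup>+x. ?f x \<partial>lebesgue_on_coords J)" by (rule nn_integral_cmult[OF m])
  also have "(\<integral>\<^sup>+x. ?f x \<partial>lebesgue_on_coords J) =
      ennreal ((1 / sqrt (real N)) ^ card J) * (\<integral>\<^sup>+y. ennreal (rescaled_weight N y) \<partial>lebesgue_on_coords J)"
    unfolding rescaled_weight_def rescaled_point_def
    using assms by (intro nn_integral_lebesgue_affine m) auto
  finally show ?thesis using R by (simp add: ennreal_mult mult.assoc)
qed

text \<open>Dominated convergence with a product of Gaussians. The limit function enters only as a
  \<open>lim\<close>, which gives its measurability without a formula; it is positive everywhere,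
  and so is its integral.\<close>

lemma slice_integral_asymptotics:
  "\<exists>\<kappa>>0. (\<lambda>N. enn2real (slice_integral C n N) * sqrt (real N) ^ card J / (Emax / 4 ^ n) ^ N) \<longlonglongrightarrow> \<kappa>"
proof -
  interpret product_sigma_finite "\<lambda>_::nat. lborel :: real measure" by unfold_locales
  let ?M = "lebesgue_on_coords J"
  obtain c where c: "c > 0" "\<And>N y. N > 0 \<Longrightarrow> rescaled_weight N y \<le> exp (- c * (\<Sum>j\<in>J. (y j)\<^sup>2))"
    using rescaled_weight_bound by blast
  define w where "w y = ennreal (exp (- c * (\<Sum>j\<in>J. (y j)\<^sup>2)))" for y :: "nat \<Rightarrow> real"
  define L where "L y = lim (\<lambda>N. rescaled_weight N y)" for y
  have L: "(\<lambda>N. rescaled_weight N y) \<longlonglongrightarrow> L y" "L y > 0" for y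
    using rescaled_weight_tendsto[of y] limI unfolding L_def by auto
  have meas[measurable]: "rescaled_weight N \<in> borel_measurable ?M" for N
  proof -
    have "rescaled_point N \<in> measurable ?M ?M"
      unfolding rescaled_point_def by measurable
    from measurable_compose[OF this slice_integrand_measurable(2)]
    show ?thesis by (simp add: rescaled_weight_def[abs_def])
  qed
  have Lm[measurable]: "L \<in> borel_measurable ?M"
    unfolding L_def[abs_def] by (rule borel_measurable_lim_metric) (rule meas)
  have wm[measurable]: "w \<in> borel_measurable ?M"
  proof -
    have "(\<lambda>y. y j) \<in> borel_measurable ?M" if "j \<in> J" for j
      using measurable_component_singleton[OF that, of "\<lambda>_. lborel"] by simp
    then have "(\<lambda>y. \<Sum>j\<in>J. (y j)\<^sup>2) \<in> borel_measurable ?M"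
      by (intro borel_measurable_sum borel_measurable_power)
    then show ?thesis unfolding w_def by simp
  qed
  have wfin: "(\<integral>\<^sup>+y. w y \<partial>?M) < \<infinity>"
  proof -
    have "w y = (\<Prod>j\<in>J. ennreal (exp (- c * (y j)\<^sup>2)))" for y
      by (simp add: w_def sum_distrib_left exp_sum prod_ennreal sum_negf[symmetric] del: sum_negf)
    then have "(\<integral>\<^sup>+y. w y \<partial>?M) = (\<Prod>j\<in>J. (\<integral>\<^sup>+t. ennreal (exp (- c * t\<^sup>2)) \<partial>lborel))"
      by (simp only:) (rule product_nn_integral_prod, auto)
    then show ?thesis using gaussian_nn_integral_finite[OF c(1)]
      by (simp add: power_less_top_ennreal)
  qed
  define I where "I N = (\<integral>\<^sup>+y. ennreal (rescaled_weight N y) \<partial>?M)" for N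
  \<comment> \<open>Shifted by one because the Gaussian bound requires N > 0.\<close>
  have lim: "(\<lambda>N. I (Suc N)) \<longlonglongrightarrow> (\<integral>\<^sup>+y. ennreal (L y) \<partial>?M)"
    unfolding I_def
  proof (rule nn_integral_dominated_convergence[where w = w])
    show "AE y in ?M. ennreal (rescaled_weight (Suc N) y) \<le> w y" for N
      using c(2) by (intro AE_I2) (simp add: w_def ennreal_leI)
    show "AE y in ?M. (\<lambda>N. ennreal (rescaled_weight (Suc N) y)) \<longlonglongrightarrow> ennreal (L y)"
      using L(1) by (intro AE_I2 tendsto_ennrealI) (rule LIMSEQ_Suc)
  qed (use wfin in auto)
  have Lfin: "(\<integral>\<^sup>+y. ennreal (L y) \<partial>?M) < \<infinity>"
  proof -
    have "ennreal (L y) \<le> w y" for y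
      unfolding w_def using c(2) by (intro ennreal_leI LIMSEQ_le_const2[OF L(1)] exI[of _ 1]) auto
    then have "(\<integral>\<^sup>+y. ennreal (L y) \<partial>?M) \<le> (\<integral>\<^sup>+y. w y \<partial>?M)" by (intro nn_integral_mono)
    then show ?thesis using wfin by (rule le_less_trans)
  qed
  have Lpos: "(\<integral>\<^sup>+y. ennreal (L y) \<partial>?M) > 0"
  proof (rule ccontr)
    assume "\<not> ?thesis"
    then have "(\<integral>\<^sup>+y. ennreal (L y) \<partial>?M) = 0" by simp
    then have "AE y in ?M. ennreal (L y) = 0" by (subst (asm) nn_integral_0_iff_AE) auto
    then have "AE y in ?M. False"
    proof eventually_elim
      case (elim y)
      then show ?case using L(2)[of y] by (simp add: ennreal_eq_0_iff)
    qed
    \<comment> \<open>The measure of the unit cube is 1, so the underlying space is not a null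
      set.\<close>
    then have "emeasure ?M (Pi\<^sub>E J (\<lambda>_. {0..1})) = emeasure ?M {}"
      by (intro emeasure_eq_AE sets_PiM_I_finite) auto
    moreover have "emeasure ?M (Pi\<^sub>E J (\<lambda>_. {0..1})) = 1"
      by (subst emeasure_PiM) auto
    ultimately show False by simp
  qed
  define \<kappa> where "\<kappa> = enn2real (\<integral>\<^sup>+y. ennreal (L y) \<partial>?M)"
  have \<kappa>: "\<kappa> > 0" using Lpos Lfin by (simp add: \<kappa>_def enn2real_positive_iff)
  have "(\<lambda>N. enn2real (I (Suc N))) \<longlonglongrightarrow> \<kappa>"
    unfolding \<kappa>_def using lim Lfin by (intro tendsto_enn2real) auto
  moreover have "enn2real (I (Suc N)) =
      enn2real (slice_integral C n (Suc N)) * sqrt (real (Suc N)) ^ card J / (Emax / 4 ^ n) ^ Suc N" for N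
  proof -
    let ?a = "(Emax / 4 ^ n) ^ Suc N" and ?b = "(1 / sqrt (real (Suc N))) ^ card J"
    have a: "?a > 0" using Emax_gt_0 by simp
    then have ab: "?a * ?b \<ge> 0" by (intro mult_nonneg_nonneg less_imp_le[OF a]) auto
    have "enn2real (slice_integral C n (Suc N)) = ?a * ?b * enn2real (I (Suc N))"
      unfolding slice_integral_rescaled[OF zero_less_Suc] I_def
      by (simp only: enn2real_mult enn2real_ennreal[OF ab])
    moreover have "?b * sqrt (real (Suc N)) ^ card J = 1"
      by (simp add: power_mult_distrib[symmetric] del: power_mult_distrib of_nat_Suc)
    moreover have "x * b * e * s / x = e" if "x > 0" "b * s = 1" for x b e s :: real
    proof -
      have "x * b * e * s / x = x * e * (b * s) / x" by (simp add: mult_ac)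
      then show ?thesis using that by simp
    qed
    ultimately show ?thesis using a by (simp only:)
  qed
  ultimately have "(\<lambda>N. enn2real (slice_integral C n (Suc N)) * sqrt (real (Suc N)) ^ card J /
      (Emax / 4 ^ n) ^ Suc N) \<longlonglongrightarrow> \<kappa>" by simp
  then have "(\<lambda>N. enn2real (slice_integral C n N) * sqrt (real N) ^ card J / (Emax / 4 ^ n) ^ N) \<longlonglongrightarrow> \<kappa>"
    by (rule LIMSEQ_imp_Suc)
  then show ?thesis using \<kappa> by blast
qed

end

section \<open>Volume ratios\<close>

lemma slice_maximum_exists:
  assumes "moment_constraint C" "last_index C \<le> n"
    and "\<mu> \<in> constrained_measures C {0..1}" "mErr (\<lambda>j. moment j \<mu>) n > 0"
  shows "\<exists>p. slice_maximum C n p"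
  by (rule maximiser_poly[OF assms]) (rule exI, rule slice_maximum.intro, (rule assms | assumption)+)

text \<open>All trigonometric moments of positive order vanish, hence so do all
  coefficients.\<close>

lemma mErr_arcsine: "mErr (\<lambda>j. moment j arcsine) n = 1"
proof -
  have t: "trig_moment (\<lambda>j. moment j arcsine) (Suc k) = 0" for k
  proof -
    have "trig_moment (\<lambda>j. moment j arcsine) (Suc k) = (\<integral>x. Re (circ x ^ Suc k) \<partial>arcsine)"
      by (rule trig_moment_measure[OF arcsine_in_moment_measures, of "Suc k"]) auto
    also have "\<dots> = Re (0 ^ Suc k)"
      by (rule arcsine_mean_value) (auto intro!: continuous_intros holomorphic_intros)
    finally show ?thesis by simp
  qed
  have "mverb (\<lambda>j. moment j arcsine) n = 0" for n by (simp add: mverb_def verb_def t)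
  then show ?thesis by (induction n) (simp_all add: mErr_Suc)
qed

section \<open>Size of the Beta integrals\<close>

lemma canonical_weight_finite: "canonical_weight N < \<infinity>"
proof -
  have "canonical_weight N \<le> (\<integral>\<^sup>+a. indicator {-1..1::real} a \<partial>lborel)"
    unfolding canonical_weight_def
  proof (rule nn_integral_mono)
    fix a :: real
    show "indicator {-1..1} a * ennreal (1 / 2 * ((1 - a\<^sup>2) / 4) ^ N) \<le> indicator {-1..1} a"
    proof (cases "a \<in> {-1..1}")
      case True
      then have "a\<^sup>2 \<le> 1" by (simp add: abs_square_le_1 abs_le_iff)
      have "a\<^sup>2 \<ge> 0" by simp
      have "0 \<le> (1 - a\<^sup>2) / 4" using \<open>a\<^sup>2 \<le> 1\<close> by simp
      moreover have "(1 - a\<^sup>2) / 4 \<le> 1 / 4"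
        using \<open>a\<^sup>2 \<ge> 0\<close> by (intro divide_right_mono) simp_all
      then have "(1 - a\<^sup>2) / 4 \<le> 1" by (rule order_trans) simp
      ultimately have "((1 - a\<^sup>2) / 4) ^ N \<le> 1" by (rule power_le_one)
      then have "ennreal (1 / 2 * ((1 - a\<^sup>2) / 4) ^ N) \<le> ennreal 1" by (intro ennreal_leI) simp
      then show ?thesis using True by simp
    qed simp
  qed
  also have "\<dots> < \<infinity>" by simp
  finally show ?thesis .
qed

lemma canonical_weight_pos: "canonical_weight N > 0"
proof -
  \<comment> \<open>The constant 3/16 is the minimum of (1 - a^2) / 4 on the chosen interval,
    attained at a = 1/2.\<close>
  have "(\<integral>\<^sup>+a. ennreal (1 / 2 * (3 / 16) ^ N) * indicator {0..1/2::real} a \<partial>lborel) \<le> canonical_weight N"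
    unfolding canonical_weight_def
  proof (rule nn_integral_mono)
    fix a :: real
    show "ennreal (1 / 2 * (3 / 16) ^ N) * indicator {0..1/2} a \<le>
        indicator {-1..1} a * ennreal (1 / 2 * ((1 - a\<^sup>2) / 4) ^ N)"
    proof (cases "a \<in> {0..1/2}")
      case True
      then have "a\<^sup>2 \<le> (1 / 2)\<^sup>2" by (intro power_mono) auto
      then have "(3 / 16) ^ N \<le> ((1 - a\<^sup>2) / 4) ^ N" by (intro power_mono) (auto simp: power2_eq_square)
      then show ?thesis using True by (simp add: ennreal_leI)
    qed simp
  qed
  moreover have "(\<integral>\<^sup>+a. ennreal (1 / 2 * (3 / 16) ^ N) * indicator {0..1/2::real} a \<partial>lborel) > 0"
    by (simp add: nn_integral_cmult ennreal_mult[symmetric] ennreal_zero_less_mult_iff ennreal_inverse_positive)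
  ultimately show ?thesis by (rule less_le_trans[rotated])
qed

text \<open>Instead of Stirling's formula, the slice asymptotics are applied without constraints at
  order 1: there the slice integral is exactly this weight, with one free coordinate and maximal
  range 1/4.\<close>

lemma canonical_weight_asymptotics:
  "\<exists>\<beta>>0. (\<lambda>N. enn2real (canonical_weight N) * sqrt (real N) * 4 ^ N) \<longlonglongrightarrow> \<beta>"
proof -
  let ?C = "Map.empty :: nat \<rightharpoonup> real"
  have C0: "moment_constraint ?C" "last_index ?C = 0"
    by (simp_all add: moment_constraint_def last_index_def)
  have arc: "arcsine \<in> constrained_measures ?C {0..1}"
    using arcsine_in_moment_measures by (simp add: constrained_measures_def)
  obtain p where "slice_maximum ?C 1 p"
    using slice_maximum_exists[OF C0(1) _ arc, of 1] C0(2) by (auto simp: mErr_arcsine)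
  then interpret slice_maximum ?C 1 p .
  have cardJ: "card (free_coordinates ?C (Suc 0)) = 1" by (simp add: free_coordinates_def)
  have "Emax = 1"
  proof (rule antisym)
    show "Emax \<le> 1" unfolding Emax_def
      using moment_measure by (intro mErr_le_1[of 1]) (auto simp: is_moments_def m\<^sub>0_def)
    obtain c where c: "c > 0" "\<And>m. satisfies ?C m \<Longrightarrow> (\<forall>j\<le>1. mErr m j > 0) \<Longrightarrow>
       ln (mErr m 1) \<le> ln Emax - c * (\<Sum>j\<in>J. (m j - m\<^sub>0 j)\<^sup>2)"
      using quadratic_bound by blast
    \<comment> \<open>The arcsine law has error 1 and is tested in the quadratic bound.\<close>
    have "ln 1 \<le> ln Emax - c * (\<Sum>j\<in>J. (moment j arcsine - m\<^sub>0 j)\<^sup>2)"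
      using c(2)[of "\<lambda>j. moment j arcsine"] by (simp add: satisfies_def mErr_arcsine)
    also have "\<dots> \<le> ln Emax" using c(1) by (simp add: sum_nonneg)
    finally show "1 \<le> Emax" using Emax_gt_0 by simp
  qed
  moreover have "slice_integral ?C 1 N = canonical_weight N" for N
    using slice_integral_unfold[OF C0(1), of 1 N] slice_integral_empty[of "Suc N"] C0(2) by simp
  ultimately show ?thesis
    using slice_integral_asymptotics cardJ by (simp add: power_one_over)
qed

text \<open>The numerator contains the weights of order below N, the denominator those of order
  below N + i; only the i topmost survive the division.\<close>

lemma volume_ratio_eq:
  assumes C: "moment_constraint C"
  defines "i \<equiv> last_index C"
  shows "volume_ratio C (N + i) =
    enn2real (slice_integral C i N) / (\<Prod>l<i. enn2real (canonical_weight (N + l)))"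
proof -
  let ?w = "\<lambda>l. enn2real (canonical_weight l)"
  have w: "?w l > 0" for l
    using canonical_weight_pos canonical_weight_finite by (simp add: enn2real_positive_iff)
  have pr: "enn2real (\<Prod>l<m. canonical_weight l) = (\<Prod>l<m. ?w l)" for m
    by (induction m) (simp_all add: enn2real_mult)
  have "constrained_volume C (N + i) = (\<Prod>l<N. ?w l) * enn2real (slice_integral C i N)"
    using constrained_volume_eq[OF C, of "i + N"] slice_integral_unfold[OF C, of N 0] pr[of N]
    by (simp add: i_def enn2real_mult add.commute)
  moreover have "vol {1..N + i} (moment_space (N + i) {0..1}) = (\<Prod>l<N. ?w l) * (\<Prod>l<i. ?w (N + l))"
  proof -
    have "(\<Prod>l<N + i. ?w l) = (\<Prod>l<N. ?w l) * (\<Prod>l<i. ?w (N + l))"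
      by (induction i) (simp_all add: mult.assoc)
    then show ?thesis by (simp only: moment_space_volume pr)
  qed
  moreover have "(\<Prod>l<N. ?w l) \<noteq> 0" using w by (simp add: less_imp_neq[symmetric])
  ultimately show ?thesis by (simp add: volume_ratio_def)
qed

text \<open>Only the existence of a positive limit matters here: every constant is absorbed in \<open>d\<close>.\<close>

lemma volume_ratio_limit:
  assumes "slice_maximum C (last_index C) p"
  defines "i \<equiv> last_index C" and "k \<equiv> num_constraints C"
  defines "E \<equiv> slice_maximum.Emax (last_index C) p"
  shows "\<exists>a>0. (\<lambda>N. volume_ratio C (N + i) / ((E / 4 ^ i) ^ N * (4 ^ i) ^ N * sqrt (real N) ^ k)) \<longlonglongrightarrow> a"
proof -
  interpret slice_maximum C i p using assms(1) by (simp add: i_def)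
  let ?w = "\<lambda>l. enn2real (canonical_weight l)"
  define R where "R = E / 4 ^ i"
  have E: "E = Emax" by (simp add: E_def i_def)
  have R: "R > 0" using Emax_gt_0 by (simp add: R_def E)
  obtain \<kappa> where \<kappa>: "\<kappa> > 0"
    "(\<lambda>N. enn2real (slice_integral C i N) * sqrt (real N) ^ card J / R ^ N) \<longlonglongrightarrow> \<kappa>"
    using slice_integral_asymptotics by (auto simp: R_def E)
  obtain \<beta> where \<beta>: "\<beta> > 0" "(\<lambda>N. ?w N * sqrt (real N) * 4 ^ N) \<longlonglongrightarrow> \<beta>"
    using canonical_weight_asymptotics by blast
  have v: "(\<lambda>N. ?w (N + l) * sqrt (real N) * 4 ^ N) \<longlonglongrightarrow> \<beta> / 4 ^ l" for l
  proof -
    have "(\<lambda>N. sqrt (real N) / sqrt (real (N + l))) \<longlonglongrightarrow> 1" by real_asymp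
    from tendsto_mult[OF LIMSEQ_ignore_initial_segment[OF \<beta>(2), of l] this]
    have "(\<lambda>N. ?w (N + l) * sqrt (real (N + l)) * 4 ^ (N + l) * (sqrt (real N) / sqrt (real (N + l))) / 4 ^ l) \<longlonglongrightarrow> \<beta> * 1 / 4 ^ l"
      by (rule tendsto_divide[OF _ tendsto_const]) simp
    moreover have "eventually (\<lambda>N. ?w (N + l) * sqrt (real (N + l)) * 4 ^ (N + l) * (sqrt (real N) / sqrt (real (N + l))) / 4 ^ l =
        ?w (N + l) * sqrt (real N) * 4 ^ N) sequentially"
      using eventually_gt_at_top[of 0] by eventually_elim (simp add: power_add)
    ultimately show ?thesis by (simp add: Lim_transform_eventually)
  qed
  have lim: "(\<lambda>N. (enn2real (slice_integral C i N) * sqrt (real N) ^ card J / R ^ N) /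
      (\<Prod>l<i. ?w (N + l) * sqrt (real N) * 4 ^ N)) \<longlonglongrightarrow> \<kappa> / (\<Prod>l<i. \<beta> / 4 ^ l)"
    using \<beta>(1) by (intro tendsto_divide \<kappa>(2) tendsto_prod v) auto
  have dom: "dom C \<subseteq> {1..i}" using last_index_ge[OF C] by (simp add: i_def subset_eq)
  \<comment> \<open>The weights contribute i factors sqrt N and the slice only i - k; the surplus is
    the factor sqrt N ^ k.\<close>
  have cardJ: "card J + k = i"
  proof -
    have "card J = i - k"
      using dom by (simp add: free_coordinates_def k_def num_constraints_def card_Diff_subset finite_subset[OF dom])
    moreover have "k \<le> i" using card_mono[OF _ dom] by (simp add: k_def num_constraints_def)
    ultimately show ?thesis by simp
  qed
  have "eventually (\<lambda>N. (enn2real (slice_integral C i N) * sqrt (real N) ^ card J / R ^ N) /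
      (\<Prod>l<i. ?w (N + l) * sqrt (real N) * 4 ^ N) =
      volume_ratio C (N + i) / (R ^ N * (4 ^ i) ^ N * sqrt (real N) ^ k)) sequentially"
    using eventually_gt_at_top[of 0]
  proof eventually_elim
    case (elim N)
    define s P S where "s = sqrt (real N)" and "P = (\<Prod>l<i. ?w (N + l))" and "S = enn2real (slice_integral C i N)"
    have s: "s > 0" using elim by (simp add: s_def)
    have "(\<Prod>l<i. ?w (N + l) * s * 4 ^ N) = P * s ^ i * (4 ^ N) ^ i"
      by (simp add: prod.distrib P_def)
    also have "\<dots> = P * (s ^ card J * s ^ k) * (4 ^ i) ^ N"
      by (simp add: power_add[symmetric] cardJ power_mult[symmetric] mult.commute[of N])
    finally have pr: "(\<Prod>l<i. ?w (N + l) * s * 4 ^ N) = P * (s ^ card J * s ^ k) * (4 ^ i) ^ N" .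
    have "(S * s ^ card J / R ^ N) / (P * (s ^ card J * s ^ k) * (4 ^ i) ^ N) = S / P / (R ^ N * (4 ^ i) ^ N * s ^ k)"
      using s by simp
    then show ?case
      using volume_ratio_eq[OF C, of N] by (simp only: pr s_def[symmetric] S_def[symmetric] P_def[symmetric] i_def[symmetric])
  qed
  with lim have "(\<lambda>N. volume_ratio C (N + i) / (R ^ N * (4 ^ i) ^ N * sqrt (real N) ^ k)) \<longlonglongrightarrow> \<kappa> / (\<Prod>l<i. \<beta> / 4 ^ l)"
    by (rule Lim_transform_eventually)
  moreover have "\<kappa> / (\<Prod>l<i. \<beta> / 4 ^ l) > 0" using \<kappa>(1) \<beta>(1) by (intro divide_pos_pos prod_pos) auto
  ultimately show ?thesis unfolding R_def by blast
qed

lemma power_times_powr_bigo: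
  fixes q a :: real
  assumes "0 < q" "q < 1" "0 \<le> a"
  shows "\<exists>c>0. (\<lambda>n. q ^ n * real n powr a) \<in> O(\<lambda>n. exp (- c * real n))"
proof -
  \<comment> \<open>Half the exponential rate is sacrificed to absorb the power of n.\<close>
  define c where "c = - ln q / 2"
  have c: "c > 0" using assms by (simp add: c_def)
  have q: "q ^ n = exp (- (2 * c) * real n)" for n
    using assms(1) by (simp add: c_def mult.commute exp_of_nat_mult)
  have "(\<lambda>n. exp (- (2 * c) * real n) * real n powr a) \<in> O(\<lambda>n. exp (- c * real n))"
    using c assms(3) by real_asymp
  then show ?thesis using c by (auto simp: q)
qed

theorem theorem2p4:
  fixes C :: "nat \<rightharpoonup> real" and k i :: nat
  defines "k \<equiv> num_constraints C" and "i \<equiv> last_index C"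
  assumes "moment_constraint C" and "admissible C {0..1}"
  shows "(\<exists>d>0. volume_ratio C \<sim>[at_top]
            (\<lambda>n. (moment_range i (entropy_minimizer C) ^ (n - i)
                    * real n powr (real k / 2) * (2 * pi) powr (real k / 2) / sqrt d)
                 / (4 powr (- (real i * (real i - 3) / 2)) * 4 powr (- (real i * real n))
                    * sqrt (pi / 4) ^ i)))
       \<and> (arcsine \<notin> constrained_measures C {0..1} \<longrightarrow>
            (\<exists>c>0. volume_ratio C \<in> O(\<lambda>n. exp (- c * real n))))
       \<and> (arcsine \<in> constrained_measures C {0..1} \<longrightarrow>
            volume_ratio C \<in> O(\<lambda>n. real n powr (real k / 2)))"
proof -
  note C = assms(3)
  obtain \<mu> where \<mu>: "\<mu> \<in> constrained_measures C {0..1}" "mErr (\<lambda>j. moment j \<mu>) i > 0"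
    using admissible_imp_mErr_pos[OF assms(4)] by (auto simp: i_def)
  obtain p where p: "slice_maximum C i p"
    using slice_maximum_exists[OF C _ \<mu>] by (auto simp: i_def)
  then interpret slice_maximum C i p .
  define R where "R = Emax / 4 ^ i"
  have R: "R > 0" using Emax_gt_0 by (simp add: R_def)
  have em: "entropy_minimizer C = inv_poly_measure p"
    by (rule entropy_minimizer_eq[OF pos mem integral_one])
  have range: "moment_range i (entropy_minimizer C) = R"
    unfolding em R_def using moment_range_eq[OF moment_measure Emax_pos] by (simp add: Emax_def m\<^sub>0_def[abs_def])
  obtain a where a: "a > 0"
    "(\<lambda>N. volume_ratio C (N + i) / (R ^ N * (4 ^ i) ^ N * sqrt (real N) ^ k)) \<longlonglongrightarrow> a"
    using volume_ratio_limit[of C p] p by (auto simp: i_def k_def R_def)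
  \<comment> \<open>Passing from N = n - i to n: sqrt (n - i) / sqrt n tends to 1, and the power of
    4 changes by the constant (4^i)^i.\<close>
  have lim: "(\<lambda>n. volume_ratio C n / (R ^ (n - i) * (4 ^ i) ^ n * real n powr (real k / 2))) \<longlonglongrightarrow> a / (4 ^ i) ^ i"
  proof (rule LIMSEQ_offset[of _ i])
    have "(\<lambda>N. (sqrt (real N) / sqrt (real (N + i))) ^ k) \<longlonglongrightarrow> 1 ^ k"
      by (intro tendsto_power) real_asymp
    from tendsto_mult[OF a(2) this]
    have "(\<lambda>N. volume_ratio C (N + i) / (R ^ N * (4 ^ i) ^ N * sqrt (real N) ^ k) *
        (sqrt (real N) / sqrt (real (N + i))) ^ k / (4 ^ i) ^ i) \<longlonglongrightarrow> a * 1 ^ k / (4 ^ i) ^ i"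
      by (rule tendsto_divide[OF _ tendsto_const]) simp
    moreover have "eventually (\<lambda>N. volume_ratio C (N + i) / (R ^ N * (4 ^ i) ^ N * sqrt (real N) ^ k) *
        (sqrt (real N) / sqrt (real (N + i))) ^ k / (4 ^ i) ^ i =
        volume_ratio C (N + i) / (R ^ (N + i - i) * (4 ^ i) ^ (N + i) * real (N + i) powr (real k / 2))) sequentially"
      using eventually_gt_at_top[of 0]
    proof eventually_elim
      case (elim N)
      have "real (N + i) powr (real k / 2) = sqrt (real (N + i)) ^ k"
        using elim by (simp add: powr_half_sqrt[symmetric] powr_power)
      moreover have "v / (r * f * s ^ k) * (s / t) ^ k / g = v / (r * (f * g) * t ^ k)"
        if "s > 0" for v r f g s t :: real
        using that by (simp add: power_divide)
      ultimately show ?case using elim by (simp only: power_add diff_add_inverse2) simp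
    qed
    ultimately show "(\<lambda>N. volume_ratio C (N + i) / (R ^ (N + i - i) * (4 ^ i) ^ (N + i) * real (N + i) powr (real k / 2)))
        \<longlonglongrightarrow> a / (4 ^ i) ^ i"
      by (simp add: Lim_transform_eventually)
  qed
  define b where "b = a / (4 ^ i) ^ i"
  have b: "b > 0" using a(1) by (simp add: b_def)
  define G where "G n = R ^ (n - i) * (4 ^ i) ^ n * real n powr (real k / 2)" for n
  have lim: "(\<lambda>n. volume_ratio C n / G n) \<longlonglongrightarrow> b" using lim by (simp add: G_def b_def)
  have G_nz: "eventually (\<lambda>n. G n \<noteq> 0) sequentially"
    using eventually_gt_at_top[of 0] by eventually_elim (use R in \<open>simp add: G_def\<close>)
  have bigo: "volume_ratio C \<in> O(G)"
    using lim G_nz by (rule bigoI_tendsto)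
  define K where "K = (2 * pi) powr (real k / 2) / (4 powr (- (real i * (real i - 3) / 2)) * sqrt (pi / 4) ^ i)"
  have K: "K > 0" by (simp add: K_def)
  \<comment> \<open>\<open>K\<close> collects all constant factors of the claimed formula, and
    \<open>d\<close> solves K / sqrt d = b for the limit b found above.\<close>
  define d where "d = (K / b)\<^sup>2"
  have d: "d > 0" "sqrt d = K / b" using K b by (simp_all add: d_def)
  have T: "(moment_range i (entropy_minimizer C) ^ (n - i)
        * real n powr (real k / 2) * (2 * pi) powr (real k / 2) / sqrt d)
     / (4 powr (- (real i * (real i - 3) / 2)) * 4 powr (- (real i * real n)) * sqrt (pi / 4) ^ i) = b * G n" for n
  proof -
    have "4 powr (- (real i * real n)) = 1 / (4 ^ i) ^ n"
      by (simp add: powr_minus_divide power_mult[symmetric] powr_realpow[symmetric] powr_powr)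
    moreover have "x * y * u / (u / (v * w) / b) / (v * (1 / f) * w) = b * (x * f * y)"
      if "u > 0" "v > 0" "w > 0" "f > 0" for x y u v w f :: real
      using that b by (simp add: field_simps)
    ultimately show ?thesis unfolding range d(2) K_def G_def by simp
  qed
  have "volume_ratio C \<sim>[at_top] (\<lambda>n. b * G n)"
  proof (rule asymp_equivI')
    have "(\<lambda>n. volume_ratio C n / G n / b) \<longlonglongrightarrow> b / b" using b by (intro tendsto_intros lim) auto
    then show "(\<lambda>n. volume_ratio C n / (b * G n)) \<longlonglongrightarrow> 1" using b by (simp add: mult.commute)
  qed
  then have 1: "\<exists>d>0. volume_ratio C \<sim>[at_top]
            (\<lambda>n. (moment_range i (entropy_minimizer C) ^ (n - i)
                    * real n powr (real k / 2) * (2 * pi) powr (real k / 2) / sqrt d)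
                 / (4 powr (- (real i * (real i - 3) / 2)) * 4 powr (- (real i * real n))
                    * sqrt (pi / 4) ^ i))"
    using d(1) by (intro exI[of _ d]) (simp only: T simp_thms)
  \<comment> \<open>The powers of 4 cancel against those in R = Emax / 4^i, so the exponential rate
    of the ratio is \<open>Emax\<close>.\<close>
  have G_eq: "eventually (\<lambda>n. G n = 1 / R ^ i * (Emax ^ n * real n powr (real k / 2))) sequentially"
    using eventually_ge_at_top[of i]
  proof eventually_elim
    case (elim n)
    have "R ^ (n - i) = R ^ n / R ^ i" using R elim by (simp add: power_diff)
    moreover have "R ^ n * (4 ^ i) ^ n = Emax ^ n" by (simp add: R_def power_mult_distrib[symmetric] del: power_mult_distrib)
    ultimately show ?case by (simp add: G_def field_simps)
  qed
  have G_bigo: "G \<in> O(\<lambda>n. Emax ^ n * real n powr (real k / 2))"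
    using R by (subst landau_o.big.in_cong[OF G_eq]) simp
  have Emax_le: "Emax \<le> 1"
    unfolding Emax_def using moment_measure by (intro mErr_le_1[of i]) (auto simp: is_moments_def m\<^sub>0_def)
  have 2: "\<exists>c>0. volume_ratio C \<in> O(\<lambda>n. exp (- c * real n))" if "arcsine \<notin> constrained_measures C {0..1}"
  proof -
    \<comment> \<open>If \<open>Emax\<close> were 1, the minimiser would have relative entropy 0,
      just as the arcsine law has relative to itself. Uniqueness with the constant polynomial 1
      would identify the two, and the arcsine law would satisfy the constraint.\<close>
    have "Emax \<noteq> 1"
    proof
      assume "Emax = 1"
      have one: "pos_poly 1" "inv_poly_measure 1 = arcsine"
        by (simp_all add: pos_poly_def inv_poly_measure_def density_1)
      have "rel_entropy arcsine (inv_poly_measure p) = ereal (- ln Emax)"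
        using rel_entropy_inv_poly_measure[OF pos moment_measure] ln_Emax by (simp add: Emax_def m\<^sub>0_def[abs_def])
      moreover have "rel_entropy arcsine (inv_poly_measure 1) = ereal 0"
        using rel_entropy_inv_poly_measure[OF one(1)] arcsine_in_moment_measures by (simp add: one(2))
      moreover have "(\<integral>x. poly 1 x \<partial>inv_poly_measure p) = 1"
        using prob_space.prob_space[OF moment_measuresD(1)[OF moment_measure]] by simp
      ultimately have "inv_poly_measure p = inv_poly_measure 1"
        using one arcsine_in_moment_measures \<open>Emax = 1\<close>
        by (intro inv_poly_measure_unique moment_measure) auto
      then show False using that mem one(2) by simp
    qed
    then have "Emax < 1" using Emax_le by simp
    then obtain c where "c > 0" "(\<lambda>n. Emax ^ n * real n powr (real k / 2)) \<in> O(\<lambda>n. exp (- c * real n))"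
      using power_times_powr_bigo[OF Emax_gt_0, of "real k / 2"] by auto
    then show ?thesis using landau_o.big_trans[OF landau_o.big_trans[OF bigo G_bigo]] by blast
  qed
  have "(\<lambda>n. Emax ^ n * real n powr (real k / 2)) \<in> O(\<lambda>n. real n powr (real k / 2))"
    using Emax_le Emax_gt_0 by (intro landau_o.big_mono always_eventually) (auto simp: power_le_one mult_left_le_one_le)
  then have 3: "volume_ratio C \<in> O(\<lambda>n. real n powr (real k / 2))"
    using landau_o.big_trans[OF landau_o.big_trans[OF bigo G_bigo]] by blast
  show ?thesis using 1 2 3 by blast
qed

end
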